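(* Let $K\subset\mathbb{R}^n$ be a convex body and $C=\frac12(K+(-K))$ its central symmetral. For $k=1,\ldots,n$, the defect $\mathcal A_k(K)=W_{n-k}(C)-W_{n-k}(K)$ satisfies $$\mathcal A_k(K)=\frac{\kappa_n}{\kappa_k}\int_{\mathrm{Gr}(n,k)}\left[\mathrm{Vol}_k\left(\frac{K|E+(-(K|E))}{2}\right)-\mathrm{Vol}_k(K|E)\right]\,\mathrm{d}E.$$
   Context: A convex body in $\mathbb{R}^n$ is a compact convex set with non-empty interior. $B^n$ is the Euclidean unit ball and $\kappa_n=\mathrm{Vol}_n(B^n)$. $V$ is the mixed volume, normalized by $V(K,\ldots,K)=\mathrm{Vol}_n(K)$, and the quermassintegrals are $W_j(K)=V(K^{[n-j]},(B^n)^{[j]})$, where $[r]$ denotes repetition $r$ times. $\mathrm{Gr}(n,k)$ is the Grassmannian of $k$-dimensional linear subspaces of $\mathbb{R}^n$ with its rotation-invariant probability measure $\mathrm{d}E$, and $K|E$ is the orthogonal projection of $K$ onto $E$; $\mathrm{Vol}_k$ is $k$-dimensional volume in $E$. *)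

theory Defs
  imports "HOL-Probability.Probability" "HOL-Library.Set_Algebras" "HOL-Combinatorics.Permutations"
begin

text \<open>Throughout, \<open>+\<close> and \<open>\<Sum>\<close> on sets are Minkowski sums (from \<open>Set_Algebras\<close>).
  The unary minus on sets is the complement in HOL, so the reflection \<open>-K\<close> is
  written \<open>uminus ` K\<close>.\<close>

definition convex_body :: "'a::euclidean_space set \<Rightarrow> bool" where
  "convex_body K \<longleftrightarrow> compact K \<and> convex K \<and> interior K \<noteq> {}"

definition central_symmetral :: "'a::real_vector set \<Rightarrow> 'a set" where
  "central_symmetral K = (\<lambda>x. (1/2) *\<^sub>R x) ` (K + uminus ` K)"

section \<open>Mixed volumes and quermassintegrals\<close>

text \<open>Minkowski's expansion for \<open>n\<close> bodies \<open>K 0, \<dots>, K (n - 1)\<close> in \<open>n\<close>-dimensional space, over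
  all \<open>l 0, \<dots>, l (n - 1) \<ge> 0\<close>:
  \[ Vol (l_0 K_0 + \dots + l_{n-1} K_{n-1})
       = \sum_{f_0,\dots,f_{n-1}} c_{f_0 \dots f_{n-1}} \, l_{f_0} \cdots l_{f_{n-1}}, \]
  with coefficients symmetric in their indices. An index tuple is a function \<open>f\<close> on
  \<open>{..<n}\<close>. Symmetry determines \<open>c\<close> on all index tuples; the coefficient
  \<open>c f\<close> is the mixed volume of \<open>K (f 0), \<dots>, K (f (n - 1))\<close>.\<close>

definition minkowski_coefficients ::
    "(nat \<Rightarrow> (real ^ 'n) set) \<Rightarrow> ((nat \<Rightarrow> nat) \<Rightarrow> real) \<Rightarrow> bool" where
  "minkowski_coefficients K c \<longleftrightarrow>
     (let n = CARD('n); F = {..<n} \<rightarrow>\<^sub>E {..<n} in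
       (\<forall>f\<in>F. \<forall>p. p permutes {..<n} \<longrightarrow> c (f \<circ> p) = c f) \<and>
       (\<forall>l. (\<forall>i<n. 0 \<le> l i) \<longrightarrow>
          measure lborel (\<Sum>i<n. (\<lambda>x. l i *\<^sub>R x) ` K i) = (\<Sum>f\<in>F. c f * (\<Prod>i<n. l (f i)))))"

definition mixed_volume :: "(nat \<Rightarrow> (real ^ 'n) set) \<Rightarrow> real" where
  "mixed_volume K =
     (THE v. \<exists>c. minkowski_coefficients K c \<and> v = c (\<lambda>i\<in>{..<CARD('n)}. i))"

definition quermassintegral :: "nat \<Rightarrow> (real ^ 'n) set \<Rightarrow> real" where
  "quermassintegral j K = mixed_volume (\<lambda>i. if i < CARD('n) - j then K else cball 0 1)"

definition symmetrization_defect :: "nat \<Rightarrow> (real ^ 'n) set \<Rightarrow> real" where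
  "symmetrization_defect k K =
     quermassintegral (CARD('n) - k) (central_symmetral K) - quermassintegral (CARD('n) - k) K"

section \<open>Projections and volume in subspaces\<close>

definition orth_proj :: "'a::euclidean_space set \<Rightarrow> 'a \<Rightarrow> 'a" where
  "orth_proj E x = (THE y. y \<in> E \<and> (\<forall>z\<in>E. orthogonal (x - y) z))"

definition orthonormal_basis_of :: "'a::euclidean_space set \<Rightarrow> 'a set \<Rightarrow> bool" where
  "orthonormal_basis_of E B \<longleftrightarrow>
     pairwise orthogonal B \<and> (\<forall>b\<in>B. norm b = 1) \<and> span B = E"

text \<open>Lebesgue measure of a linear subspace \<open>E\<close>, as a Borel measure on the ambient space
  concentrated on \<open>E\<close>: the construction of \<^const>\<open>lborel\<close> with \<^const>\<open>Basis\<close> replaced by an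
  orthonormal basis of \<open>E\<close>. The measure does not depend on the basis chosen.\<close>

definition subspace_lborel :: "'a::euclidean_space set \<Rightarrow> 'a measure" where
  "subspace_lborel E =
     (let B = (SOME B. orthonormal_basis_of E B)
      in distr (\<Pi>\<^sub>M b\<in>B. lborel) borel (\<lambda>f. \<Sum>b\<in>B. f b *\<^sub>R b))"

section \<open>The Grassmannian\<close>

definition Gr :: "nat \<Rightarrow> (real ^ 'n) set set" where
  "Gr k = {E. subspace E \<and> dim E = k}"

text \<open>The Borel sets of the Grassmannian: its topology is the one induced by identifying a
  subspace with the matrix of the orthogonal projection onto it.\<close>

definition Gr_borel :: "nat \<Rightarrow> (real ^ 'n) set measure" where
  "Gr_borel k = vimage_algebra (Gr k) (\<lambda>E. matrix (orth_proj E)) (borel :: (real ^ 'n ^ 'n) measure)"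

definition Gr_measure :: "nat \<Rightarrow> (real ^ 'n) set measure" where
  "Gr_measure k =
     (THE M. sets M = sets (Gr_borel k) \<and> prob_space M \<and>
        (\<forall>Q :: real ^ 'n ^ 'n. rotation_matrix Q \<longrightarrow> distr M (Gr_borel k) (\<lambda>E. (*v) Q ` E) = M))"

end

(* Adding a segment increases the volume of a convex body affinely in its length, so the volume of K
   plus a zonotope is multi-affine in the lengths of its generators; comparing growth rates, each
   coefficient is the volume of a parallelotope times the volume of the projection of K onto the
   orthogonal complement of its span. Averages of independent random segments with a rotation
   invariant law converge to a ball by the law of large numbers. Taking expectations therefore gives
   Steiner's formula, with coefficients that are averages of projection volumes over the law of a
   random subspace. This law is rotation invariant, hence the invariant measure of the Grassmannian,
   and the case of K a ball determines all constants; this is Kubota's formula. Orthogonal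
   projections commute with central symmetrization, so the theorem is the difference of Kubota's
   formula for C and for K. *)
theory Submission
  imports Defs
begin

text \<open>Mixed volumes and the measure on the Grassmannian are definite descriptions, so nothing
  can be computed from them before existence and uniqueness are known. Random zonotopes settle
  existence in both cases. For mixed volumes, Steiner's formula yields explicit Minkowski
  coefficients for families made up of K and the unit ball, the only families that quermassintegrals
  involve; Minkowski's theorem for arbitrary bodies does not enter. For the Grassmannian, the
  complement of the span of n - k random generators, taken under a suitable density, realises the
  invariant measure, so no Haar measure on the rotation group is constructed. The density is
  proportional to the volume of the parallelotope of the generators. This is exactly the factor that
  accompanies the projection volume in each coefficient, so a weighted average over generators
  becomes a plain average over subspaces. Uniqueness uses a metric criterion: two probability
  measures agree if each gives equal mass to all balls of equal radius centred at projection
  matrices. Uniqueness of mixed volumes is inclusion-exclusion on the index tuples.\<close>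

abbreviation vol :: "'a::euclidean_space set \<Rightarrow> real" where
  "vol \<equiv> measure lborel"

section \<open>Minkowski sums with segments\<close>

lemma compact_set_plus:
  fixes A B :: "'a::real_normed_vector set"
  assumes "compact A" "compact B"
  shows "compact (A + B)"
proof -
  have "A + B = {x + y |x y. x \<in> A \<and> y \<in> B}"
    by (auto simp: set_plus_def)
  with compact_sums[OF assms] show ?thesis by simp
qed

lemma compact_set_sum:
  fixes A :: "'i \<Rightarrow> 'a::real_normed_vector set"
  assumes "\<And>i. i \<in> I \<Longrightarrow> compact (A i)"
  shows "compact (\<Sum>i\<in>I. A i)"
  using assms
  by (induction I rule: infinite_finite_induct) (auto simp: compact_set_plus)

lemma compact_subset_cballE:
  fixes K :: "'a::real_normed_vector set"
  assumes "compact K"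
  obtains r where "0 < r" "K \<subseteq> cball 0 r"
  using bounded_subset_ballD[OF compact_imp_bounded[OF assms], of 0] ball_subset_cball by blast

lemma image_scaleR_plus:
  fixes A B :: "'a::real_vector set"
  shows "(\<lambda>x. c *\<^sub>R x) ` (A + B) = (\<lambda>x. c *\<^sub>R x) ` A + (\<lambda>x. c *\<^sub>R x) ` B"
  by (force simp: set_plus_image image_iff scaleR_add_right)

lemma linear_image_set_plus:
  assumes "linear f"
  shows "f ` (A + B) = f ` A + f ` B"
  by (force simp: set_plus_image image_iff linear_add[OF assms])

lemma linear_image_set_sum:
  assumes "linear f"
  shows "f ` (\<Sum>i\<in>I. A i) = (\<Sum>i\<in>I. f ` A i)"
  using sum_set_linear[of "\<lambda>A. f ` A" A I] linear_image_set_plus[OF assms] linear_0[OF assms]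
  by (simp add: comp_def)

lemma translation_eq_set_plus: "(+) a ` A = {a} + A"
  by (auto simp: set_plus_def)

text \<open>Stated for arbitrary sets, so that later uses carry no measurability conditions: a set
  that is not Borel and its translate both get the value 0.\<close>

lemma vol_translation:
  fixes A :: "'a::euclidean_space set"
  shows "vol ((+) a ` A) = vol A"
proof (cases "A \<in> sets borel")
  case True
  have "vol A = measure (distr lborel borel ((+) (- a))) A"
    by (simp add: lborel_distr_plus)
  also have "\<dots> = vol ((+) (- a) -` A)"
    using True by (subst measure_distr) auto
  also have "(+) (- a) -` A = (+) a ` A"
    by (force simp: image_iff)
  finally show ?thesis by simp
next
  case False
  have "(+) a ` A \<notin> sets borel"
  proof
    assume "(+) a ` A \<in> sets borel"
    then have "(+) a -` ((+) a ` A) \<inter> space borel \<in> sets borel"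
      by (rule measurable_sets[rotated]) measurable
    also have "(+) a -` ((+) a ` A) \<inter> space borel = A"
      by auto
    finally show False using False by simp
  qed
  with False show ?thesis
    by (simp add: measure_notin_sets)
qed

lemma vol_scaleR:
  fixes A :: "'a::euclidean_space set"
  assumes "A \<in> sets borel" "0 \<le> c"
  shows "vol ((\<lambda>x. c *\<^sub>R x) ` A) = c ^ DIM('a) * vol A"
proof (cases "c = 0")
  case True
  have "(\<lambda>x. c *\<^sub>R x) ` A \<subseteq> {0}" using True by auto
  then have "vol ((\<lambda>x. c *\<^sub>R x) ` A) = 0"
    by (metis emeasure_lborel_countable[OF countable_empty] emeasure_lborel_singleton
        measure_def subset_singletonD enn2real_0)
  then show ?thesis using True by simp
next
  case False
  have *: "(\<lambda>x. (1/c) *\<^sub>R x) -` A = (\<lambda>x. c *\<^sub>R x) ` A"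
    using False by (force simp: image_iff)
  have eq: "lborel = density (distr lborel borel (\<lambda>x::'a. 0 + (1/c) *\<^sub>R x)) (\<lambda>_. \<bar>1/c\<bar>^DIM('a))"
    by (rule lborel_affine) (use False in auto)
  have "emeasure lborel A = \<bar>1/c\<bar>^DIM('a) * emeasure lborel ((\<lambda>x. c *\<^sub>R x) ` A)"
    apply (subst eq)
    using assms by (simp add: emeasure_density nn_integral_cmult emeasure_distr * )
  then have "vol A = (1/c)^DIM('a) * vol ((\<lambda>x. c *\<^sub>R x) ` A)"
    using assms by (simp add: measure_def enn2real_mult)
  then show ?thesis using False assms
    by (simp add: power_one_over field_simps)
qed

lemma closed_segment_0_scaleR:
  fixes u :: "'a::real_vector"
  assumes "0 \<le> s"
  shows "closed_segment 0 (s *\<^sub>R u) = (\<lambda>r. r *\<^sub>R u) ` {0..s}"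
proof -
  have "closed_segment 0 (s *\<^sub>R u) = (\<lambda>r. r *\<^sub>R u) ` ((\<lambda>x. x * s) ` {0..1})"
    by (auto simp: closed_segment_def image_image image_iff)
  also have "(\<lambda>x. x * s) ` {0..1} = {0..s}"
    using assms image_mult_atLeastAtMost_if'[of s 0 1] by auto
  finally show ?thesis .
qed

lemma mem_plus_segment:
  fixes u :: "'a::real_vector"
  assumes "0 \<le> s"
  shows "x \<in> K + closed_segment 0 (s *\<^sub>R u) \<longleftrightarrow> (\<exists>r. 0 \<le> r \<and> r \<le> s \<and> x - r *\<^sub>R u \<in> K)"
  unfolding closed_segment_0_scaleR[OF assms] set_plus_def
  by (force simp: algebra_simps)

text \<open>The source of affinity in the length: the layer gained by prolonging the segment from s
  to s + t is a translate of the layer gained by a segment of parameter t alone. Convexity enters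
  because every line in direction u meets K in an interval.\<close>

lemma plus_segment_diff:
  fixes K :: "'a::real_vector set"
  assumes "convex K" "0 \<le> s" "0 \<le> t"
  shows "(K + closed_segment 0 ((s + t) *\<^sub>R u)) - (K + closed_segment 0 (s *\<^sub>R u)) =
    (+) (s *\<^sub>R u) ` ((K + closed_segment 0 (t *\<^sub>R u)) - K)" (is "?L = ?R")
proof (intro set_eqI iffI)
  fix x assume "x \<in> ?L"
  then obtain r where r: "0 \<le> r" "r \<le> s + t" "x - r *\<^sub>R u \<in> K"
    and nx: "\<And>r. 0 \<le> r \<Longrightarrow> r \<le> s \<Longrightarrow> x - r *\<^sub>R u \<notin> K"
    using assms by (auto simp: mem_plus_segment)
  have "s < r" using r nx[of r] by force
  have "x - s *\<^sub>R u - (r - s) *\<^sub>R u \<in> K"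
    using r by (simp add: algebra_simps)
  then have "x - s *\<^sub>R u \<in> K + closed_segment 0 (t *\<^sub>R u)"
    using r \<open>s < r\<close> assms by (auto simp: mem_plus_segment intro!: exI[of _ "r - s"])
  with nx[of s] assms show "x \<in> ?R"
    by (auto intro!: image_eqI[of _ _ "x - s *\<^sub>R u"])
next
  fix x assume "x \<in> ?R"
  then obtain z where x: "x = s *\<^sub>R u + z" and z: "z \<notin> K" "z \<in> K + closed_segment 0 (t *\<^sub>R u)"
    by auto
  then obtain r where r: "0 \<le> r" "r \<le> t" "z - r *\<^sub>R u \<in> K"
    using assms by (auto simp: mem_plus_segment)
  have "x - (s + r) *\<^sub>R u \<in> K" using r x by (simp add: algebra_simps)
  then have 1: "x \<in> K + closed_segment 0 ((s + t) *\<^sub>R u)"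
    using r assms by (auto simp: mem_plus_segment intro!: exI[of _ "s + r"])
  have "x \<notin> K + closed_segment 0 (s *\<^sub>R u)"
  proof
    assume "x \<in> K + closed_segment 0 (s *\<^sub>R u)"
    then obtain q where q: "0 \<le> q" "q \<le> s" "x - q *\<^sub>R u \<in> K"
      using assms by (auto simp: mem_plus_segment)
    let ?p = "s - q"
    have p: "z + ?p *\<^sub>R u \<in> K" using q x by (simp add: algebra_simps)
    show False
    proof (cases "?p + r = 0")
      case True
      then have "?p = 0" using q r by auto
      then show False using p z by simp
    next
      case False
      then have pos: "?p + r > 0" using q r by auto
      \<comment> \<open>z lies on the chord between two points of K on the line through z in
        direction u; the weights are those for which the u-components cancel.\<close>
      have "(r / (?p + r)) *\<^sub>R (z + ?p *\<^sub>R u) + (?p / (?p + r)) *\<^sub>R (z - r *\<^sub>R u) \<in> K"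
        using p r q pos by (intro convexD[OF assms(1)]) (auto simp: add_divide_distrib[symmetric])
      also have "(r / (?p + r)) *\<^sub>R (z + ?p *\<^sub>R u) + (?p / (?p + r)) *\<^sub>R (z - r *\<^sub>R u)
          = ((r / (?p + r)) + (?p / (?p + r))) *\<^sub>R z + ((r / (?p + r)) * ?p - (?p / (?p + r)) * r) *\<^sub>R u"
        by (simp only: scaleR_add_right scaleR_diff_right scaleR_add_left scaleR_diff_left scaleR_scaleR) (simp add: scaleR_diff_left right_diff_distrib diff_divide_distrib)
      also have "r / (?p + r) + ?p / (?p + r) = 1"
        using pos by (metis add.commute add_divide_distrib div_self less_irrefl)
      also have "(r / (?p + r)) * ?p - (?p / (?p + r)) * r = 0" by simp
      also have "1 *\<^sub>R z + 0 *\<^sub>R u = z" by simp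
      finally show False using z by simp
    qed
  qed
  with 1 show "x \<in> ?L" by simp
qed

text \<open>Cauchy's functional equation on the half-line. Nonnegativity makes D monotone; trapping
  m * s between consecutive integers bounds the deviation from linearity at m * s by D 1 for every
  m, whereas additivity makes it m times the deviation at s.\<close>

lemma additive_nonneg_imp_linear:
  fixes D :: "real \<Rightarrow> real"
  assumes add: "\<And>s t. 0 \<le> s \<Longrightarrow> 0 \<le> t \<Longrightarrow> D (s + t) = D s + D t"
    and nonneg: "\<And>s. 0 \<le> s \<Longrightarrow> 0 \<le> D s" and "0 \<le> s"
  shows "D s = s * D 1"
proof -
  have D0: "D 0 = 0" using add[of 0 0] by simp
  have mono: "D s \<le> D t" if "0 \<le> s" "s \<le> t" for s t
    using add[of s "t - s"] nonneg[of "t - s"] that by simp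
  have nat: "D (real m * s) = real m * D s" if "0 \<le> s" for m s
    by (induction m) (use that D0 in \<open>auto simp: add algebra_simps\<close>)
  have *: "\<bar>D s - s * D 1\<bar> * real m \<le> D 1" for m
  proof -
    define k where "k = nat \<lfloor>real m * s\<rfloor>"
    have k: "real k \<le> real m * s" "real m * s \<le> real k + 1"
      using \<open>0 \<le> s\<close> unfolding k_def by (auto simp: of_nat_nat)
    have "real k * D 1 \<le> D (real m * s)" "D (real m * s) \<le> (real k + 1) * D 1"
      using mono[of "real k" "real m * s"] mono[of "real m * s" "real (k + 1)"] k
        nat[of 1 k] nat[of 1 "k + 1"] \<open>0 \<le> s\<close> by (auto simp: add.commute)
    moreover have "real k * D 1 \<le> real m * s * D 1" "real m * s * D 1 \<le> (real k + 1) * D 1"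
      using k nonneg[of 1] by (auto intro!: mult_right_mono)
    ultimately have "\<bar>D (real m * s) - real m * s * D 1\<bar> \<le> D 1"
      by (simp add: algebra_simps abs_le_iff)
    also have "D (real m * s) - real m * s * D 1 = real m * (D s - s * D 1)"
      using nat[OF \<open>0 \<le> s\<close>] by (simp add: algebra_simps)
    finally show ?thesis by (simp add: abs_mult mult.commute)
  qed
  have "\<bar>D s - s * D 1\<bar> = 0"
  proof (rule ccontr)
    assume "\<bar>D s - s * D 1\<bar> \<noteq> 0"
    then obtain m where "D 1 < real m * \<bar>D s - s * D 1\<bar>"
      using reals_Archimedean3[of "\<bar>D s - s * D 1\<bar>"] by auto
    with *[of m] show False by (simp add: mult.commute)
  qed
  then show ?thesis by simp
qed

text \<open>The volume gained is additive in s by \<open>plus_segment_diff\<close> and translation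
  invariance, and nonnegative by monotonicity, hence linear in s.\<close>

lemma vol_plus_segment:
  fixes K :: "'a::euclidean_space set"
  assumes "compact K" "convex K" "0 \<le> s"
  shows "vol (K + closed_segment 0 (s *\<^sub>R u)) = vol K + s * (vol (K + closed_segment 0 u) - vol K)"
proof -
  define S where "S s = K + closed_segment 0 (s *\<^sub>R u)" for s
  define D where "D s = vol (S s) - vol K" for s
  have cS: "compact (S s)" for s
    unfolding S_def using assms by (intro compact_set_plus) auto
  have fm: "S s \<in> fmeasurable lborel" for s
    using cS[of s] emeasure_compact_finite[OF cS[of s]] by (auto simp: fmeasurable_def borel_compact)
  have mono: "S s \<subseteq> S t" if "0 \<le> s" "s \<le> t" for s t
    using that unfolding S_def by (force simp: mem_plus_segment)
  have S0: "S 0 = K" by (simp add: S_def)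
  have diff: "vol (S t - S s) = vol (S t) - vol (S s)" if "0 \<le> s" "s \<le> t" for s t
    using mono[OF that] fm by (intro measurable_measure_Diff) (auto simp: borel_compact[OF cS])
  have "D s = s * D 1"
  proof (rule additive_nonneg_imp_linear)
    fix s t :: real assume st: "0 \<le> s" "0 \<le> t"
    have "vol (S (s + t) - S s) = vol (S t - S 0)"
      using plus_segment_diff[OF assms(2) st, of u] vol_translation[of "s *\<^sub>R u" "S t - S 0"]
      by (simp add: S_def)
    then show "D (s + t) = D s + D t"
      using diff[of s "s + t"] diff[of 0 t] st by (simp add: D_def S0)
  next
    fix s :: real assume "0 \<le> s"
    then show "0 \<le> D s"
      unfolding D_def S0[symmetric] using mono[of 0 s] fm borel_compact[OF cS]
      by (auto intro!: measure_mono_fmeasurable)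
  qed (use assms in auto)
  then show ?thesis by (simp add: D_def S_def)
qed

section \<open>Mixed differences of volumes\<close>

definition zonotope :: "('i \<Rightarrow> 'a::real_vector) \<Rightarrow> 'i set \<Rightarrow> 'a set" where
  "zonotope u S = (\<Sum>i\<in>S. closed_segment 0 (u i))"

text \<open>The iterated difference of the volume over the generators indexed by S, written out by
  inclusion-exclusion. As the volume is multi-affine in the lengths, this is the coefficient of the
  monomial in which each length from S occurs once.\<close>

definition vol_diff :: "('i \<Rightarrow> 'a::euclidean_space) \<Rightarrow> 'i set \<Rightarrow> 'a set \<Rightarrow> real" where
  "vol_diff u S K = (\<Sum>R\<in>Pow S. (-1) ^ card (S - R) * vol (K + zonotope u R))"

lemma compact_zonotope [simp, intro]: "compact (zonotope u S :: 'a::euclidean_space set)"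
  unfolding zonotope_def by (intro compact_set_sum) auto

lemma convex_zonotope [simp, intro]: "convex (zonotope u S :: 'a::euclidean_space set)"
  unfolding zonotope_def by (intro convex_set_sum) auto

lemma zonotope_insert:
  "finite S \<Longrightarrow> i \<notin> S \<Longrightarrow> zonotope u (insert i S) = closed_segment 0 (u i) + zonotope u S"
  by (simp add: zonotope_def)

lemma zonotope_empty [simp]: "zonotope u {} = {0}"
  by (simp add: zonotope_def)

lemma sum_Pow_insert:
  fixes f :: "'i set \<Rightarrow> 'b::comm_monoid_add"
  assumes "finite S" "i \<notin> S"
  shows "(\<Sum>T\<in>Pow (insert i S). f T) = (\<Sum>T\<in>Pow S. f T) + (\<Sum>T\<in>Pow S. f (insert i T))"
proof -
  have "inj_on (insert i) (Pow S)"
    using assms by (auto simp: inj_on_def)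
  then show ?thesis unfolding Pow_insert using assms
    by (subst sum.union_disjoint) (auto simp: sum.reindex)
qed

text \<open>Sorting the subsets by whether they contain i exhibits the alternating sum as one
  further difference step, which is the form that inductions use.\<close>

lemma vol_diff_insert:
  assumes "finite S" "i \<notin> S"
  shows "vol_diff u (insert i S) K = vol_diff u S (K + closed_segment 0 (u i)) - vol_diff u S K"
proof -
  have 1: "(-1) ^ card (insert i S - R) * vol (K + zonotope u R) =
      - ((-1) ^ card (S - R) * vol (K + zonotope u R))" if "R \<in> Pow S" for R
  proof -
    have "insert i S - R = insert i (S - R)" "i \<notin> S - R" using that assms by auto
    then show ?thesis using assms by simp
  qed
  have 2: "(-1) ^ card (insert i S - insert i R) * vol (K + zonotope u (insert i R)) =
      (-1) ^ card (S - R) * vol (K + closed_segment 0 (u i) + zonotope u R)" if "R \<in> Pow S" for R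
  proof -
    have "insert i S - insert i R = S - R" "i \<notin> R" "finite R"
      using that assms finite_subset by auto
    then show ?thesis by (simp add: zonotope_insert add.assoc)
  qed
  show ?thesis
    unfolding vol_diff_def sum_Pow_insert[OF assms]
    using sum.cong[OF refl 1, of "Pow S"] sum.cong[OF refl 2, of "Pow S"] by (simp add: sum_negf del: Pow_iff insert_Diff_if Diff_insert Diff_insert0)
qed

text \<open>Induction on the generators: affinity in the length of the new segment is applied to the
  body K plus the old zonotope, and the induction hypothesis is used for K as well as for K plus the
  unscaled new segment.\<close>

lemma vol_plus_scaled_segments:
  fixes K :: "'a::euclidean_space set"
  assumes "finite S" "compact K" "convex K" "\<And>i. i \<in> S \<Longrightarrow> 0 \<le> s i"
  shows "vol (K + zonotope (\<lambda>i. s i *\<^sub>R u i) S) = (\<Sum>T\<in>Pow S. (\<Prod>i\<in>T. s i) * vol_diff u T K)"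
  using assms
proof (induction S arbitrary: K)
  case empty
  then show ?case by (simp add: vol_diff_def)
next
  case (insert i S)
  let ?Z = "zonotope (\<lambda>i. s i *\<^sub>R u i) S"
  have cK: "compact (K + closed_segment 0 (u i))" "convex (K + closed_segment 0 (u i))"
    using insert.prems by (auto intro: compact_set_plus convex_set_plus)
  have "vol (K + zonotope (\<lambda>i. s i *\<^sub>R u i) (insert i S)) =
      vol (K + ?Z + closed_segment 0 (s i *\<^sub>R u i))"
    using insert.hyps by (simp add: zonotope_insert add_ac)
  also have "\<dots> = vol (K + ?Z) + s i * (vol (K + closed_segment 0 (u i) + ?Z) - vol (K + ?Z))"
    using insert.prems
    by (subst vol_plus_segment) (auto intro!: compact_set_plus convex_set_plus simp: add_ac)
  also have "\<dots> = (\<Sum>T\<in>Pow S. (\<Prod>i\<in>T. s i) * vol_diff u T K) +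
      s i * (\<Sum>T\<in>Pow S. (\<Prod>i\<in>T. s i) * (vol_diff u T (K + closed_segment 0 (u i)) - vol_diff u T K))"
    using insert.IH[of K] insert.IH[OF cK] insert.prems
    by (simp add: algebra_simps sum_subtractf)
  also have "(\<Sum>T\<in>Pow S. (\<Prod>i\<in>T. s i) * (vol_diff u T (K + closed_segment 0 (u i)) - vol_diff u T K))
      = (\<Sum>T\<in>Pow S. (\<Prod>i\<in>T. s i) * vol_diff u (insert i T) K)"
    using insert.hyps finite_subset[OF _ insert.hyps(1)]
    by (intro sum.cong refl, subst vol_diff_insert) auto
  also have "s i * \<dots> = (\<Sum>T\<in>Pow S. (\<Prod>i\<in>insert i T. s i) * vol_diff u (insert i T) K)"
    unfolding sum_distrib_left
    using insert.hyps finite_subset[OF _ insert.hyps(1)]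
    by (intro sum.cong refl, subst prod.insert) (auto simp: mult.assoc)
  finally show ?case
    unfolding sum_Pow_insert[OF insert.hyps] .
qed

section \<open>Lebesgue measure in orthogonal coordinates\<close>

lemma distr_lborel_uminus: "distr lborel borel (\<lambda>x::'a::euclidean_space. - x) = lborel"
  using lborel_affine[of "-1" "0::'a"] by (simp add: density_1)

lemma nn_integral_lborel_translation:
  fixes f :: "'a::euclidean_space \<Rightarrow> ennreal"
  assumes [measurable]: "f \<in> borel_measurable borel"
  shows "(\<integral>\<^sup>+x. f (c + x) \<partial>lborel) = (\<integral>\<^sup>+x. f x \<partial>lborel)"
  by (subst (2) lborel_distr_plus[of c, symmetric]) (simp add: nn_integral_distr)

text \<open>The image measure is translation invariant, and a Fubini argument shows that two translation
  invariant measures are proportional; the unit ball fixes the factor.\<close>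

lemma distr_lborel_orthogonal:
  fixes T :: "'a::euclidean_space \<Rightarrow> 'a"
  assumes T: "orthogonal_transformation T"
  shows "distr lborel borel T = lborel"
proof -
  let ?M = "distr lborel borel T"
  have lin: "linear T" using T by (rule orthogonal_transformation_linear)
  have Tm [measurable]: "T \<in> borel_measurable borel"
    using lin by (intro borel_measurable_continuous_onI linear_continuous_on)
      (auto simp: linear_conv_bounded_linear)
  obtain S where S: "\<And>x. S (T x) = x" "\<And>x. T (S x) = x"
    using orthogonal_transformation_bij[OF T] by (metis bij_inv_eq_iff)
  have ball: "emeasure ?M (ball 0 1) = emeasure lborel (ball 0 1 :: 'a set)"
  proof -
    have "T -` ball 0 1 = ball 0 1"
      using orthogonal_transformation_norm[OF T] by auto
    then show ?thesis by (simp add: emeasure_distr)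
  qed
  have trans: "(\<integral>\<^sup>+x. f (c + x) \<partial>?M) = (\<integral>\<^sup>+x. f x \<partial>?M)"
    if [measurable]: "f \<in> borel_measurable borel" for f :: "'a \<Rightarrow> ennreal" and c
  proof -
    have "(\<integral>\<^sup>+x. f (c + x) \<partial>?M) = (\<integral>\<^sup>+x. f (T (S c + x)) \<partial>lborel)"
      by (simp add: nn_integral_distr linear_add[OF lin] S)
    also have "\<dots> = (\<integral>\<^sup>+x. f (T x) \<partial>lborel)"
      by (rule nn_integral_lborel_translation) measurable
    finally show ?thesis by (simp add: nn_integral_distr)
  qed
  have sf: "sigma_finite_measure ?M"
  proof
    show "\<exists>A. countable A \<and> A \<subseteq> sets ?M \<and> \<Union> A = space ?M \<and> (\<forall>a\<in>A. emeasure ?M a \<noteq> \<infinity>)"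
    proof (intro exI conjI ballI)
      show "countable (range (\<lambda>m::nat. cball (0::'a) m))" by simp
      show "\<Union> (range (\<lambda>m::nat. cball (0::'a) m)) = space ?M"
        using real_arch_simple by (auto simp: dist_norm)
      fix a assume "a \<in> range (\<lambda>m::nat. cball (0::'a) m)"
      then obtain m where a: "a = cball 0 (real m)" by auto
      have "T -` a = a" using orthogonal_transformation_norm[OF T] by (auto simp: a)
      then show "emeasure ?M a \<noteq> \<infinity>"
        using emeasure_compact_finite[of a] by (simp add: a emeasure_distr)
    qed auto
  qed
  interpret M: sigma_finite_measure ?M by fact
  interpret P: pair_sigma_finite ?M lborel ..
  show ?thesis
  proof (rule measure_eqI)
    define D :: "'a set" where "D = ball 0 1"
    have [measurable]: "D \<in> sets borel" by (simp add: D_def)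
    fix A assume "A \<in> sets ?M"
    then have [measurable]: "A \<in> sets borel" by simp
    let ?f = "indicator A :: 'a \<Rightarrow> ennreal" and ?g = "indicator (D) :: 'a \<Rightarrow> ennreal"
    have "emeasure ?M A * emeasure lborel (D) = (\<integral>\<^sup>+x. (\<integral>\<^sup>+y. ?f x * ?g y \<partial>lborel) \<partial>?M)"
    proof -
      have "(\<integral>\<^sup>+y. ?f x * ?g y \<partial>lborel) = ?f x * emeasure lborel (D)" for x
        by (subst nn_integral_cmult_indicator) simp_all
      then show ?thesis by (simp add: nn_integral_multc)
    qed
    \<comment> \<open>Shifting y by x here, and x by - y after Fubini, moves the sum out of the
      indicator of D and a difference into that of A. The inner integral over y then gives the
      volume of A, so A and D have exchanged measures.\<close>
    also have "\<dots> = (\<integral>\<^sup>+x. (\<integral>\<^sup>+y. ?f x * ?g (x + y) \<partial>lborel) \<partial>?M)"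
    proof -
      have "(\<integral>\<^sup>+y. ?f x * ?g (x + y) \<partial>lborel) = (\<integral>\<^sup>+y. ?f x * ?g y \<partial>lborel)" for x
        by (rule nn_integral_lborel_translation[of "\<lambda>y. ?f x * ?g y" x])
          measurable
      then show ?thesis by simp
    qed
    also have "\<dots> = (\<integral>\<^sup>+y. (\<integral>\<^sup>+x. ?f x * ?g (x + y) \<partial>?M) \<partial>lborel)"
      by (rule P.Fubini'[symmetric]) measurable
    also have "\<dots> = (\<integral>\<^sup>+y. (\<integral>\<^sup>+x. ?f (x - y) * ?g x \<partial>?M) \<partial>lborel)"
      using trans[of "\<lambda>x. ?f x * ?g (x + y)" "- y" for y] by (simp add: algebra_simps)
    also have "\<dots> = (\<integral>\<^sup>+x. (\<integral>\<^sup>+y. ?f (x - y) * ?g x \<partial>lborel) \<partial>?M)"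
      by (rule P.Fubini') measurable
    also have "\<dots> = (\<integral>\<^sup>+x. emeasure lborel A * ?g x \<partial>?M)"
    proof (intro nn_integral_cong)
      fix x
      have "(\<integral>\<^sup>+y. ?f (x - y) * ?g x \<partial>lborel) = (\<integral>\<^sup>+y. ?f (x + (- y)) \<partial>lborel) * ?g x"
        by (simp add: nn_integral_multc)
      also have "(\<integral>\<^sup>+y. ?f (x + (- y)) \<partial>lborel) = (\<integral>\<^sup>+y. ?f (x + y) \<partial>distr lborel borel uminus)"
        by (simp add: nn_integral_distr)
      also have "\<dots> = emeasure lborel A"
        using nn_integral_lborel_translation[of ?f x] by (simp add: distr_lborel_uminus)
      finally show "(\<integral>\<^sup>+y. ?f (x - y) * ?g x \<partial>lborel) = emeasure lborel A * ?g x" .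
    qed
    also have "\<dots> = emeasure lborel A * emeasure lborel (D)"
      by (simp add: nn_integral_cmult ball[folded D_def])
    finally have eq: "emeasure ?M A * emeasure lborel (D) =
      emeasure lborel A * emeasure lborel (D)" .
    have "emeasure lborel (D) < \<infinity>"
      by (rule emeasure_bounded_finite) (simp add: D_def)
    moreover have "emeasure lborel (D) \<noteq> 0"
      using emeasure_ball[of 1 "0::'a"] by (simp add: D_def less_imp_neq[OF unit_ball_vol_pos, symmetric])
    ultimately show "emeasure ?M A = emeasure lborel A"
      using eq ennreal_mult_cancel_left[of "emeasure lborel D" "emeasure ?M A" "emeasure lborel A"]
      by (auto simp: mult.commute)
  qed simp
qed

lemma emeasure_orthogonal_image:
  fixes T :: "'a::euclidean_space \<Rightarrow> 'a"
  assumes T: "orthogonal_transformation T" and A: "compact A"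
  shows "emeasure lborel (T ` A) = emeasure lborel A"
proof -
  have lin: "linear T" using T by (rule orthogonal_transformation_linear)
  then have cont: "continuous_on UNIV T"
    by (intro linear_continuous_on) (auto simp: linear_conv_bounded_linear)
  have "compact (T ` A)"
    using A cont continuous_on_subset by (blast intro: compact_continuous_image)
  then have "emeasure lborel (T ` A) = emeasure lborel (T -` (T ` A))"
    using borel_measurable_continuous_onI[OF cont]
    by (subst distr_lborel_orthogonal[OF T, symmetric]) (simp add: emeasure_distr borel_compact)
  also have "T -` (T ` A) = A"
    using orthogonal_transformation_inj[OF T] by (rule inj_vimage_image_eq)
  finally show ?thesis .
qed

section \<open>Orthonormal bases of subspaces and coordinates with respect to them\<close>

lemma orthonormal_basis_ofD:
  fixes B :: "'a::euclidean_space set"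
  assumes "orthonormal_basis_of E B"
  shows "finite B" "card B = dim E" "span B = E" "subspace E" "B \<subseteq> E" "independent B"
    "\<And>b c. b \<in> B \<Longrightarrow> c \<in> B \<Longrightarrow> b \<bullet> c = (if b = c then 1 else 0)"
proof -
  have B: "pairwise orthogonal B" "\<And>b. b \<in> B \<Longrightarrow> norm b = 1" "span B = E"
    using assms by (auto simp: orthonormal_basis_of_def)
  show ind: "independent B"
    using B(1,2) by (intro pairwise_orthogonal_independent) force+
  then show "finite B" by (rule independent_imp_finite)
  show "card B = dim E" using ind B(3) dim_span_eq_card_independent by metis
  show "span B = E" "subspace E" "B \<subseteq> E" using B(3) span_superset by auto
  show "b \<bullet> c = (if b = c then 1 else 0)" if "b \<in> B" "c \<in> B" for b c
    using B(1,2) that by (auto simp: pairwise_def orthogonal_def norm_eq_1)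
qed

lemma orthonormal_basis_of_some:
  fixes E :: "'a::euclidean_space set"
  assumes "subspace E"
  shows "orthonormal_basis_of E (SOME B. orthonormal_basis_of E B)"
proof (rule someI_ex)
  show "\<exists>B. orthonormal_basis_of E B"
    using orthonormal_basis_subspace[OF assms] unfolding orthonormal_basis_of_def by metis
qed

lemma norm_orthonormal_sum:
  fixes B :: "'a::euclidean_space set"
  assumes B: "orthonormal_basis_of E B"
  shows "(norm (\<Sum>b\<in>B. f b *\<^sub>R b))\<^sup>2 = (\<Sum>b\<in>B. (f b)\<^sup>2)"
proof -
  note D = orthonormal_basis_ofD[OF B]
  have "(\<Sum>b\<in>B. f b *\<^sub>R b) \<bullet> (\<Sum>b\<in>B. f b *\<^sub>R b) = (\<Sum>b\<in>B. \<Sum>c\<in>B. f b * f c * (b \<bullet> c))"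
    by (simp only: inner_sum_left inner_sum_right inner_scaleR_left inner_scaleR_right)
      (simp add: sum_distrib_left inner_commute mult_ac)
  also have "\<dots> = (\<Sum>b\<in>B. \<Sum>c\<in>B. if c = b then f b * f b else 0)"
    by (intro sum.cong refl) (auto simp: D(7))
  also have "\<dots> = (\<Sum>b\<in>B. (f b)\<^sup>2)"
    using D(1) by (simp add: power2_eq_square)
  finally show ?thesis by (simp add: power2_norm_eq_inner)
qed

lemma distr_PiM_bij:
  assumes N: "sigma_finite_measure N" and g: "bij_betw g I J" and "finite I"
  shows "distr (\<Pi>\<^sub>M i\<in>I. N) (\<Pi>\<^sub>M j\<in>J. N) (\<lambda>f. \<lambda>j\<in>J. f (the_inv_into I g j)) = (\<Pi>\<^sub>M j\<in>J. N)"
proof -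
  interpret N: sigma_finite_measure N by fact
  interpret product_sigma_finite "\<lambda>_. N" ..
  let ?h = "the_inv_into I g"
  have J: "finite J" using g \<open>finite I\<close> bij_betw_finite by blast
  have h: "bij_betw ?h J I" using g by (rule bij_betw_the_inv_into)
  have hI: "?h j \<in> I" if "j \<in> J" for j using h that bij_betw_apply by fastforce
  have m [measurable]: "(\<lambda>f. \<lambda>j\<in>J. f (?h j)) \<in> (\<Pi>\<^sub>M i\<in>I. N) \<rightarrow>\<^sub>M (\<Pi>\<^sub>M j\<in>J. N)"
    by (intro measurable_restrict) (use hI in measurable)
  show ?thesis
  proof (rule PiM_eqI[OF J])
    fix A assume A: "\<And>j. j \<in> J \<Longrightarrow> A j \<in> sets N"
    have "(\<lambda>f. \<lambda>j\<in>J. f (?h j)) -` (Pi\<^sub>E J A) \<inter> space (\<Pi>\<^sub>M i\<in>I. N) = (\<Pi>\<^sub>E i\<in>I. A (g i))"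
    proof (intro set_eqI iffI)
      fix f assume f: "f \<in> (\<lambda>f. \<lambda>j\<in>J. f (?h j)) -` (Pi\<^sub>E J A) \<inter> space (\<Pi>\<^sub>M i\<in>I. N)"
      then have *: "f (?h j) \<in> A j" if "j \<in> J" for j using that by (auto simp: PiE_iff)
      have "f i \<in> A (g i)" if "i \<in> I" for i
        using *[of "g i"] that g by (metis bij_betw_apply bij_betw_imp_inj_on the_inv_into_f_f)
      then show "f \<in> (\<Pi>\<^sub>E i\<in>I. A (g i))"
        using f by (auto simp: PiE_iff space_PiM)
    next
      fix f assume f: "f \<in> (\<Pi>\<^sub>E i\<in>I. A (g i))"
      have "f (?h j) \<in> A j" if "j \<in> J" for j
      proof -
        have "f (?h j) \<in> A (g (?h j))" using f hI[OF that] by (auto simp: PiE_iff)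
        then show ?thesis using f_the_inv_into_f_bij_betw[OF g] that by auto
      qed
      moreover have "f i \<in> space N" if "i \<in> I" for i
        using f that A[of "g i"] sets.sets_into_space g by (metis PiE_mem bij_betw_apply subsetD)
      ultimately show "f \<in> (\<lambda>f. \<lambda>j\<in>J. f (?h j)) -` (Pi\<^sub>E J A) \<inter> space (\<Pi>\<^sub>M i\<in>I. N)"
        using f by (auto simp: PiE_iff space_PiM)
    qed
    then have "emeasure (distr (\<Pi>\<^sub>M i\<in>I. N) (\<Pi>\<^sub>M j\<in>J. N) (\<lambda>f. \<lambda>j\<in>J. f (?h j))) (Pi\<^sub>E J A)
       = (\<Prod>i\<in>I. emeasure N (A (g i)))"
      using A J \<open>finite I\<close> g by (subst emeasure_distr) (auto simp: emeasure_PiM bij_betw_apply)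
    also have "\<dots> = (\<Prod>j\<in>J. emeasure N (A j))"
      by (rule prod.reindex_bij_betw[OF g])
    finally show "emeasure (distr (\<Pi>\<^sub>M i\<in>I. N) (\<Pi>\<^sub>M j\<in>J. N) (\<lambda>f. \<lambda>j\<in>J. f (?h j))) (Pi\<^sub>E J A)
       = (\<Prod>j\<in>J. emeasure N (A j))" .
  qed simp
qed

text \<open>An orthogonal map carrying \<open>Basis\<close> to \<open>B\<close> preserves
  \<open>lborel\<close>, and in coordinates it merely relabels the factors of the product
  measure.\<close>

lemma lborel_eq_orthonormal:
  fixes B :: "'a::euclidean_space set"
  assumes B: "orthonormal_basis_of UNIV B"
  shows "lborel = distr (\<Pi>\<^sub>M b\<in>B. lborel) borel (\<lambda>f. \<Sum>b\<in>B. f b *\<^sub>R b)"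
proof -
  note D = orthonormal_basis_ofD[OF B]
  have "card (Basis :: ('a) set) = card B" by (simp only: D(2) dim_UNIV)
  then obtain g where g: "bij_betw g (Basis :: 'a set) B"
    using finite_same_card_bij[OF finite_Basis D(1)] by metis
  define T where "T x = (\<Sum>i\<in>Basis. (x \<bullet> i) *\<^sub>R g i)" for x :: 'a
  have gg: "g i \<bullet> g j = (if i = j then 1 else 0)" if "i \<in> Basis" "j \<in> Basis" for i j
    using D(7)[of "g i" "g j"] that g by (auto simp: bij_betw_def inj_on_def)
  have T: "orthogonal_transformation T"
    unfolding orthogonal_transformation_def
  proof (intro conjI allI)
    show "linear T" unfolding T_def
      by (intro linearI) (auto simp: inner_add_left scaleR_add_left sum.distrib scaleR_sum_right)
    fix v w :: 'a
    have "T v \<bullet> T w = (\<Sum>i\<in>Basis. \<Sum>j\<in>Basis. (v \<bullet> i) * (w \<bullet> j) * (g i \<bullet> g j))"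
      unfolding T_def by (subst inner_sum_left) (simp add: inner_sum_right sum_distrib_left mult_ac)
    also have "\<dots> = (\<Sum>i\<in>Basis. \<Sum>j\<in>Basis. if j = i then (v \<bullet> i) * (w \<bullet> i) else 0)"
      by (intro sum.cong refl) (auto simp: gg)
    also have "\<dots> = v \<bullet> w" by (simp add: euclidean_inner[of v w])
    finally show "T v \<bullet> T w = v \<bullet> w" .
  qed
  have Tm [measurable]: "T \<in> borel_measurable borel" unfolding T_def by measurable
  have hB: "the_inv_into Basis g b \<in> Basis" if "b \<in> B" for b
    using bij_betw_the_inv_into[OF g] that bij_betw_apply by fastforce
  have "lborel = distr lborel borel T"
    using distr_lborel_orthogonal[OF T] by simp
  also have "\<dots> = distr (\<Pi>\<^sub>M b\<in>Basis. lborel) borel (\<lambda>f. \<Sum>i\<in>Basis. f i *\<^sub>R g i)"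
  proof -
    have "T (\<Sum>b\<in>Basis. f b *\<^sub>R b) = (\<Sum>i\<in>Basis. f i *\<^sub>R g i)" for f
      unfolding T_def by (intro sum.cong refl) simp
    then show ?thesis
      by (subst lborel_eq, subst distr_distr) (auto simp: comp_def)
  qed
  also have "\<dots> = distr (\<Pi>\<^sub>M b\<in>Basis. lborel) borel
      ((\<lambda>f. \<Sum>b\<in>B. f b *\<^sub>R b) \<circ> (\<lambda>f. \<lambda>b\<in>B. f (the_inv_into Basis g b)))"
  proof (rule distr_cong)
    fix f :: "'a \<Rightarrow> real"
    have "(\<Sum>b\<in>B. f (the_inv_into Basis g b) *\<^sub>R b) = (\<Sum>i\<in>Basis. f (the_inv_into Basis g (g i)) *\<^sub>R g i)"
      by (rule sum.reindex_bij_betw[OF g, symmetric])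
    also have "\<dots> = (\<Sum>i\<in>Basis. f i *\<^sub>R g i)"
      using g by (intro sum.cong refl) (simp add: bij_betw_imp_inj_on the_inv_into_f_f)
    finally show "(\<Sum>i\<in>Basis. f i *\<^sub>R g i) =
      ((\<lambda>f. \<Sum>b\<in>B. f b *\<^sub>R b) \<circ> (\<lambda>f. \<lambda>b\<in>B. f (the_inv_into Basis g b))) f" by simp
  qed auto
  also have "\<dots> = distr (distr (\<Pi>\<^sub>M b\<in>Basis. lborel) (\<Pi>\<^sub>M b\<in>B. lborel)
      (\<lambda>f. \<lambda>b\<in>B. f (the_inv_into Basis g b))) borel (\<lambda>f. \<Sum>b\<in>B. f b *\<^sub>R b)"
    by (subst distr_distr) (auto intro!: measurable_restrict measurable_component_singleton hB)
  also have "distr (\<Pi>\<^sub>M b\<in>Basis. lborel) (\<Pi>\<^sub>M b\<in>B. lborel)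
      (\<lambda>f. \<lambda>b\<in>B. f (the_inv_into Basis g b)) = (\<Pi>\<^sub>M b\<in>B. lborel)"
    by (rule distr_PiM_bij[OF sigma_finite_lborel g]) simp
  finally show ?thesis .
qed

section \<open>Lebesgue measure on subspaces\<close>

lemma sets_subspace_lborel [simp, measurable_cong]: "sets (subspace_lborel E) = sets borel"
  and space_subspace_lborel [simp]: "space (subspace_lborel E) = UNIV"
  by (simp_all add: subspace_lborel_def Let_def)

lemma emeasure_subspace_lborel:
  assumes "B = (SOME B. orthonormal_basis_of E B)" "A \<in> sets borel"
  shows "emeasure (subspace_lborel E) A =
    emeasure (\<Pi>\<^sub>M b\<in>B. lborel) {f \<in> space (\<Pi>\<^sub>M b\<in>B. lborel). (\<Sum>b\<in>B. f b *\<^sub>R b) \<in> A}"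
  unfolding subspace_lborel_def assms(1)[symmetric] Let_def
  using assms(2) by (subst emeasure_distr) (auto intro!: arg_cong[where f="emeasure _"])

lemma emeasure_subspace_lborel_cball:
  fixes E :: "'a::euclidean_space set"
  assumes "subspace E" "0 < r"
  shows "emeasure (subspace_lborel E) (cball 0 r) = ennreal (unit_ball_vol (real (dim E)) * r ^ dim E)"
proof -
  define B where "B = (SOME B. orthonormal_basis_of E B)"
  have B: "orthonormal_basis_of E B"
    unfolding B_def using assms(1) by (rule orthonormal_basis_of_some)
  note D = orthonormal_basis_ofD[OF B]
  have "norm (\<Sum>b\<in>B. f b *\<^sub>R b) = sqrt (\<Sum>b\<in>B. (f b)\<^sup>2)" for f
    using norm_orthonormal_sum[OF B, of f] by (metis norm_ge_zero real_sqrt_unique)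
  then have "{f \<in> space (\<Pi>\<^sub>M b\<in>B. lborel). (\<Sum>b\<in>B. f b *\<^sub>R b) \<in> cball 0 r} =
    {f. sqrt (\<Sum>i\<in>B. (f i)\<^sup>2) \<le> r} \<inter> space (\<Pi>\<^sub>M b\<in>B. lborel)"
    by auto
  then show ?thesis
    using emeasure_cball_aux[OF D(1) assms(2)] D(2)
    by (simp add: emeasure_subspace_lborel[OF B_def])
qed

lemma AE_subspace_lborel:
  fixes E :: "'a::euclidean_space set"
  assumes "subspace E"
  shows "AE x in subspace_lborel E. x \<in> E"
proof -
  define B where "B = (SOME B. orthonormal_basis_of E B)"
  have B: "orthonormal_basis_of E B"
    unfolding B_def using assms by (rule orthonormal_basis_of_some)
  note D = orthonormal_basis_ofD[OF B]
  have mem: "(\<Sum>b\<in>B. f b *\<^sub>R b) \<in> E" for f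
    using D by (intro subspace_sum subspace_scale) auto
  have [measurable]: "E \<in> sets borel"
    using closed_subspace[OF assms] by (rule borel_closed)
  show ?thesis
    unfolding subspace_lborel_def B_def[symmetric] Let_def
    by (subst AE_distr_iff) (auto simp: mem)
qed

lemma emeasure_subspace_lborel_Int:
  fixes E :: "'a::euclidean_space set"
  assumes "subspace E" and [measurable]: "A \<in> sets borel"
  shows "emeasure (subspace_lborel E) (A \<inter> E) = emeasure (subspace_lborel E) A"
proof (rule emeasure_eq_AE)
  show "AE x in subspace_lborel E. (x \<in> A \<inter> E) = (x \<in> A)"
    using AE_subspace_lborel[OF assms(1)] by eventually_elim auto
  show "A \<inter> E \<in> sets (subspace_lborel E)"
    using closed_subspace[OF assms(1)] by (simp add: borel_closed)
qed simp

lemma emeasure_subspace_lborel_finite: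
  fixes E :: "'a::euclidean_space set"
  assumes "subspace E" "bounded A"
  shows "emeasure (subspace_lborel E) A < \<infinity>"
proof -
  obtain r where r: "0 < r" "A \<subseteq> cball 0 r"
    using bounded_subset_ballD[OF assms(2), of 0] ball_subset_cball by blast
  then have "emeasure (subspace_lborel E) A \<le> emeasure (subspace_lborel E) (cball 0 r)"
    by (intro emeasure_mono) auto
  also have "\<dots> < \<infinity>" using emeasure_subspace_lborel_cball[OF assms(1) r(1)] by simp
  finally show ?thesis .
qed

lemma sigma_finite_subspace_lborel:
  fixes E :: "'a::euclidean_space set"
  assumes "subspace E"
  shows "sigma_finite_measure (subspace_lborel E)"
proof
  show "\<exists>A. countable A \<and> A \<subseteq> sets (subspace_lborel E) \<and> \<Union> A = space (subspace_lborel E) \<and>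
      (\<forall>a\<in>A. emeasure (subspace_lborel E) a \<noteq> \<infinity>)"
  proof (intro exI conjI ballI)
    show "countable (range (\<lambda>m::nat. cball (0::'a) m))" by simp
    show "\<Union> (range (\<lambda>m::nat. cball (0::'a) m)) = space (subspace_lborel E)"
      using real_arch_simple by (auto simp: dist_norm)
    fix a assume "a \<in> range (\<lambda>m::nat. cball (0::'a) m)"
    then have "bounded a" by auto
    then show "emeasure (subspace_lborel E) a \<noteq> \<infinity>"
      using emeasure_subspace_lborel_finite[OF assms] by fastforce
  qed auto
qed

lemma orthonormal_basis_of_union:
  fixes E :: "'a::euclidean_space set"
  assumes E: "orthonormal_basis_of E A" and F: "orthonormal_basis_of (E\<^sup>\<bottom>) B"
  shows "orthonormal_basis_of UNIV (A \<union> B)" "A \<inter> B = {}"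
proof -
  note DE = orthonormal_basis_ofD[OF E] and DF = orthonormal_basis_ofD[OF F]
  have orth: "orthogonal a b" if "a \<in> A" "b \<in> B" for a b
    using that DE(5) DF(5) by (auto simp: orthogonal_comp_def)
  then have orth': "orthogonal b a" if "a \<in> A" "b \<in> B" for a b
    using that by (simp add: orthogonal_commute)
  show "A \<inter> B = {}"
  proof (rule ccontr)
    assume "A \<inter> B \<noteq> {}"
    then obtain a where "a \<in> A" "a \<in> B" by auto
    with orth[of a a] DE(7)[of a a] show False by (simp add: orthogonal_def)
  qed
  have "UNIV = span A + span B"
    using subspace_sum_orthogonal_comp[OF DE(4)] DE(3) DF(3) by simp
  also have "\<dots> \<subseteq> span (A \<union> B)"
    by (intro subspace_sum_minimal span_mono) auto
  finally show "orthonormal_basis_of UNIV (A \<union> B)"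
    using E F orth orth' unfolding orthonormal_basis_of_def pairwise_def
    by auto
qed

lemma dim_orthogonal_comp:
  fixes E :: "'a::euclidean_space set"
  assumes "subspace E"
  shows "dim E + dim (E\<^sup>\<bottom>) = DIM('a)"
proof -
  note A = orthonormal_basis_of_some[OF assms]
    and B = orthonormal_basis_of_some[OF subspace_orthogonal_comp[of E]]
  note AB = orthonormal_basis_of_union[OF A B]
  show ?thesis
    using orthonormal_basis_ofD(1,2)[OF A] orthonormal_basis_ofD(1,2)[OF B]
      orthonormal_basis_ofD(2)[OF AB(1)] AB(2)
    by (simp add: card_Un_disjoint)
qed

text \<open>The bases chosen for E and for its complement unite to an orthonormal basis of the whole
  space, over which the product measure splits. This is what opens Fubini's theorem to arbitrary
  orthogonal decompositions.\<close>

lemma lborel_eq_orthogonal_sum: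
  fixes E :: "'a::euclidean_space set"
  assumes "subspace E"
  shows "lborel = distr (subspace_lborel E \<Otimes>\<^sub>M subspace_lborel (E\<^sup>\<bottom>)) borel (\<lambda>(x, y). x + y)"
proof -
  interpret product_sigma_finite "\<lambda>_. lborel :: real measure" ..
  define A where "A = (SOME B. orthonormal_basis_of E B)"
  define B where "B = (SOME B. orthonormal_basis_of (E\<^sup>\<bottom>) B)"
  have A: "orthonormal_basis_of E A"
    unfolding A_def using assms by (rule orthonormal_basis_of_some)
  have B: "orthonormal_basis_of (E\<^sup>\<bottom>) B"
    unfolding B_def using subspace_orthogonal_comp by (rule orthonormal_basis_of_some)
  note DA = orthonormal_basis_ofD[OF A] and DB = orthonormal_basis_ofD[OF B]
    and AB = orthonormal_basis_of_union[OF A B]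
  let ?PA = "\<Pi>\<^sub>M b\<in>A. (lborel :: real measure)" and ?PB = "\<Pi>\<^sub>M b\<in>B. (lborel :: real measure)"
  let ?fA = "\<lambda>f. \<Sum>b\<in>A. f b *\<^sub>R b" and ?fB = "\<lambda>f. \<Sum>b\<in>B. f b *\<^sub>R b"
  have EA: "subspace_lborel E = distr ?PA borel ?fA" and EB: "subspace_lborel (E\<^sup>\<bottom>) = distr ?PB borel ?fB"
    by (simp_all add: subspace_lborel_def A_def B_def Let_def)
  have fA: "?fA \<in> borel_measurable ?PA" and fB: "?fB \<in> borel_measurable ?PB"
    by measurable
  have fAB: "(\<lambda>(f, g). (?fA f, ?fB g)) \<in> ?PA \<Otimes>\<^sub>M ?PB \<rightarrow>\<^sub>M borel \<Otimes>\<^sub>M borel"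
    using measurable_compose[OF measurable_fst fA] measurable_compose[OF measurable_snd fB]
    by (auto intro!: measurable_Pair simp: split_beta')
  have "lborel = distr (\<Pi>\<^sub>M b\<in>A \<union> B. lborel) borel (\<lambda>f. \<Sum>b\<in>A \<union> B. f b *\<^sub>R b)"
    by (rule lborel_eq_orthonormal[OF AB(1)])
  also have "(\<Pi>\<^sub>M b\<in>A \<union> B. lborel) = distr (?PA \<Otimes>\<^sub>M ?PB) (\<Pi>\<^sub>M b\<in>A \<union> B. lborel) (merge A B)"
    by (rule distr_merge[OF AB(2) DA(1) DB(1), symmetric])
  also have "distr \<dots> borel (\<lambda>f. \<Sum>b\<in>A \<union> B. f b *\<^sub>R b) =
      distr (?PA \<Otimes>\<^sub>M ?PB) borel ((\<lambda>f. \<Sum>b\<in>A \<union> B. f b *\<^sub>R b) \<circ> merge A B)"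
    by (rule distr_distr) auto
  also have "\<dots> = distr (?PA \<Otimes>\<^sub>M ?PB) borel ((\<lambda>(x, y). x + y) \<circ> (\<lambda>(f, g). (?fA f, ?fB g)))"
  proof (rule distr_cong)
    fix h :: "('a \<Rightarrow> real) \<times> ('a \<Rightarrow> real)"
    obtain f g where h: "h = (f, g)" by (cases h)
    have "(\<Sum>b\<in>A. merge A B (f, g) b *\<^sub>R b) = ?fA f" "(\<Sum>b\<in>B. merge A B (f, g) b *\<^sub>R b) = ?fB g"
      using AB(2) by (auto intro!: sum.cong)
    then show "((\<lambda>f. \<Sum>b\<in>A \<union> B. f b *\<^sub>R b) \<circ> merge A B) h =
      ((\<lambda>(x, y). x + y) \<circ> (\<lambda>(f, g). (?fA f, ?fB g))) h"
      using AB(2) DA(1) DB(1) by (simp add: h sum.union_disjoint)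
  qed auto
  also have "\<dots> = distr (distr (?PA \<Otimes>\<^sub>M ?PB) (borel \<Otimes>\<^sub>M borel) (\<lambda>(f, g). (?fA f, ?fB g))) borel (\<lambda>(x, y). x + y)"
    by (rule distr_distr[symmetric, OF _ fAB]) measurable
  also have "distr (?PA \<Otimes>\<^sub>M ?PB) (borel \<Otimes>\<^sub>M borel) (\<lambda>(f, g). (?fA f, ?fB g)) =
      subspace_lborel E \<Otimes>\<^sub>M subspace_lborel (E\<^sup>\<bottom>)"
    unfolding EA EB
    by (rule pair_measure_distr[symmetric, OF fA fB])
      (use sigma_finite_subspace_lborel[OF subspace_orthogonal_comp[of E]] in \<open>simp add: EB\<close>)
  finally show ?thesis .
qed

lemma emeasure_lborel_sections:
  fixes E :: "'a::euclidean_space set"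
  assumes "subspace E" and [measurable]: "X \<in> sets borel"
  shows "emeasure lborel X = (\<integral>\<^sup>+x. emeasure (subspace_lborel (E\<^sup>\<bottom>)) {y. x + y \<in> X} \<partial>subspace_lborel E)"
proof -
  interpret F: sigma_finite_measure "subspace_lborel (E\<^sup>\<bottom>)"
    by (rule sigma_finite_subspace_lborel[OF subspace_orthogonal_comp])
  have m: "(\<lambda>(x, y). x + y) \<in> subspace_lborel E \<Otimes>\<^sub>M subspace_lborel (E\<^sup>\<bottom>) \<rightarrow>\<^sub>M borel"
    by measurable
  have "emeasure lborel X = emeasure (subspace_lborel E \<Otimes>\<^sub>M subspace_lborel (E\<^sup>\<bottom>))
      ((\<lambda>(x, y). x + y) -` X \<inter> space (subspace_lborel E \<Otimes>\<^sub>M subspace_lborel (E\<^sup>\<bottom>)))"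
    using lborel_eq_orthogonal_sum[OF assms(1)] emeasure_distr[OF m assms(2)] by metis
  also have "\<dots> = (\<integral>\<^sup>+x. emeasure (subspace_lborel (E\<^sup>\<bottom>)) {y. x + y \<in> X} \<partial>subspace_lborel E)"
    by (subst F.emeasure_pair_measure_alt[OF measurable_sets[OF m assms(2)]])
      (simp add: space_pair_measure vimage_def)
  finally show ?thesis .
qed

lemma orthogonal_sum_unique:
  fixes E :: "'a::euclidean_space set"
  assumes "subspace E" "x \<in> E" "x' \<in> E" "y \<in> E\<^sup>\<bottom>" "y' \<in> E\<^sup>\<bottom>" "x + y = x' + y'"
  shows "x = x' \<and> y = y'"
proof -
  have "x - x' = y' - y" using assms(6) by (simp add: algebra_simps)
  then have "x - x' \<in> E \<inter> E\<^sup>\<bottom>"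
    using assms subspace_diff subspace_orthogonal_comp by (metis IntI)
  then have "x - x' = 0" using orthogonal_Int_0[OF assms(1)] by blast
  with assms(6) show ?thesis by auto
qed

lemma emeasure_orthogonal_plus:
  fixes E :: "'a::euclidean_space set"
  assumes E: "subspace E" and A: "compact A" "A \<subseteq> E" and P: "compact P" "P \<subseteq> E\<^sup>\<bottom>"
  shows "emeasure lborel (A + P) = emeasure (subspace_lborel E) A * emeasure (subspace_lborel (E\<^sup>\<bottom>)) P"
proof -
  have [measurable]: "A \<in> sets borel" "P \<in> sets borel" "A + P \<in> sets borel"
    using A P compact_set_plus[of A P] by (auto intro: borel_compact)
  have "emeasure lborel (A + P) =
      (\<integral>\<^sup>+x. emeasure (subspace_lborel (E\<^sup>\<bottom>)) {y. x + y \<in> A + P} \<partial>subspace_lborel E)"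
    by (rule emeasure_lborel_sections[OF E]) simp
  also have "\<dots> = (\<integral>\<^sup>+x. indicator A x * emeasure (subspace_lborel (E\<^sup>\<bottom>)) P \<partial>subspace_lborel E)"
  proof (rule nn_integral_cong_AE)
    show "AE x in subspace_lborel E. emeasure (subspace_lborel (E\<^sup>\<bottom>)) {y. x + y \<in> A + P} =
        indicator A x * emeasure (subspace_lborel (E\<^sup>\<bottom>)) P"
      using AE_subspace_lborel[OF E]
    proof eventually_elim
      case (elim x)
      have iff: "x + y \<in> A + P \<longleftrightarrow> x \<in> A \<and> y \<in> P" if "y \<in> E\<^sup>\<bottom>" for y
      proof
        assume "x + y \<in> A + P"
        then obtain a p where ap: "a \<in> A" "p \<in> P" "x + y = a + p" by (auto elim: set_plus_elim)
        then have "x = a \<and> y = p"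
          using elim that A(2) P(2) by (intro orthogonal_sum_unique[OF E]) auto
        with ap show "x \<in> A \<and> y \<in> P" by simp
      qed auto
      have "emeasure (subspace_lborel (E\<^sup>\<bottom>)) {y. x + y \<in> A + P} =
        emeasure (subspace_lborel (E\<^sup>\<bottom>)) (if x \<in> A then P else {})"
      proof (rule emeasure_eq_AE)
        show "AE y in subspace_lborel (E\<^sup>\<bottom>). (y \<in> {y. x + y \<in> A + P}) = (y \<in> (if x \<in> A then P else {}))"
          using AE_subspace_lborel[OF subspace_orthogonal_comp[of E]]
          by eventually_elim (auto simp: iff)
        have "(\<lambda>y. x + y) -` (A + P) \<inter> space borel \<in> sets borel"
          by (rule measurable_sets[of _ borel borel]) auto
        then show "{y. x + y \<in> A + P} \<in> sets (subspace_lborel (E\<^sup>\<bottom>))"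
          by (simp add: vimage_def)
      qed auto
      then show ?case by auto
    qed
  qed
  also have "\<dots> = emeasure (subspace_lborel E) A * emeasure (subspace_lborel (E\<^sup>\<bottom>)) P"
    by (simp add: nn_integral_multc)
  finally show ?thesis .
qed

lemma vol_orthogonal_plus:
  fixes E :: "'a::euclidean_space set"
  assumes "subspace E" "compact A" "A \<subseteq> E" "compact P" "P \<subseteq> E\<^sup>\<bottom>"
  shows "vol (A + P) = measure (subspace_lborel E) A * measure (subspace_lborel (E\<^sup>\<bottom>)) P"
  unfolding measure_def emeasure_orthogonal_plus[OF assms] by (simp add: enn2real_mult)

section \<open>Orthogonal projections\<close>

lemma orth_proj_unique:
  fixes E :: "'a::euclidean_space set"
  assumes "subspace E" "y \<in> E" "x - y \<in> E\<^sup>\<bottom>"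
  shows "orth_proj E x = y"
  unfolding orth_proj_def
proof (rule the_equality)
  show "y \<in> E \<and> (\<forall>z\<in>E. orthogonal (x - y) z)"
    using assms by (auto simp: orthogonal_comp_def orthogonal_commute)
  fix y' assume y': "y' \<in> E \<and> (\<forall>z\<in>E. orthogonal (x - y') z)"
  then have "x - y' \<in> E\<^sup>\<bottom>" by (auto simp: orthogonal_comp_def orthogonal_commute)
  then show "y' = y"
    using orthogonal_sum_unique[OF assms(1), of y' y "x - y'" "x - y"] assms y' by simp
qed

lemma orth_proj_mem:
  fixes E :: "'a::euclidean_space set"
  assumes "subspace E"
  shows "orth_proj E x \<in> E" "x - orth_proj E x \<in> E\<^sup>\<bottom>"
proof -
  have "x \<in> E + E\<^sup>\<bottom>" using subspace_sum_orthogonal_comp[OF assms] by simp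
  then obtain y z where "y \<in> E" "z \<in> E\<^sup>\<bottom>" "x = y + z" by (auto elim: set_plus_elim)
  then have "y \<in> E" "x - y \<in> E\<^sup>\<bottom>" by auto
  with orth_proj_unique[OF assms this] show "orth_proj E x \<in> E" "x - orth_proj E x \<in> E\<^sup>\<bottom>" by auto
qed

lemma linear_orth_proj:
  fixes E :: "'a::euclidean_space set"
  assumes E: "subspace E"
  shows "linear (orth_proj E)"
proof (rule linearI)
  note E' = subspace_orthogonal_comp[of E]
  fix x y :: 'a and c :: real
  have "(x - orth_proj E x) + (y - orth_proj E y) \<in> E\<^sup>\<bottom>"
    by (intro subspace_add[OF E'] orth_proj_mem E)
  then show "orth_proj E (x + y) = orth_proj E x + orth_proj E y"
    by (intro orth_proj_unique E subspace_add orth_proj_mem) (simp add: algebra_simps)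
  have "c *\<^sub>R (x - orth_proj E x) \<in> E\<^sup>\<bottom>"
    by (intro subspace_scale[OF E'] orth_proj_mem E)
  then show "orth_proj E (c *\<^sub>R x) = c *\<^sub>R orth_proj E x"
    by (intro orth_proj_unique E subspace_scale orth_proj_mem) (simp add: algebra_simps)
qed

lemma orth_proj_orthogonal_comp:
  fixes E :: "'a::euclidean_space set"
  assumes "subspace E"
  shows "orth_proj (E\<^sup>\<bottom>) x = x - orth_proj E x"
  using orth_proj_mem[OF assms, of x]
  by (intro orth_proj_unique) (auto simp: subspace_orthogonal_comp orthogonal_comp_self[OF assms])

lemma norm_orth_proj_le:
  fixes E :: "'a::euclidean_space set"
  assumes "subspace E"
  shows "norm (orth_proj E x) \<le> norm x"
proof -
  have "orthogonal (orth_proj E x) (x - orth_proj E x)"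
    using orth_proj_mem[OF assms, of x] by (auto simp: orthogonal_comp_def)
  then have "(norm (orth_proj E x + (x - orth_proj E x)))\<^sup>2 =
      (norm (orth_proj E x))\<^sup>2 + (norm (x - orth_proj E x))\<^sup>2"
    by (rule norm_add_Pythagorean)
  then have "(norm (orth_proj E x))\<^sup>2 \<le> (norm x)\<^sup>2" by simp
  then show ?thesis by (rule power2_le_imp_le) simp
qed

lemma continuous_on_linear:
  fixes f :: "'a::euclidean_space \<Rightarrow> 'b::real_normed_vector"
  shows "linear f \<Longrightarrow> continuous_on A f"
  by (simp add: linear_continuous_on linear_conv_bounded_linear)

lemma compact_orth_proj:
  fixes E :: "'a::euclidean_space set"
  assumes "subspace E" "compact K"
  shows "compact (orth_proj E ` K)"
  using assms by (intro compact_continuous_image continuous_on_linear linear_orth_proj)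

lemma measure_subspace_lborel_cball:
  fixes E :: "'a::euclidean_space set"
  assumes "subspace E" "0 < r"
  shows "measure (subspace_lborel E) (cball 0 r \<inter> E) = unit_ball_vol (real (dim E)) * r ^ dim E"
  using emeasure_subspace_lborel_cball[OF assms] emeasure_subspace_lborel_Int[OF assms(1), of "cball 0 r"] assms
  by (simp add: measure_def)

lemma compact_cball_Int:
  fixes E :: "'a::euclidean_space set"
  assumes "subspace E"
  shows "compact (cball 0 r \<inter> E)"
  using closed_subspace[OF assms] by (intro compact_Int_closed) auto

text \<open>Scaling and translation in a subspace are read off from the volume of the sum with
  the unit ball of the orthogonal complement.\<close>

lemma vol_plus_complement_cball:
  fixes E :: "'a::euclidean_space set"
  assumes "subspace E" "compact A" "A \<subseteq> E" "0 < r"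
  shows "vol (A + (cball 0 r \<inter> E\<^sup>\<bottom>)) =
    measure (subspace_lborel E) A * (unit_ball_vol (real (dim (E\<^sup>\<bottom>))) * r ^ dim (E\<^sup>\<bottom>))"
  using assms vol_orthogonal_plus[OF assms(1-3) compact_cball_Int[of "E\<^sup>\<bottom>"]]
    measure_subspace_lborel_cball[of "E\<^sup>\<bottom>" r]
  by (simp add: subspace_orthogonal_comp)

lemma scaleR_cball_Int:
  fixes E :: "'a::euclidean_space set"
  assumes "subspace E" "0 < c"
  shows "(\<lambda>x. c *\<^sub>R x) ` (cball 0 r \<inter> E) = cball 0 (c * r) \<inter> E"
proof (intro set_eqI iffI)
  fix x assume "x \<in> cball 0 (c * r) \<inter> E"
  then have "(1/c) *\<^sub>R x \<in> cball 0 r \<inter> E" "x = c *\<^sub>R ((1/c) *\<^sub>R x)"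
    using assms by (auto simp: subspace_scale field_simps)
  then show "x \<in> (\<lambda>x. c *\<^sub>R x) ` (cball 0 r \<inter> E)" by blast
qed (use assms in \<open>auto simp: subspace_scale\<close>)

lemma measure_subspace_lborel_scaleR:
  fixes E :: "'a::euclidean_space set"
  assumes E: "subspace E" and A: "compact A" "A \<subseteq> E" and c: "0 < c"
  shows "measure (subspace_lborel E) ((\<lambda>x. c *\<^sub>R x) ` A) = c ^ dim E * measure (subspace_lborel E) A"
proof -
  note E' = subspace_orthogonal_comp[of E]
  let ?k = "unit_ball_vol (real (dim (E\<^sup>\<bottom>)))"
  have k: "?k > 0" by (rule unit_ball_vol_pos) simp
  have cA: "compact ((\<lambda>x. c *\<^sub>R x) ` A)" "(\<lambda>x. c *\<^sub>R x) ` A \<subseteq> E"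
    using A E by (auto intro: compact_scaling subspace_scale)
  have "measure (subspace_lborel E) ((\<lambda>x. c *\<^sub>R x) ` A) * (?k * c ^ dim (E\<^sup>\<bottom>)) =
      vol ((\<lambda>x. c *\<^sub>R x) ` A + (cball 0 c \<inter> E\<^sup>\<bottom>))"
    using vol_plus_complement_cball[OF E cA c] by simp
  also have "\<dots> = vol ((\<lambda>x. c *\<^sub>R x) ` (A + (cball 0 1 \<inter> E\<^sup>\<bottom>)))"
    using scaleR_cball_Int[OF E' c, of 1] by (simp add: image_scaleR_plus)
  also have "\<dots> = c ^ DIM('a) * vol (A + (cball 0 1 \<inter> E\<^sup>\<bottom>))"
    using A c compact_cball_Int[OF E'] by (intro vol_scaleR borel_compact compact_set_plus) auto
  also have "\<dots> = c ^ DIM('a) * (measure (subspace_lborel E) A * ?k)"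
    using vol_plus_complement_cball[OF E A, of 1] by simp
  also have "c ^ DIM('a) = c ^ dim E * c ^ dim (E\<^sup>\<bottom>)"
    by (simp only: dim_orthogonal_comp[OF E, symmetric] power_add)
  finally have "measure (subspace_lborel E) ((\<lambda>x. c *\<^sub>R x) ` A) * (?k * c ^ dim (E\<^sup>\<bottom>)) =
      (c ^ dim E * measure (subspace_lborel E) A) * (?k * c ^ dim (E\<^sup>\<bottom>))"
    by (simp add: mult_ac)
  moreover have "?k * c ^ dim (E\<^sup>\<bottom>) \<noteq> 0"
    using mult_pos_pos[OF k zero_less_power[OF c, of "dim (E\<^sup>\<bottom>)"]] by linarith
  ultimately show ?thesis by (metis mult_cancel_right)
qed

lemma measure_subspace_lborel_translation:
  fixes E :: "'a::euclidean_space set"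
  assumes E: "subspace E" and A: "compact A" "A \<subseteq> E" and c: "c \<in> E"
  shows "measure (subspace_lborel E) ((+) c ` A) = measure (subspace_lborel E) A"
proof -
  let ?k = "unit_ball_vol (real (dim (E\<^sup>\<bottom>)))"
  have k: "?k > 0" by (rule unit_ball_vol_pos) simp
  have cA: "compact ((+) c ` A)" "(+) c ` A \<subseteq> E"
    using A E c by (auto intro: compact_translation subspace_add)
  have "measure (subspace_lborel E) ((+) c ` A) * ?k = vol ((+) c ` A + (cball 0 1 \<inter> E\<^sup>\<bottom>))"
    using vol_plus_complement_cball[OF E cA, of 1] by simp
  also have "\<dots> = vol ((+) c ` (A + (cball 0 1 \<inter> E\<^sup>\<bottom>)))"
    by (simp add: translation_eq_set_plus add.assoc)
  also have "\<dots> = measure (subspace_lborel E) A * ?k"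
    using vol_plus_complement_cball[OF E A, of 1] by (simp add: vol_translation)
  finally show ?thesis using k by simp
qed

section \<open>Mixed differences as volumes of projections\<close>

lemma zonotope_scaleR:
  "zonotope (\<lambda>i. c *\<^sub>R u i) S = (\<lambda>x. c *\<^sub>R x) ` zonotope u S"
proof -
  have "linear (\<lambda>x. c *\<^sub>R x)" by (rule linear_scaleR)
  then show ?thesis
    unfolding zonotope_def
    by (subst linear_image_set_sum) (auto simp: closed_segment_linear_image[symmetric] intro!: sum.cong)
qed

lemma zonotope_subset_span:
  "zonotope u S \<subseteq> span (u ` S)"
proof (induction S rule: infinite_finite_induct)
  case (insert i S)
  have "u i \<in> span (u ` insert i S)" by (intro span_base) simp
  then have "closed_segment 0 (u i) \<subseteq> span (u ` insert i S)"
    by (auto simp: closed_segment_def intro: span_scale)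
  moreover have "zonotope u S \<subseteq> span (u ` insert i S)"
    using insert.IH span_mono[of "u ` S" "u ` insert i S"] by blast
  ultimately show ?case
    using insert.hyps by (simp add: zonotope_insert subspace_sum_minimal)
qed (auto simp: zonotope_def span_zero)

text \<open>Over each point of the projection of K, the fibre of K + P contains a translate of
  P.\<close>

lemma vol_plus_ge:
  fixes E :: "'a::euclidean_space set"
  assumes E: "subspace E" and K: "compact K" and P: "compact P" "P \<subseteq> E\<^sup>\<bottom>"
  shows "measure (subspace_lborel E) (orth_proj E ` K) * measure (subspace_lborel (E\<^sup>\<bottom>)) P \<le> vol (K + P)"
proof -
  let ?F = "E\<^sup>\<bottom>"
  note F = subspace_orthogonal_comp[of E]
  have cKP: "compact (K + P)" using K P by (intro compact_set_plus)
  then have [measurable]: "K + P \<in> sets borel" by (rule borel_compact)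
  have cK: "compact (orth_proj E ` K)" by (rule compact_orth_proj[OF E K])
  then have [measurable]: "orth_proj E ` K \<in> sets borel" by (rule borel_compact)
  have "emeasure (subspace_lborel E) (orth_proj E ` K) * emeasure (subspace_lborel ?F) P =
      (\<integral>\<^sup>+x. indicator (orth_proj E ` K) x * emeasure (subspace_lborel ?F) P \<partial>subspace_lborel E)"
    by (simp add: nn_integral_multc)
  also have "\<dots> \<le> (\<integral>\<^sup>+x. emeasure (subspace_lborel ?F) {y. x + y \<in> K + P} \<partial>subspace_lborel E)"
  proof (rule nn_integral_mono)
    fix x
    show "indicator (orth_proj E ` K) x * emeasure (subspace_lborel ?F) P \<le>
        emeasure (subspace_lborel ?F) {y. x + y \<in> K + P}"
    proof (cases "x \<in> orth_proj E ` K")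
      case True
      then obtain k where k: "k \<in> K" "x = orth_proj E k" by auto
      \<comment> \<open>The component of k orthogonal to E: shifting P by it lands in the fibre of K
        + P over x.\<close>
      let ?f = "k - x"
      have f: "?f \<in> ?F" using k orth_proj_mem[OF E, of k] by simp
      have P': "compact ((+) ?f ` P)" using P by (rule_tac compact_translation)
      have "emeasure (subspace_lborel ?F) P = emeasure (subspace_lborel ?F) ((+) ?f ` P)"
        using measure_subspace_lborel_translation[OF F P f]
          emeasure_subspace_lborel_finite[OF F compact_imp_bounded[OF P(1)]]
          emeasure_subspace_lborel_finite[OF F compact_imp_bounded[OF P']]
        by (simp add: emeasure_eq_ennreal_measure less_top)
      also have "\<dots> \<le> emeasure (subspace_lborel ?F) {y. x + y \<in> K + P}"
      proof (rule emeasure_mono)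
        show "(+) ?f ` P \<subseteq> {y. x + y \<in> K + P}" using k by auto
        have "(\<lambda>y. x + y) -` (K + P) \<inter> space borel \<in> sets borel"
          by (rule measurable_sets[of _ borel borel]) auto
        then show "{y. x + y \<in> K + P} \<in> sets (subspace_lborel ?F)" by (simp add: vimage_def)
      qed
      finally show ?thesis using True by simp
    qed simp
  qed
  also have "\<dots> = emeasure lborel (K + P)"
    by (rule emeasure_lborel_sections[OF E, symmetric]) simp
  finally have le: "emeasure (subspace_lborel E) (orth_proj E ` K) * emeasure (subspace_lborel ?F) P
      \<le> emeasure lborel (K + P)" .
  have fin: "emeasure lborel (K + P) < top" using emeasure_compact_finite[OF cKP] by simp
  have "measure (subspace_lborel E) (orth_proj E ` K) * measure (subspace_lborel ?F) P =
    enn2real (emeasure (subspace_lborel E) (orth_proj E ` K) * emeasure (subspace_lborel ?F) P)"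
    by (simp add: measure_def enn2real_mult)
  also have "\<dots> \<le> vol (K + P)" unfolding measure_def by (rule enn2real_mono[OF le fin])
  finally show ?thesis .
qed

text \<open>K lies in the sum of its projection to E and a ball of radius r in the complement;
  adding P then gives an orthogonal sum, whose volume is a product.\<close>

lemma vol_plus_le:
  fixes E :: "'a::euclidean_space set"
  assumes E: "subspace E" and K: "compact K" "K \<subseteq> cball 0 r" and P: "compact P" "P \<subseteq> E\<^sup>\<bottom>"
  shows "vol (K + P) \<le> measure (subspace_lborel E) (orth_proj E ` K) *
    measure (subspace_lborel (E\<^sup>\<bottom>)) ((cball 0 r \<inter> E\<^sup>\<bottom>) + P)"
proof -
  let ?F = "E\<^sup>\<bottom>"
  note F = subspace_orthogonal_comp[of E]
  have cK: "compact (orth_proj E ` K)" by (rule compact_orth_proj[OF E K(1)])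
  have cP: "compact ((cball 0 r \<inter> ?F) + P)" by (intro compact_set_plus compact_cball_Int F P)
  have subF: "(cball 0 r \<inter> ?F) + P \<subseteq> ?F" using P(2) by (intro subspace_sum_minimal F) auto
  have "K \<subseteq> orth_proj E ` K + (cball 0 r \<inter> ?F)"
  proof
    fix k assume k: "k \<in> K"
    have "k - orth_proj E k \<in> cball 0 r \<inter> ?F"
      using orth_proj_mem[OF E, of k] norm_orth_proj_le[OF F, of k] K(2) k
      by (auto simp: orth_proj_orthogonal_comp[OF E])
    then have "orth_proj E k + (k - orth_proj E k) \<in> orth_proj E ` K + (cball 0 r \<inter> ?F)"
      using k by (intro set_plus_intro) auto
    then show "k \<in> orth_proj E ` K + (cball 0 r \<inter> ?F)" by simp
  qed
  then have "K + P \<subseteq> orth_proj E ` K + (cball 0 r \<inter> ?F) + P" by (intro set_plus_mono2) auto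
  then have "vol (K + P) \<le> vol (orth_proj E ` K + ((cball 0 r \<inter> ?F) + P))"
    using compact_set_plus[OF cK cP] compact_set_plus[OF K(1) P(1)] emeasure_compact_finite
    by (intro measure_mono_fmeasurable) (auto simp: fmeasurable_def borel_compact add.assoc)
  also have "\<dots> = measure (subspace_lborel E) (orth_proj E ` K) *
      measure (subspace_lborel ?F) ((cball 0 r \<inter> ?F) + P)"
    using orth_proj_mem(1)[OF E] by (intro vol_orthogonal_plus E cK cP subF) auto
  finally show ?thesis .
qed

text \<open>P is closed, so the thickenings decrease to P itself, and a measure is continuous from
  above along sets of finite measure.\<close>

lemma tendsto_measure_thickening:
  fixes F :: "'a::euclidean_space set"
  assumes F: "subspace F" and P: "compact P" and r: "0 \<le> r"
  shows "(\<lambda>m. measure (subspace_lborel F) ((cball 0 (r / real (Suc m)) \<inter> F) + P))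
    \<longlonglongrightarrow> measure (subspace_lborel F) P"
proof -
  define A where "A m = (cball 0 (r / real (Suc m)) \<inter> F) + P" for m
  have cA: "compact (A m)" for m unfolding A_def by (intro compact_set_plus compact_cball_Int F P)
  have "(\<lambda>m. measure (subspace_lborel F) (A m)) \<longlonglongrightarrow> measure (subspace_lborel F) (\<Inter>m. A m)"
  proof (rule Lim_measure_decseq)
    show "range A \<subseteq> sets (subspace_lborel F)" using cA by (auto simp: borel_compact)
    show "decseq A"
      unfolding decseq_def A_def
    proof (intro allI impI set_plus_mono2)
      fix m n :: nat assume "m \<le> n"
      then have "r / real (Suc n) \<le> r / real (Suc m)" using r by (intro divide_left_mono) auto
      then show "cball 0 (r / real (Suc n)) \<inter> F \<subseteq> cball 0 (r / real (Suc m)) \<inter> F" by auto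
    qed auto
    show "emeasure (subspace_lborel F) (A m) \<noteq> \<infinity>" for m
      using emeasure_subspace_lborel_finite[OF F compact_imp_bounded[OF cA[of m]]] by simp
  qed
  also have "(\<Inter>m. A m) = P"
  proof (intro equalityI subsetI)
    fix x assume x: "x \<in> (\<Inter>m. A m)"
    have "\<exists>y\<in>P. dist y x < e" if "0 < e" for e
    proof -
      obtain m where m: "r / e < real m" using reals_Archimedean2 by blast
      then have "r < e * real (Suc m)" using that by (simp add: field_simps)
      then have *: "r / real (Suc m) < e" by (simp add: field_simps)
      have "x \<in> A m" using x by auto
      then obtain z p where "z \<in> cball 0 (r / real (Suc m))" "p \<in> P" "x = z + p"
        unfolding A_def by (auto elim: set_plus_elim)
      then show ?thesis using * by (intro bexI[of _ p]) (auto simp: dist_norm)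
    qed
    then show "x \<in> P" using closed_approachable[OF compact_imp_closed[OF P]] by blast
  next
    fix x assume "x \<in> P"
    then have "0 + x \<in> A m" for m
      unfolding A_def using r subspace_0[OF F] by (intro set_plus_intro) auto
    then show "x \<in> (\<Inter>m. A m)" by simp
  qed
  finally show ?thesis unfolding A_def .
qed

lemma tendsto_Suc_power_divide:
  assumes "d \<le> j"
  shows "(\<lambda>m. real (Suc m) ^ d / real (Suc m) ^ j) \<longlonglongrightarrow> (if d = j then 1 else 0)"
proof (cases "d = j")
  case False
  then obtain i where i: "j = d + Suc i" using assms less_imp_Suc_add[of d j] by auto
  have "(\<lambda>m. inverse (real (Suc m)) ^ Suc i) \<longlonglongrightarrow> 0 ^ Suc i"
    by (intro tendsto_power LIMSEQ_inverse_real_of_nat)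
  moreover have "real (Suc m) ^ d / real (Suc m) ^ j = inverse (real (Suc m)) ^ Suc i" for m
    unfolding i power_add by (simp only: power_inverse) (simp add: field_simps del: power_Suc of_nat_Suc)
  ultimately show ?thesis using False by simp
qed simp

text \<open>\<^term>\<open>vol_diff u S K\<close> is the coefficient of \<open>s ^ card S\<close> in the polynomial
  \<open>vol (K + s *\<^sub>R P)\<close>, where \<open>P\<close> is the zonotope; for large \<open>s\<close> this volume is
  squeezed between \<open>s ^ d\<close> times a product measure and a slight thickening of it.\<close>

lemma vol_diff_eq:
  fixes K :: "'a::euclidean_space set" and u :: "'i \<Rightarrow> 'a"
  assumes S: "finite S" and K: "compact K" "convex K"
  defines "F \<equiv> span (u ` S)"
  shows "vol_diff u S K = (if dim F = card S
    then measure (subspace_lborel F) (zonotope u S) * measure (subspace_lborel (F\<^sup>\<bottom>)) (orth_proj (F\<^sup>\<bottom>) ` K)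
    else 0)"
proof -
  let ?j = "card S" and ?d = "dim F" and ?P = "zonotope u S" and ?E = "F\<^sup>\<bottom>"
  have F: "subspace F" unfolding F_def by simp
  have E: "subspace ?E" by (rule subspace_orthogonal_comp)
  have EF: "?E\<^sup>\<bottom> = F" by (rule orthogonal_comp_self[OF F])
  have PF: "?P \<subseteq> F" unfolding F_def by (rule zonotope_subset_span)
  have cP: "compact ?P" by simp
  have dj: "?d \<le> ?j"
    unfolding F_def dim_span using dim_le_card[of "u ` S" "u ` S"] card_image_le[OF S, of u] S
    by (meson finite_imageI le_trans span_superset)
  obtain r where r: "0 < r" "K \<subseteq> cball 0 r" by (rule compact_subset_cballE[OF K(1)])
  define s where "s m = real (Suc m)" for m
  have s: "0 < s m" for m by (simp add: s_def)
  define mE where "mE = measure (subspace_lborel ?E) (orth_proj ?E ` K)"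
  define U where "U m = measure (subspace_lborel F) ((cball 0 (r / s m) \<inter> F) + ?P)" for m
  define V where "V m = vol (K + (\<lambda>x. s m *\<^sub>R x) ` ?P)" for m
  have csP: "compact ((\<lambda>x. s m *\<^sub>R x) ` ?P)" "(\<lambda>x. s m *\<^sub>R x) ` ?P \<subseteq> F" for m
    using PF F by (auto intro: compact_scaling subspace_scale)
  have V_eq: "V m = (\<Sum>T\<in>Pow S. s m ^ card T * vol_diff u T K)" for m
  proof -
    have "V m = (\<Sum>T\<in>Pow S. (\<Prod>i\<in>T. s m) * vol_diff u T K)"
      unfolding V_def zonotope_scaleR[symmetric]
      using s[of m] by (intro vol_plus_scaled_segments S K) auto
    then show ?thesis by simp
  qed
  \<comment> \<open>Division by the top power removes every term in the limit except T = S.\<close>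
  have "(\<lambda>m. \<Sum>T\<in>Pow S. (s m ^ card T / s m ^ ?j) * vol_diff u T K) \<longlonglongrightarrow>
      (\<Sum>T\<in>Pow S. (if card T = ?j then 1 else 0) * vol_diff u T K)"
    unfolding s_def using S
    by (intro tendsto_sum tendsto_mult tendsto_const tendsto_Suc_power_divide) (auto intro: card_mono)
  also have "(\<Sum>T\<in>Pow S. (if card T = ?j then 1 else 0) * vol_diff u T K) =
      (\<Sum>T\<in>Pow S. if T = S then vol_diff u T K else 0)"
    using S by (intro sum.cong refl) (auto dest: card_subset_eq)
  also have "\<dots> = vol_diff u S K" using S by simp
  also have "(\<lambda>m. \<Sum>T\<in>Pow S. (s m ^ card T / s m ^ ?j) * vol_diff u T K) = (\<lambda>m. V m / s m ^ ?j)"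
    by (simp add: V_eq sum_divide_distrib)
  finally have lim1: "(\<lambda>m. V m / s m ^ ?j) \<longlonglongrightarrow> vol_diff u S K" .
  have lower: "s m ^ ?d / s m ^ ?j * (mE * measure (subspace_lborel F) ?P) \<le> V m / s m ^ ?j" for m
  proof -
    have "mE * (s m ^ ?d * measure (subspace_lborel F) ?P) \<le> V m"
      using vol_plus_ge[OF E K(1) csP(1)[of m]] csP(2)[of m]
        measure_subspace_lborel_scaleR[OF F cP PF s[of m]]
      by (simp add: EF mE_def V_def)
    then show ?thesis using s[of m] by (simp add: divide_right_mono mult_ac)
  qed
  have upper: "V m / s m ^ ?j \<le> s m ^ ?d / s m ^ ?j * (mE * U m)" for m
  proof -
    let ?A = "(cball 0 (r / s m) \<inter> F) + ?P"
    have cA: "compact ?A" by (intro compact_set_plus compact_cball_Int F) simp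
    have AF: "?A \<subseteq> F" using PF by (intro subspace_sum_minimal F) auto
    \<comment> \<open>A thickening by the fixed radius r is, relative to the scaled zonotope, one by
      r / s m, which disappears in the limit.\<close>
    have "(\<lambda>x. s m *\<^sub>R x) ` ?A = (cball 0 r \<inter> F) + (\<lambda>x. s m *\<^sub>R x) ` ?P"
      using s[of m] by (simp add: image_scaleR_plus scaleR_cball_Int[OF F])
    then have "V m \<le> mE * (s m ^ ?d * U m)"
      using vol_plus_le[OF E K(1) r(2) csP(1)[of m]] csP(2)[of m]
        measure_subspace_lborel_scaleR[OF F cA AF s[of m]]
      by (simp add: EF mE_def V_def U_def)
    then show ?thesis using s[of m] by (simp add: divide_right_mono mult_ac)
  qed
  \<comment> \<open>For dependent generators d < j: the volume grows too slowly to produce a term of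
    degree j, and the coefficient vanishes.\<close>
  let ?c = "if ?d = ?j then 1 else 0 :: real"
  have limc: "(\<lambda>m. s m ^ ?d / s m ^ ?j) \<longlonglongrightarrow> ?c"
    unfolding s_def by (rule tendsto_Suc_power_divide[OF dj])
  have limU: "U \<longlonglongrightarrow> measure (subspace_lborel F) ?P"
    unfolding U_def s_def using r by (intro tendsto_measure_thickening F cP) auto
  have "(\<lambda>m. V m / s m ^ ?j) \<longlonglongrightarrow> ?c * (mE * measure (subspace_lborel F) ?P)"
  proof (rule tendsto_sandwich)
    show "(\<lambda>m. s m ^ ?d / s m ^ ?j * (mE * measure (subspace_lborel F) ?P))
        \<longlonglongrightarrow> ?c * (mE * measure (subspace_lborel F) ?P)"
      by (intro tendsto_mult limc tendsto_const)
    show "(\<lambda>m. s m ^ ?d / s m ^ ?j * (mE * U m)) \<longlonglongrightarrow> ?c * (mE * measure (subspace_lborel F) ?P)"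
      by (intro tendsto_mult limc tendsto_const limU)
  qed (use lower upper in auto)
  with lim1 have "vol_diff u S K = ?c * (mE * measure (subspace_lborel F) ?P)"
    by (rule LIMSEQ_unique)
  then show ?thesis by (auto simp: mE_def)
qed

section \<open>Support functions\<close>

definition support_fun :: "'a::real_inner set \<Rightarrow> 'a \<Rightarrow> real" where
  "support_fun K v = (SUP x\<in>K. v \<bullet> x)"

lemma support_fun_attained:
  fixes K :: "'a::euclidean_space set"
  assumes "compact K" "K \<noteq> {}"
  obtains x where "x \<in> K" "v \<bullet> x = support_fun K v" "\<And>y. y \<in> K \<Longrightarrow> v \<bullet> y \<le> support_fun K v"
proof -
  have "continuous_on K ((\<bullet>) v)" by (intro continuous_intros)
  then obtain x where x: "x \<in> K" "\<And>y. y \<in> K \<Longrightarrow> v \<bullet> y \<le> v \<bullet> x"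
    using continuous_attains_sup[OF assms] by blast
  then have "support_fun K v = v \<bullet> x"
    unfolding support_fun_def by (intro cSup_eq_maximum) auto
  with x that show ?thesis by auto
qed

lemma inner_le_support_fun:
  fixes K :: "'a::euclidean_space set"
  assumes "compact K" "x \<in> K"
  shows "v \<bullet> x \<le> support_fun K v"
  using support_fun_attained[of K v] assms by (metis empty_iff)

lemma support_fun_plus:
  fixes A B :: "'a::euclidean_space set"
  assumes A: "compact A" "A \<noteq> {}" and B: "compact B" "B \<noteq> {}"
  shows "support_fun (A + B) v = support_fun A v + support_fun B v"
proof -
  obtain a where a: "a \<in> A" "v \<bullet> a = support_fun A v" using support_fun_attained[OF A] by metis
  obtain b where b: "b \<in> B" "v \<bullet> b = support_fun B v" using support_fun_attained[OF B] by metis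
  have "A + B \<noteq> {}" using a b by blast
  then obtain c where c: "c \<in> A + B" "v \<bullet> c = support_fun (A + B) v"
    using support_fun_attained[OF compact_set_plus[OF A(1) B(1)]] by metis
  obtain a' b' where "a' \<in> A" "b' \<in> B" "c = a' + b'" using c(1) by (auto elim: set_plus_elim)
  then have "support_fun (A + B) v \<le> support_fun A v + support_fun B v"
    using inner_le_support_fun[OF A(1), of a' v] inner_le_support_fun[OF B(1), of b' v] c(2)
    by (simp add: inner_add_right)
  moreover have "support_fun A v + support_fun B v \<le> support_fun (A + B) v"
    using inner_le_support_fun[OF compact_set_plus[OF A(1) B(1)], of "a + b" v] a b
    by (auto simp: inner_add_right)
  ultimately show ?thesis by simp
qed

lemma support_fun_segment:
  fixes u :: "'a::euclidean_space"
  shows "support_fun (closed_segment 0 u) v = max 0 (v \<bullet> u)"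
proof -
  obtain x where x: "x \<in> closed_segment 0 u" "v \<bullet> x = support_fun (closed_segment 0 u) v"
    using support_fun_attained[of "closed_segment 0 u" v] by auto
  then obtain r where "0 \<le> r" "r \<le> 1" "x = r *\<^sub>R u" by (auto simp: in_segment)
  then have "v \<bullet> x \<le> max 0 (v \<bullet> u)"
    using mult_left_le_one_le[of "v \<bullet> u" r] mult_nonneg_nonpos[of r "v \<bullet> u"]
    by (cases "v \<bullet> u \<ge> 0") auto
  moreover have "0 \<le> support_fun (closed_segment 0 u) v" "v \<bullet> u \<le> support_fun (closed_segment 0 u) v"
    using inner_le_support_fun[of "closed_segment 0 u" 0 v] inner_le_support_fun[of "closed_segment 0 u" u v]
    by auto
  ultimately show ?thesis using x by simp
qed

lemma zonotope_nonempty: "zonotope u S \<noteq> {}"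
proof -
  have "0 \<in> zonotope u S"
    unfolding zonotope_def by (induction S rule: infinite_finite_induct) (auto simp: set_plus_def intro: bexI[of _ 0])
  then show ?thesis by blast
qed

lemma support_fun_zonotope:
  fixes u :: "'i \<Rightarrow> 'a::euclidean_space"
  assumes "finite S"
  shows "support_fun (zonotope u S) v = (\<Sum>i\<in>S. max 0 (v \<bullet> u i))"
  using assms
proof induction
  case empty
  then show ?case by (simp add: support_fun_def)
next
  case (insert i S)
  then show ?case
    by (simp add: zonotope_insert support_fun_plus support_fun_segment zonotope_nonempty)
qed

lemma support_fun_cball:
  fixes v :: "'a::euclidean_space"
  assumes "0 \<le> r"
  shows "support_fun (cball 0 r) v = r * norm v"
proof -
  obtain x where x: "x \<in> cball (0::'a) r" "v \<bullet> x = support_fun (cball 0 r) v"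
    using support_fun_attained[of "cball 0 r" v] assms by auto
  have "v \<bullet> x \<le> norm v * norm x" by (rule norm_cauchy_schwarz)
  also have "\<dots> \<le> r * norm v" using x mult_left_mono[of "norm x" r "norm v"] by (simp add: mult.commute)
  finally have 1: "support_fun (cball 0 r) v \<le> r * norm v" using x by simp
  have "v \<bullet> ((r / norm v) *\<^sub>R v) \<le> support_fun (cball 0 r) v"
    using assms by (intro inner_le_support_fun) auto
  then have 2: "r * norm v \<le> support_fun (cball 0 r) v" if "v \<noteq> 0"
    using that by (simp add: dot_square_norm power2_eq_square)
  have 3: "0 \<le> support_fun (cball 0 r) v"
    using inner_le_support_fun[of "cball 0 r" 0 v] assms by simp
  show ?thesis using 1 2 3 by (cases "v = 0") auto
qed

lemma mem_iff_support_fun: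
  fixes K :: "'a::euclidean_space set"
  assumes K: "compact K" "convex K"
  shows "x \<in> K \<longleftrightarrow> K \<noteq> {} \<and> (\<forall>v. v \<bullet> x \<le> support_fun K v)"
proof (intro iffI conjI allI)
  assume *: "K \<noteq> {} \<and> (\<forall>v. v \<bullet> x \<le> support_fun K v)"
  show "x \<in> K"
  proof (rule ccontr)
    assume "x \<notin> K"
    then obtain a b where ab: "a \<bullet> x < b" "\<forall>y\<in>K. b < a \<bullet> y"
      using separating_hyperplane_closed_point[OF K(2) compact_imp_closed[OF K(1)]] by blast
    obtain y where y: "y \<in> K" "(- a) \<bullet> y = support_fun K (- a)"
      using support_fun_attained[OF K(1), of "- a"] * by metis
    have "(- a) \<bullet> x \<le> (- a) \<bullet> y" using * y by metis
    then show False using ab y by force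
  qed
qed (use inner_le_support_fun[OF K(1)] in auto)

text \<open>Inclusion of convex bodies is reduced to unit directions, the ones for which the random
  estimates are available.\<close>

lemma subset_of_support_fun_le:
  fixes A B :: "'a::euclidean_space set"
  assumes "compact A" "compact B" "convex B" "B \<noteq> {}"
    and "\<And>v. norm v = 1 \<Longrightarrow> support_fun A v \<le> support_fun B v"
  shows "A \<subseteq> B"
proof
  fix x assume x: "x \<in> A"
  have "v \<bullet> x \<le> support_fun B v" for v
  proof (cases "v = 0")
    case True
    then show ?thesis using support_fun_attained[of B v] assms by (metis inner_zero_left order_refl)
  next
    case False
    let ?w = "(1 / norm v) *\<^sub>R v"
    obtain b where b: "b \<in> B" "?w \<bullet> b = support_fun B ?w"
      using support_fun_attained[of B ?w] assms by metis
    have "?w \<bullet> x \<le> support_fun A ?w" by (rule inner_le_support_fun[OF assms(1) x])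
    also have "\<dots> \<le> ?w \<bullet> b" using assms(5)[of ?w] False b by simp
    finally have "v \<bullet> x \<le> v \<bullet> b" using False by (simp add: divide_le_cancel)
    also have "\<dots> \<le> support_fun B v" by (rule inner_le_support_fun[OF assms(2) b(1)])
    finally show ?thesis .
  qed
  then show "x \<in> B" using mem_iff_support_fun[OF assms(2,3)] assms(4) by blast
qed

lemma support_fun_lipschitz:
  fixes K :: "'a::euclidean_space set"
  assumes K: "compact K" "K \<noteq> {}" "K \<subseteq> cball 0 r"
  shows "\<bar>support_fun K v - support_fun K w\<bar> \<le> r * norm (v - w)"
proof -
  have *: "support_fun K v - support_fun K w \<le> r * norm (v - w)" for v w
  proof -
    obtain x where x: "x \<in> K" "v \<bullet> x = support_fun K v" using support_fun_attained[OF K(1,2)] by metis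
    have "support_fun K v - support_fun K w \<le> (v - w) \<bullet> x"
      using inner_le_support_fun[OF K(1) x(1), of w] x by (simp add: inner_diff_left)
    also have "\<dots> \<le> norm (v - w) * norm x" by (rule norm_cauchy_schwarz)
    also have "\<dots> \<le> r * norm (v - w)"
      using x(1) K(3) mult_left_mono[of "norm x" r "norm (v - w)"] by (auto simp: mult.commute)
    finally show ?thesis .
  qed
  show ?thesis using *[of v w] *[of w v] by (simp add: norm_minus_commute abs_le_iff)
qed

lemma continuous_on_support_fun:
  fixes K :: "'a::euclidean_space set"
  assumes "compact K" "K \<noteq> {}"
  shows "continuous_on UNIV (support_fun K)"
proof -
  obtain r where r: "0 < r" "K \<subseteq> cball 0 r" by (rule compact_subset_cballE[OF assms(1)])
  then have "r-lipschitz_on UNIV (support_fun K)"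
    using support_fun_lipschitz[OF assms r(2)] by (intro lipschitz_onI) (auto simp: dist_norm)
  then show ?thesis by (rule lipschitz_on_continuous_on)
qed

lemma countable_dense_closureE:
  obtains D :: "'a::{metric_space, second_countable_topology} set" where "countable D" "closure D = UNIV"
proof -
  obtain D :: "'a set" where D: "countable D" "\<And>X. open X \<Longrightarrow> X \<noteq> {} \<Longrightarrow> \<exists>d\<in>D. d \<in> X"
    using countable_dense_setE by blast
  have "closure D = UNIV"
  proof (rule UNIV_eq_I[symmetric])
    fix x :: 'a
    have "\<exists>d\<in>D. d \<in> ball x e" if "0 < e" for e using D(2)[of "ball x e"] that by auto
    then show "x \<in> closure D" by (auto simp: closure_approachable dist_commute)
  qed
  with D(1) show ?thesis by (rule that)
qed

text \<open>Support functions are continuous, so countably many inequalities decide membership. This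
  is what makes families of convex bodies jointly measurable in the parameter and the point.\<close>

lemma mem_iff_support_fun_dense:
  fixes K :: "'a::euclidean_space set"
  assumes K: "compact K" "convex K" "K \<noteq> {}" and D: "closure D = UNIV"
  shows "x \<in> K \<longleftrightarrow> (\<forall>v\<in>D. v \<bullet> x \<le> support_fun K v)"
proof
  assume *: "\<forall>v\<in>D. v \<bullet> x \<le> support_fun K v"
  have "closed {v. v \<bullet> x \<le> support_fun K v}"
    by (intro closed_Collect_le continuous_intros continuous_on_support_fun K)
  then have "closure D \<subseteq> {v. v \<bullet> x \<le> support_fun K v}"
    using * by (intro closure_minimal) auto
  then have "\<forall>v. v \<bullet> x \<le> support_fun K v" using D by auto
  then show "x \<in> K" using mem_iff_support_fun[OF K(1,2)] K(3) by blast
qed (use inner_le_support_fun[OF K(1)] in auto)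

section \<open>Measurability and bounds for mixed differences\<close>

text \<open>The pairs (u, x) with x in the sum are cut out by countably many inequalities between
  support functions, each measurable in (u, x); the volume is the measure of the section at
  u.\<close>

lemma measurable_vol_plus_zonotope:
  fixes K :: "'a::euclidean_space set"
  assumes K: "compact K" "convex K" and R: "finite R" "R \<subseteq> I" and c: "0 \<le> c"
    and M: "sets M = sets (\<Pi>\<^sub>M i\<in>I. borel)"
  shows "(\<lambda>u. vol (K + zonotope (\<lambda>i. c *\<^sub>R u i) R)) \<in> borel_measurable M"
proof (cases "K = {}")
  case False
  obtain D :: "'a set" where D: "countable D" "closure D = UNIV"
    by (rule countable_dense_closureE)
  let ?Q = "{(u, x). x \<in> K + zonotope (\<lambda>i. c *\<^sub>R u i) R} \<inter> space (M \<Otimes>\<^sub>M lborel)"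
  have mem: "x \<in> K + zonotope (\<lambda>i. c *\<^sub>R u i) R \<longleftrightarrow>
      (\<forall>v\<in>D. v \<bullet> x \<le> support_fun K v + (\<Sum>i\<in>R. max 0 (v \<bullet> c *\<^sub>R u i)))" for x u
  proof -
    have "K + zonotope (\<lambda>i. c *\<^sub>R u i) R \<noteq> {}"
      using False zonotope_nonempty by (metis ex_in_conv set_plus_intro)
    then show ?thesis
      using K R(1) False D(2)
      by (subst mem_iff_support_fun_dense[of _ D])
        (auto simp: compact_set_plus convex_set_plus support_fun_plus support_fun_zonotope zonotope_nonempty)
  qed
  have [measurable]: "(\<lambda>u. u i) \<in> borel_measurable M" if "i \<in> R" for i
    using that R(2) measurable_cong_sets[OF M refl] by (auto intro!: measurable_component_singleton)
  have [measurable]: "(\<lambda>p. fst p i) \<in> borel_measurable (M \<Otimes>\<^sub>M lborel)" if "i \<in> R" for i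
    using that by measurable
  have "?Q = {p \<in> space (M \<Otimes>\<^sub>M lborel). \<forall>v\<in>D. v \<bullet> snd p \<le> support_fun K v + (\<Sum>i\<in>R. max 0 (v \<bullet> c *\<^sub>R fst p i))}"
    by (auto simp: mem)
  also have "\<dots> \<in> sets (M \<Otimes>\<^sub>M lborel)"
    using D(1) by measurable
  finally have Q: "?Q \<in> sets (M \<Otimes>\<^sub>M lborel)" .
  have "(\<lambda>u. enn2real (emeasure lborel (Pair u -` ?Q))) \<in> borel_measurable M"
    using lborel.measurable_emeasure_Pair[OF Q] by measurable
  moreover have "enn2real (emeasure lborel (Pair u -` ?Q)) = vol (K + zonotope (\<lambda>i. c *\<^sub>R u i) R)"
    if "u \<in> space M" for u
    using that by (auto simp: measure_def space_pair_measure intro!: arg_cong[where f="\<lambda>x. enn2real (emeasure _ x)"])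
  ultimately show ?thesis by (simp cong: measurable_cong)
qed simp

lemma measurable_vol_diff:
  fixes K :: "'a::euclidean_space set"
  assumes K: "compact K" "convex K" and S: "finite S" "S \<subseteq> I"
    and M: "sets M = sets (\<Pi>\<^sub>M i\<in>I. borel)"
  shows "(\<lambda>u. vol_diff u S K) \<in> borel_measurable M"
proof -
  have "(\<lambda>u. vol (K + zonotope u R)) \<in> borel_measurable M" if "R \<in> Pow S" for R
    using measurable_vol_plus_zonotope[OF K, of R I 1 M] that S M finite_subset[OF _ S(1)] by auto
  then show ?thesis
    unfolding vol_diff_def by (intro borel_measurable_sum borel_measurable_times borel_measurable_const)
qed

lemma zonotope_subset_cball:
  fixes u :: "'i \<Rightarrow> 'a::euclidean_space"
  assumes S: "finite S" and u: "\<And>i. i \<in> S \<Longrightarrow> norm (u i) \<le> r"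
  shows "zonotope u S \<subseteq> cball 0 (real (card S) * r)"
  using assms
proof (induction S)
  case (insert i S)
  show ?case
  proof
    fix x assume "x \<in> zonotope u (insert i S)"
    then obtain y z where yz: "y \<in> closed_segment 0 (u i)" "z \<in> zonotope u S" "x = y + z"
      using insert.hyps by (auto simp: zonotope_insert elim: set_plus_elim)
    have "norm y \<le> norm (u i)" using segment_bound[OF yz(1)] by simp
    then have "norm y \<le> r" using insert.prems[of i] by simp
    moreover have "norm z \<le> real (card S) * r" using insert yz(2) by auto
    ultimately show "x \<in> cball 0 (real (card (insert i S)) * r)"
      using norm_triangle_ineq[of y z] insert.hyps yz(3) by (simp add: algebra_simps)
  qed
qed simp

lemma vol_mono:
  fixes A B :: "'a::euclidean_space set"
  assumes "A \<subseteq> B" "compact A" "compact B"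
  shows "vol A \<le> vol B"
  using assms emeasure_compact_finite[OF assms(3)]
  by (intro measure_mono_fmeasurable) (auto simp: fmeasurable_def borel_compact)

lemma vol_plus_zonotope_le:
  fixes K :: "'a::euclidean_space set"
  assumes K: "compact K" and S: "finite S" and u: "\<And>i. i \<in> S \<Longrightarrow> norm (u i) \<le> r"
  shows "vol (K + zonotope u S) \<le> vol (K + cball 0 (real (card S) * r))"
  using zonotope_subset_cball[OF S u] K by (intro vol_mono set_plus_mono2 compact_set_plus) auto

lemma abs_vol_diff_le:
  fixes K :: "'a::euclidean_space set"
  assumes K: "compact K" and S: "finite S" and u: "\<And>i. i \<in> S \<Longrightarrow> norm (u i) \<le> 1"
  shows "\<bar>vol_diff u S K\<bar> \<le> (\<Sum>R\<in>Pow S. vol (K + cball 0 (real (card R))))"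
proof -
  have "\<bar>(-1) ^ card (S - R) * vol (K + zonotope u R)\<bar> \<le> vol (K + cball 0 (real (card R)))"
    if "R \<in> Pow S" for R
    using vol_plus_zonotope_le[OF K, of R u 1] that u finite_subset[OF _ S] by (auto simp: abs_mult power_abs)
  then show ?thesis
    unfolding vol_diff_def by (intro order_trans[OF sum_abs] sum_mono)
qed

lemma vol_diff_reindex:
  assumes "inj_on h T"
  shows "vol_diff u (h ` T) K = vol_diff (\<lambda>i. u (h i)) T K"
proof -
  have inj: "inj_on ((`) h) (Pow T)" using assms by (rule inj_on_image_Pow)
  have "(-1) ^ card (h ` T - h ` R) * vol (K + zonotope u (h ` R)) =
      (-1) ^ card (T - R) * vol (K + zonotope (\<lambda>i. u (h i)) R)" if "R \<in> Pow T" for R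
  proof -
    have R: "R \<subseteq> T" using that by auto
    have "h ` T - h ` R = h ` (T - R)" using assms R by (simp add: inj_on_image_set_diff)
    moreover have "card (h ` (T - R)) = card (T - R)"
      by (rule card_image[OF inj_on_subset[OF assms]]) blast
    moreover have "zonotope u (h ` R) = zonotope (\<lambda>i. u (h i)) R"
      unfolding zonotope_def by (subst sum.reindex[OF inj_on_subset[OF assms R]]) (simp add: comp_def)
    ultimately show ?thesis by simp
  qed
  then show ?thesis
    unfolding vol_diff_def image_Pow_surj[OF refl, of h T, symmetric] by (subst sum.reindex[OF inj]) auto
qed

lemma vol_diff_cong:
  assumes "\<And>i. i \<in> S \<Longrightarrow> u i = u' i"
  shows "vol_diff u S K = vol_diff u' S K"
  unfolding vol_diff_def zonotope_def
  using assms by (intro sum.cong arg_cong2[where f="(*)"] arg_cong[where f=vol] arg_cong2[where f="(+)"] refl) auto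

text \<open>More vectors than the dimension are dependent. Hence the expansion stops at the degree
  \<open>DIM('a)\<close>, however many segments are added.\<close>

lemma vol_diff_eq_0:
  fixes K :: "'a::euclidean_space set"
  assumes "finite S" "compact K" "convex K" "DIM('a) < card S"
  shows "vol_diff u S K = 0"
  using vol_diff_eq[OF assms(1-3), of u] dim_subset_UNIV[of "span (u ` S)"] assms(4) by auto

section \<open>Random zonotopes\<close>

text \<open>The solid ball is preferred to the sphere because its uniform law inherits rotation
  invariance directly from \<open>lborel\<close>, without a surface measure.\<close>

definition ball_measure :: "'a::euclidean_space measure" where
  "ball_measure = uniform_measure lborel (cball 0 1)"

text \<open>For j up to the dimension and a nonempty compact convex K, Steiner's formula identifies
  this with the j-th quermassintegral up to a factor independent of K.\<close>

definition mean_vol_diff :: "nat \<Rightarrow> 'a::euclidean_space set \<Rightarrow> real" where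
  "mean_vol_diff j K = (\<integral>u. vol_diff u {..<j} K \<partial>(\<Pi>\<^sub>M i\<in>{..<j}. ball_measure))"

lemma sets_ball_measure [simp, measurable_cong]: "sets ball_measure = sets borel"
  and space_ball_measure [simp]: "space ball_measure = UNIV"
  by (simp_all add: ball_measure_def)

lemma emeasure_lborel_cball_1:
  "emeasure lborel (cball (0::'a::euclidean_space) 1) \<noteq> 0"
  "emeasure lborel (cball (0::'a::euclidean_space) 1) \<noteq> \<infinity>"
  using emeasure_cball[of 1 "0::'a"] less_imp_neq[OF unit_ball_vol_pos, of "real DIM('a)"] by auto

lemma prob_space_ball_measure: "prob_space (ball_measure :: 'a::euclidean_space measure)"
  unfolding ball_measure_def by (rule prob_space_uniform_measure) (rule emeasure_lborel_cball_1)+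

lemma prob_space_PiM_ball_measure: "prob_space (\<Pi>\<^sub>M i\<in>I. ball_measure :: 'a::euclidean_space measure)"
  by (intro prob_space_PiM prob_space_ball_measure)

lemma sets_PiM_ball_measure:
  "sets (\<Pi>\<^sub>M i\<in>I. ball_measure :: 'a::euclidean_space measure) = sets (\<Pi>\<^sub>M i\<in>I. borel)"
  by (intro sets_PiM_cong) auto

lemma AE_ball_measure: "AE x in ball_measure. norm (x :: 'a::euclidean_space) \<le> 1"
  unfolding ball_measure_def by (rule AE_uniform_measureI) auto

lemma AE_PiM_ball_measure:
  assumes "finite I"
  shows "AE u in (\<Pi>\<^sub>M i\<in>I. ball_measure :: 'a::euclidean_space measure). \<forall>i\<in>I. norm (u i) \<le> 1"
  using assms by (intro AE_finite_allI AE_PiM_component prob_space_ball_measure AE_ball_measure)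

lemma measurable_orthogonal_ball_measure:
  fixes T :: "'a::euclidean_space \<Rightarrow> 'a"
  assumes "orthogonal_transformation T"
  shows "T \<in> ball_measure \<rightarrow>\<^sub>M ball_measure"
  using orthogonal_transformation_linear[OF assms] measurable_cong_sets[OF sets_ball_measure sets_ball_measure]
  by (auto intro!: borel_measurable_continuous_onI continuous_on_linear)

lemma distr_ball_measure_orthogonal:
  fixes T :: "'a::euclidean_space \<Rightarrow> 'a"
  assumes T: "orthogonal_transformation T"
  shows "distr ball_measure borel T = ball_measure"
proof (rule measure_eqI)
  have [measurable]: "T \<in> borel_measurable borel"
    using orthogonal_transformation_linear[OF T]
    by (intro borel_measurable_continuous_onI continuous_on_linear)
  fix A assume "A \<in> sets (distr ball_measure borel T)"
  then have A [measurable]: "A \<in> sets borel" by simp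
  have "emeasure (distr ball_measure borel T) A = emeasure ball_measure (T -` A)"
    by (subst emeasure_distr) auto
  also have "\<dots> = emeasure lborel (cball 0 1 \<inter> T -` A) / emeasure lborel (cball (0::'a) 1)"
    unfolding ball_measure_def
    by (rule emeasure_uniform_measure) (use measurable_sets[of T borel borel A] in auto)
  also have "cball 0 1 \<inter> T -` A = T -` (cball 0 1 \<inter> A) \<inter> space lborel"
    using orthogonal_transformation_norm[OF T] by auto
  also have "emeasure lborel \<dots> = emeasure (distr lborel borel T) (cball 0 1 \<inter> A)"
    by (rule emeasure_distr[symmetric]) auto
  also have "\<dots> = emeasure lborel (cball 0 1 \<inter> A)"
    by (simp add: distr_lborel_orthogonal[OF T])
  also have "\<dots> / emeasure lborel (cball (0::'a) 1) = emeasure ball_measure A"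
    unfolding ball_measure_def by (rule emeasure_uniform_measure[symmetric]) auto
  finally show "emeasure (distr ball_measure borel T) A = emeasure ball_measure A" .
qed simp

lemma integrable_vol_diff:
  fixes K :: "'a::euclidean_space set"
  assumes K: "compact K" "convex K" and I: "finite I" "S \<subseteq> I"
  shows "integrable (\<Pi>\<^sub>M i\<in>I. ball_measure) (\<lambda>u. vol_diff u S K)"
proof -
  interpret prob_space "\<Pi>\<^sub>M i\<in>I. ball_measure :: 'a measure" by (rule prob_space_PiM_ball_measure)
  have S: "finite S" using I finite_subset by blast
  show ?thesis
  proof (rule integrable_const_bound)
    show "AE u in (\<Pi>\<^sub>M i\<in>I. ball_measure). norm (vol_diff u S K) \<le> (\<Sum>R\<in>Pow S. vol (K + cball 0 (real (card R))))"
      using AE_PiM_ball_measure[OF I(1)]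
    proof eventually_elim
      case (elim u)
      then show ?case using abs_vol_diff_le[OF K(1) S, of u] I(2) by auto
    qed
    show "(\<lambda>u. vol_diff u S K) \<in> borel_measurable (\<Pi>\<^sub>M i\<in>I. ball_measure)"
      by (rule measurable_vol_diff[OF K S I(2) sets_PiM_ball_measure])
  qed
qed

text \<open>The generators are independent and identically distributed, so only the number of those
  selected by S matters.\<close>

lemma integral_vol_diff:
  fixes K :: "'a::euclidean_space set"
  assumes K: "compact K" "convex K" and I: "finite I" "S \<subseteq> I"
  shows "(\<integral>u. vol_diff u S K \<partial>(\<Pi>\<^sub>M i\<in>I. ball_measure)) = mean_vol_diff (card S) K"
proof -
  let ?J = "{..<card S}" and ?b = "ball_measure :: 'a measure"
  have "finite S" using I finite_subset by blast
  then obtain h where h: "bij_betw h ?J S"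
    using ex_bij_betw_nat_finite[of S] by (auto simp: atLeast0LessThan)
  have inj: "inj_on h ?J" and hS: "h ` ?J = S" using h by (auto simp: bij_betw_def)
  let ?f = "\<lambda>u. \<lambda>i\<in>?J. u (h i)"
  have hI: "h \<in> ?J \<rightarrow> I" using hS I(2) by auto
  have d: "distr (\<Pi>\<^sub>M i\<in>I. ?b) (\<Pi>\<^sub>M i\<in>?J. ?b) ?f = (\<Pi>\<^sub>M i\<in>?J. ?b)"
    by (rule distr_PiM_reindex[OF prob_space_ball_measure inj hI])
  have f: "?f \<in> (\<Pi>\<^sub>M i\<in>I. ?b) \<rightarrow>\<^sub>M (\<Pi>\<^sub>M i\<in>?J. ?b)"
    using hI by (intro measurable_restrict measurable_component_singleton) auto
  have "mean_vol_diff (card S) K = (\<integral>u. vol_diff u ?J K \<partial>distr (\<Pi>\<^sub>M i\<in>I. ?b) (\<Pi>\<^sub>M i\<in>?J. ?b) ?f)"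
    by (simp add: mean_vol_diff_def d)
  also have "\<dots> = (\<integral>u. vol_diff (?f u) ?J K \<partial>(\<Pi>\<^sub>M i\<in>I. ?b))"
    by (rule integral_distr[OF f measurable_vol_diff[OF K _ order_refl sets_PiM_ball_measure]]) simp
  also have "\<dots> = (\<integral>u. vol_diff u S K \<partial>(\<Pi>\<^sub>M i\<in>I. ?b))"
  proof (rule Bochner_Integration.integral_cong)
    fix u
    have "vol_diff (?f u) ?J K = vol_diff (\<lambda>i. u (h i)) ?J K" by (rule vol_diff_cong) simp
    also have "\<dots> = vol_diff u (h ` ?J) K" by (rule vol_diff_reindex[OF inj, symmetric])
    finally show "vol_diff (?f u) ?J K = vol_diff u S K" by (simp only: hS)
  qed simp
  finally show ?thesis by simp
qed

lemma sum_Pow_card: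
  fixes f :: "nat \<Rightarrow> real"
  assumes "finite A"
  shows "(\<Sum>T\<in>Pow A. f (card T)) = (\<Sum>j\<le>card A. real (card A choose j) * f j)"
proof -
  have "(\<Sum>T\<in>Pow A. f (card T)) = (\<Sum>j\<in>{..card A}. \<Sum>T\<in>{T\<in>Pow A. card T = j}. f (card T))"
    using assms by (intro sum.group[symmetric]) (auto intro: card_mono)
  also have "\<dots> = (\<Sum>j\<le>card A. real (card A choose j) * f j)"
    using n_subsets[OF assms] by (intro sum.cong refl) (simp add: Pow_def)
  finally show ?thesis .
qed

text \<open>In the multi-affine expansion all subsets of j generators contribute the same average,
  which accounts for the binomial coefficient.\<close>

lemma integral_vol_plus_zonotope:
  fixes K :: "'a::euclidean_space set"
  assumes K: "compact K" "convex K" and c: "0 \<le> c"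
  shows "(\<integral>u. vol (K + zonotope (\<lambda>i. c *\<^sub>R u i) {..<N}) \<partial>(\<Pi>\<^sub>M i\<in>{..<N}. ball_measure)) =
    (\<Sum>j\<le>N. real (N choose j) * (c ^ j * mean_vol_diff j K))"
proof -
  let ?M = "\<Pi>\<^sub>M i\<in>{..<N}. ball_measure :: 'a measure"
  have "(\<integral>u. vol (K + zonotope (\<lambda>i. c *\<^sub>R u i) {..<N}) \<partial>?M) =
      (\<integral>u. (\<Sum>T\<in>Pow {..<N}. c ^ card T * vol_diff u T K) \<partial>?M)"
  proof (intro Bochner_Integration.integral_cong refl)
    fix u :: "nat \<Rightarrow> 'a"
    have "vol (K + zonotope (\<lambda>i. c *\<^sub>R u i) {..<N}) = (\<Sum>T\<in>Pow {..<N}. (\<Prod>i\<in>T. c) * vol_diff u T K)"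
      using c by (intro vol_plus_scaled_segments K) auto
    then show "vol (K + zonotope (\<lambda>i. c *\<^sub>R u i) {..<N}) = (\<Sum>T\<in>Pow {..<N}. c ^ card T * vol_diff u T K)"
      by simp
  qed
  also have "\<dots> = (\<Sum>T\<in>Pow {..<N}. \<integral>u. c ^ card T * vol_diff u T K \<partial>?M)"
    by (intro Bochner_Integration.integral_sum integrable_mult_right integrable_vol_diff K) auto
  also have "\<dots> = (\<Sum>T\<in>Pow {..<N}. c ^ card T * mean_vol_diff (card T) K)"
    by (intro sum.cong refl) (simp add: integral_vol_diff[OF K])
  also have "\<dots> = (\<Sum>j\<le>N. real (N choose j) * (c ^ j * mean_vol_diff j K))"
    using sum_Pow_card[of "{..<N}" "\<lambda>j. c ^ j * mean_vol_diff j K"] by simp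
  finally show ?thesis .
qed

lemma mean_vol_diff_eq_0:
  fixes K :: "'a::euclidean_space set"
  assumes "compact K" "convex K" "DIM('a) < j"
  shows "mean_vol_diff j K = 0"
  unfolding mean_vol_diff_def using assms by (simp add: vol_diff_eq_0)

lemma tendsto_choose_divide_power:
  "(\<lambda>N. real (N choose j) / real N ^ j) \<longlonglongrightarrow> 1 / fact j"
proof -
  have "(\<lambda>N. (\<Prod>i=0..<j. 1 - real i / real N) / fact j) \<longlonglongrightarrow> (\<Prod>i=0..<j. 1 - 0) / fact j"
    by (intro tendsto_divide tendsto_prod tendsto_diff tendsto_const lim_const_over_n) simp
  moreover have "\<forall>\<^sub>F N in sequentially. (\<Prod>i=0..<j. 1 - real i / real N) / fact j = real (N choose j) / real N ^ j"
    using eventually_gt_at_top[of 0]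
  proof eventually_elim
    case (elim N)
    have "real (N choose j) = (\<Prod>i=0..<j. real N - real i) / fact j"
      by (simp add: binomial_gbinomial gbinomial_prod_rev)
    also have "(\<Prod>i=0..<j. real N - real i) = (\<Prod>i=0..<j. real N * (1 - real i / real N))"
      using elim by (intro prod.cong refl) (simp add: field_simps)
    also have "\<dots> = real N ^ j * (\<Prod>i=0..<j. 1 - real i / real N)"
      by (simp add: prod.distrib)
    finally show ?case using elim by simp
  qed
  ultimately show ?thesis by (simp add: tendsto_cong)
qed

text \<open>Scaling by s / N attaches \<open>(N choose j) / N ^ j\<close> to degree j, which tends
  to 1 / j!. Degrees above the dimension vanish, so the limit is taken in a sum of fixed
  length.\<close>

lemma tendsto_integral_vol_plus_zonotope:
  fixes K :: "'a::euclidean_space set"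
  assumes K: "compact K" "convex K" and s: "0 \<le> s"
  shows "(\<lambda>N. \<integral>u. vol (K + zonotope (\<lambda>i. (s / real N) *\<^sub>R u i) {..<N}) \<partial>(\<Pi>\<^sub>M i\<in>{..<N}. ball_measure))
    \<longlonglongrightarrow> (\<Sum>j\<le>DIM('a). s ^ j / fact j * mean_vol_diff j K)"
proof -
  let ?m = "\<lambda>j. mean_vol_diff j K"
  have "(\<lambda>N. \<Sum>j\<le>DIM('a). (real (N choose j) / real N ^ j) * (s ^ j * ?m j)) \<longlonglongrightarrow>
      (\<Sum>j\<le>DIM('a). (1 / fact j) * (s ^ j * ?m j))"
    by (intro tendsto_sum tendsto_mult tendsto_const tendsto_choose_divide_power)
  moreover have "\<forall>\<^sub>F N in sequentially. (\<Sum>j\<le>DIM('a). (real (N choose j) / real N ^ j) * (s ^ j * ?m j)) =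
      (\<integral>u. vol (K + zonotope (\<lambda>i. (s / real N) *\<^sub>R u i) {..<N}) \<partial>(\<Pi>\<^sub>M i\<in>{..<N}. ball_measure))"
    using eventually_ge_at_top[of "DIM('a)"]
  proof eventually_elim
    case (elim N)
    have "(\<integral>u. vol (K + zonotope (\<lambda>i. (s / real N) *\<^sub>R u i) {..<N}) \<partial>(\<Pi>\<^sub>M i\<in>{..<N}. ball_measure)) =
        (\<Sum>j\<le>N. real (N choose j) * ((s / real N) ^ j * ?m j))"
      using s by (intro integral_vol_plus_zonotope K) simp
    also have "\<dots> = (\<Sum>j\<le>DIM('a). real (N choose j) * ((s / real N) ^ j * ?m j))"
      using elim by (intro sum.mono_neutral_right) (auto simp: mean_vol_diff_eq_0[OF K])
    finally show ?case by (simp add: power_divide)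
  qed
  ultimately show ?thesis by (simp add: tendsto_cong)
qed

section \<open>Random zonotopes approximate a ball\<close>

text \<open>The integral is the mean support function of a random segment in direction v; rotation
  invariance makes it constant on unit vectors, so \<gamma> is the radius of the limiting
  ball.\<close>

lemma integral_positive_part_ball_measure:
  obtains \<gamma> where "0 < \<gamma>"
    "\<And>v :: real ^ 'n. norm v = 1 \<Longrightarrow> (\<integral>u. max 0 (v \<bullet> u) \<partial>ball_measure) = \<gamma>"
proof -
  define g where "g v = (\<integral>u. max 0 (v \<bullet> u) \<partial>ball_measure)" for v :: "real ^ 'n"
  have inv: "g (T v) = g v" if T: "orthogonal_transformation T" for T and v :: "real ^ 'n"
  proof -
    have m: "T \<in> ball_measure \<rightarrow>\<^sub>M borel"
      using orthogonal_transformation_linear[OF T] measurable_cong_sets[OF sets_ball_measure refl]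
      by (auto intro!: borel_measurable_continuous_onI continuous_on_linear)
    have "g (T v) = (\<integral>u. max 0 (T v \<bullet> u) \<partial>distr ball_measure borel T)"
      by (simp add: g_def distr_ball_measure_orthogonal[OF T])
    also have "\<dots> = (\<integral>u. max 0 (T v \<bullet> T u) \<partial>ball_measure)"
      by (rule integral_distr[OF m]) measurable
    also have "\<dots> = g v"
      using T by (simp add: g_def orthogonal_transformation_def)
    finally show ?thesis .
  qed
  obtain e :: "real ^ 'n" where e: "norm e = 1" using vector_choose_size[of 1] by auto
  have eq: "g v = g e" if "norm v = 1" for v
    using orthogonal_transformation_exists_1[OF e that] inv by metis
  have "0 \<le> g e" unfolding g_def by (rule integral_nonneg_AE) simp
  \<comment> \<open>A vanishing mean would force e \<bullet> u \<le> 0 almost everywhere in the unit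
    ball, hence everywhere in the open ball because this condition is closed; but e / 2 violates
    it.\<close>
  moreover have "g e \<noteq> 0"
  proof
    assume g0: "g e = 0"
    interpret prob_space "ball_measure :: (real ^ 'n) measure" by (rule prob_space_ball_measure)
    have "integrable ball_measure (\<lambda>u. max 0 (e \<bullet> u))"
    proof (rule integrable_const_bound)
      show "AE u in ball_measure. norm (max 0 (e \<bullet> u)) \<le> 1"
        using AE_ball_measure
      proof eventually_elim
        case (elim u)
        then show ?case using norm_cauchy_schwarz[of e u] e by auto
      qed
    qed measurable
    then have "AE u in ball_measure. max 0 (e \<bullet> u) = 0"
      using integral_nonneg_eq_0_iff_AE[of ball_measure "\<lambda>u. max 0 (e \<bullet> u)"] g0 by (simp add: g_def)
    then have "AE u in lborel. u \<in> cball 0 1 \<longrightarrow> max 0 (e \<bullet> u) = 0"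
      unfolding ball_measure_def
      by (subst (asm) AE_uniform_measure) (use emeasure_lborel_cball_1[where 'a="real ^ 'n"] in \<open>auto simp: less_top\<close>)
    then have "AE u in lborel. u \<in> ball 0 1 \<longrightarrow> u \<in> {u. e \<bullet> u \<le> 0}"
      by eventually_elim (auto simp: max_def split: if_splits)
    then have "AE u \<in> ball 0 1 in lebesgue. u \<in> {u. e \<bullet> u \<le> 0}"
      by (rule AE_completion)
    moreover have "(1/2) *\<^sub>R e \<in> ball 0 1" using e by simp
    moreover have "closed {u. e \<bullet> u \<le> 0}" by (intro closed_Collect_le continuous_intros)
    ultimately have "(1/2) *\<^sub>R e \<in> {u. e \<bullet> u \<le> 0}"
      using mem_closed_if_AE_lebesgue_open[of "ball 0 1" "{u. e \<bullet> u \<le> 0}" "(1/2) *\<^sub>R e"] by auto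
    then show False using e by (simp add: norm_eq_1)
  qed
  ultimately have "0 < g e" by simp
  then show ?thesis using that[of "g e"] eq unfolding g_def by blast
qed

text \<open>Hoeffding's inequality: for a unit vector v and generators in the unit ball the summands
  lie in [0, 1]. It is the law of large numbers for one direction, with an explicit rate.\<close>

lemma prob_positive_part_deviation:
  fixes v :: "real ^ 'n"
  assumes v: "norm v = 1" and N: "0 < N" and e: "0 \<le> e"
    and g: "(\<integral>u. max 0 (v \<bullet> u) \<partial>ball_measure) = \<gamma>"
  defines "M \<equiv> \<Pi>\<^sub>M i\<in>{..<N}. (ball_measure :: (real ^ 'n) measure)"
  shows "measure M {u \<in> space M. \<bar>(\<Sum>i<N. max 0 (v \<bullet> u i)) / real N - \<gamma>\<bar> \<ge> e} \<le> 2 * exp (- 2 * real N * e\<^sup>2)"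
proof -
  let ?b = "ball_measure :: (real ^ 'n) measure"
  interpret prob_space M unfolding M_def by (rule prob_space_PiM_ball_measure)
  have comp: "(\<lambda>u. u i) \<in> M \<rightarrow>\<^sub>M ?b" if "i < N" for i
    unfolding M_def using that by (intro measurable_component_singleton) auto
  have dc: "distr M ?b (\<lambda>u. u i) = ?b" if "i < N" for i
    unfolding M_def using that by (intro distr_PiM_component prob_space_ball_measure) auto
  \<comment> \<open>Independence of the coordinates amounts to their joint law being the product
    measure itself.\<close>
  have "indep_vars (\<lambda>_. ?b) (\<lambda>i u. u i) {..<N}"
  proof (subst indep_vars_iff_distr_eq_PiM')
    have "distr M (\<Pi>\<^sub>M i\<in>{..<N}. ?b) (\<lambda>x. \<lambda>i\<in>{..<N}. x i) = distr M M (\<lambda>x. x)"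
      unfolding M_def by (rule distr_cong) (auto simp: space_PiM PiE_iff extensional_restrict)
    also have "\<dots> = M" by (simp add: distr_id2)
    also have "\<dots> = (\<Pi>\<^sub>M i\<in>{..<N}. distr M ?b (\<lambda>u. u i))"
      unfolding M_def[symmetric] by (subst M_def, rule PiM_cong) (simp_all add: dc)
    finally show "distr M (\<Pi>\<^sub>M i\<in>{..<N}. ?b) (\<lambda>x. \<lambda>i\<in>{..<N}. x i) = (\<Pi>\<^sub>M i\<in>{..<N}. distr M ?b (\<lambda>u. u i))" .
  qed (use N comp in auto)
  then have indep: "indep_vars (\<lambda>_. borel) (\<lambda>i u. max 0 (v \<bullet> u i)) {..<N}"
    by (rule indep_vars_compose2) measurable
  have d: "distr M borel (\<lambda>u. max 0 (v \<bullet> u i)) = distr ?b borel (\<lambda>x. max 0 (v \<bullet> x))" if "i < N" for i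
  proof -
    have "distr ?b borel (\<lambda>x. max 0 (v \<bullet> x)) = distr (distr M ?b (\<lambda>u. u i)) borel (\<lambda>x. max 0 (v \<bullet> x))"
      by (simp add: dc[OF that])
    also have "\<dots> = distr M borel (\<lambda>u. max 0 (v \<bullet> u i))"
      by (subst distr_distr[OF _ comp[OF that]]) (auto simp: comp_def)
    finally show ?thesis by simp
  qed
  have Y: "(\<lambda>u. max 0 (v \<bullet> u 0)) \<in> borel_measurable M"
    by (rule measurable_compose[OF comp[OF N]]) measurable
  have exp: "expectation (\<lambda>u. max 0 (v \<bullet> u 0)) = \<gamma>"
  proof -
    have "\<gamma> = (\<integral>x. max 0 (v \<bullet> x) \<partial>distr M ?b (\<lambda>u. u 0))" by (simp add: dc[OF N] g)
    also have "\<dots> = expectation (\<lambda>u. max 0 (v \<bullet> u 0))"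
      by (rule integral_distr[OF comp[OF N]]) measurable
    finally show ?thesis by simp
  qed
  have AE: "AE u in M. \<forall>i\<in>{..<N}. norm (u i) \<le> 1"
    unfolding M_def by (rule AE_PiM_ball_measure) simp
  interpret Hoeffding_ineq_iid M "{..<N}" "\<lambda>i u. max 0 (v \<bullet> u i)" "\<lambda>u. max 0 (v \<bullet> u 0)" 0 1 \<gamma>
  proof unfold_locales
    show "AE u in M. max 0 (v \<bullet> u 0) \<in> {0..1}"
      using AE
    proof eventually_elim
      case (elim u)
      then have "norm (u 0) \<le> 1" using N by auto
      then have "v \<bullet> u 0 \<le> 1" using norm_cauchy_schwarz[of v "u 0"] v by simp
      then show ?case by auto
    qed
  qed (use indep d N Y exp in auto)
  show ?thesis
    using Hoeffding_ineq_abs_ge'[OF e] N by (simp add: lessThan_empty_iff)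
qed

text \<open>Control on a finite net of directions suffices: the averaged zonotope lies in the unit
  ball, so its support function is 1-Lipschitz, and the error between net points rises from e to at
  most 2 * e.\<close>

lemma zonotope_near_ball:
  fixes u :: "nat \<Rightarrow> 'a::euclidean_space"
  assumes u: "\<And>i. i < N \<Longrightarrow> norm (u i) \<le> 1" and N: "0 < N"
    and T: "T \<subseteq> sphere 0 1" "sphere 0 1 \<subseteq> (\<Union>v\<in>T. ball v e)" and e: "0 < e" "2 * e \<le> \<gamma>"
    and dev: "\<And>v. v \<in> T \<Longrightarrow> \<bar>(\<Sum>i<N. max 0 (v \<bullet> u i)) / real N - \<gamma>\<bar> < e"
  shows "cball 0 (\<gamma> - 2 * e) \<subseteq> zonotope (\<lambda>i. (1 / real N) *\<^sub>R u i) {..<N}"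
    and "zonotope (\<lambda>i. (1 / real N) *\<^sub>R u i) {..<N} \<subseteq> cball 0 (\<gamma> + 2 * e)"
proof -
  let ?Z = "zonotope (\<lambda>i. (1 / real N) *\<^sub>R u i) {..<N}"
  have sub: "?Z \<subseteq> cball 0 1"
    using zonotope_subset_cball[of "{..<N}" "\<lambda>i. (1 / real N) *\<^sub>R u i" "1 / real N"] u N
    by (auto simp: divide_right_mono)
  have h: "support_fun ?Z v = (\<Sum>i<N. max 0 (v \<bullet> u i)) / real N" for v
  proof -
    have "max 0 (v \<bullet> (1 / real N) *\<^sub>R u i) = max 0 (v \<bullet> u i) / real N" for i
      using N by (auto simp: max_def field_simps)
    then show ?thesis by (simp add: support_fun_zonotope sum_divide_distrib)
  qed
  have near: "\<bar>support_fun ?Z v - \<gamma>\<bar> \<le> 2 * e" if v: "norm v = 1" for v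
  proof -
    obtain w where w: "w \<in> T" "dist w v < e" using T(2) v by auto
    have "\<bar>support_fun ?Z v - support_fun ?Z w\<bar> \<le> 1 * norm (v - w)"
      by (rule support_fun_lipschitz[OF _ zonotope_nonempty sub]) simp
    also have "\<dots> < e" using w by (simp add: dist_norm norm_minus_commute)
    finally show ?thesis using dev[OF w(1)] by (simp add: h)
  qed
  show "cball 0 (\<gamma> - 2 * e) \<subseteq> ?Z"
  proof (rule subset_of_support_fun_le)
    fix v :: 'a assume "norm v = 1"
    then show "support_fun (cball 0 (\<gamma> - 2 * e)) v \<le> support_fun ?Z v"
      using near[of v] e by (simp add: support_fun_cball abs_le_iff)
  qed (auto simp: zonotope_nonempty)
  show "?Z \<subseteq> cball 0 (\<gamma> + 2 * e)"
  proof (rule subset_of_support_fun_le)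
    fix v :: 'a assume "norm v = 1"
    then show "support_fun ?Z v \<le> support_fun (cball 0 (\<gamma> + 2 * e)) v"
      using near[of v] e by (simp add: support_fun_cball abs_le_iff)
  qed (use e in auto)
qed

text \<open>A dilation by r' / r about a point of K enlarges K and takes the radius r to r'.
  Together with monotonicity this is continuity of the volume in the radius, with an explicit
  modulus.\<close>

lemma vol_plus_cball_le_scaled:
  fixes K :: "'a::euclidean_space set"
  assumes K: "compact K" "convex K" "K \<noteq> {}" and r: "0 < r" "r \<le> r'"
  shows "vol (K + cball 0 r') \<le> (r' / r) ^ DIM('a) * vol (K + cball 0 r)"
proof -
  obtain a where a: "a \<in> K" using K by auto
  \<comment> \<open>With a point of the body moved to the origin, dilation by a factor at least 1
    yields a larger set.\<close>
  define L where "L = (+) (- a) ` K"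
  have L: "compact L" "convex L" "0 \<in> L"
    using a compact_translation[OF K(1), of "- a"] convex_translation[OF K(2), of "- a"]
    unfolding L_def by (auto intro: image_eqI[of _ _ a])
  have eq: "vol (K + cball 0 t) = vol (L + cball 0 t)" for t
  proof -
    have "L + cball 0 t = (+) (- a) ` (K + cball 0 t)"
      unfolding L_def translation_eq_set_plus by (rule add.assoc)
    then show ?thesis using vol_translation[of "- a" "K + cball 0 t"] by simp
  qed
  let ?c = "r' / r"
  have c: "1 \<le> ?c" using r by simp
  have LcL: "L \<subseteq> (\<lambda>x. ?c *\<^sub>R x) ` L"
  proof
    fix x assume x: "x \<in> L"
    have "(1 - 1 / ?c) *\<^sub>R 0 + (1 / ?c) *\<^sub>R x \<in> L"
      using c r by (intro convexD[OF L(2) L(3) x]) auto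
    moreover have "x = ?c *\<^sub>R ((1 / ?c) *\<^sub>R x)" using c r by simp
    ultimately show "x \<in> (\<lambda>x. ?c *\<^sub>R x) ` L" by (metis image_eqI add_0 scaleR_zero_right)
  qed
  have "(\<lambda>x. ?c *\<^sub>R x) ` cball (0::'a) r = cball 0 r'"
    using scaleR_cball_Int[of "UNIV :: 'a set" ?c r] c r by simp
  then have "L + cball 0 r' \<subseteq> (\<lambda>x. ?c *\<^sub>R x) ` (L + cball 0 r)"
    using LcL by (simp add: image_scaleR_plus set_plus_mono2)
  then have "vol (L + cball 0 r') \<le> vol ((\<lambda>x. ?c *\<^sub>R x) ` (L + cball 0 r))"
    using L by (intro vol_mono compact_set_plus compact_scaling) auto
  also have "\<dots> = ?c ^ DIM('a) * vol (L + cball 0 r)"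
    using c L by (intro vol_scaleR borel_compact compact_set_plus) auto
  finally show ?thesis by (simp add: eq)
qed

text \<open>Outside an event of small probability the random zonotope is squeezed between two balls;
  on that event the volume is still between 0 and \<open>vol (K + cball 0 s)\<close>. The event
  contributes nothing in the limit, while the expectations tend to L.\<close>

lemma steiner_bounds:
  fixes K :: "(real ^ 'n) set"
  assumes K: "compact K" "convex K" "K \<noteq> {}" and s: "0 < s" and e: "0 < e" "2 * e < \<gamma>"
    and g: "\<And>v :: real ^ 'n. norm v = 1 \<Longrightarrow> (\<integral>u. max 0 (v \<bullet> u) \<partial>ball_measure) = \<gamma>"
  defines "L \<equiv> \<Sum>j\<le>CARD('n). s ^ j / fact j * mean_vol_diff j K"
  shows "vol (K + cball 0 (s * (\<gamma> - 2 * e))) \<le> L" "L \<le> vol (K + cball 0 (s * (\<gamma> + 2 * e)))"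
proof -
  let ?M = "\<lambda>N. \<Pi>\<^sub>M i\<in>{..<N}. (ball_measure :: (real ^ 'n) measure)"
  let ?V = "\<lambda>N u. vol (K + zonotope (\<lambda>i. (s / real N) *\<^sub>R u i) {..<N})"
  let ?l = "vol (K + cball 0 (s * (\<gamma> - 2 * e)))" and ?u = "vol (K + cball 0 (s * (\<gamma> + 2 * e)))"
  let ?m = "vol (K + cball 0 s)"
  have lim: "(\<lambda>N. \<integral>u. ?V N u \<partial>?M N) \<longlonglongrightarrow> L"
    unfolding L_def using tendsto_integral_vol_plus_zonotope[OF K(1,2), of s] s by simp
  obtain T where T: "T \<subseteq> sphere (0 :: real ^ 'n) 1" "finite T" "sphere 0 1 \<subseteq> (\<Union>v\<in>T. ball v e)"
    using compactE_image[OF compact_sphere, of "sphere (0 :: real ^ 'n) 1" "\<lambda>v. ball v e" 0 1] e by force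
  \<comment> \<open>Union bound: the Hoeffding estimate times the number of directions in the
    net.\<close>
  define p where "p N = real (card T) * (2 * exp (- 2 * real N * e\<^sup>2))" for N
  have p: "p \<longlonglongrightarrow> 0"
  proof -
    have "(\<lambda>N. exp (- 2 * e\<^sup>2) ^ N) \<longlonglongrightarrow> 0"
      using e by (intro LIMSEQ_power_zero) simp
    then have "(\<lambda>N. real (card T) * (2 * exp (- 2 * e\<^sup>2) ^ N)) \<longlonglongrightarrow> real (card T) * (2 * 0)"
      by (intro tendsto_mult tendsto_const)
    moreover have "exp (- 2 * e\<^sup>2) ^ N = exp (- 2 * real N * e\<^sup>2)" for N
      by (simp add: exp_of_nat_mult[symmetric] mult_ac)
    ultimately show ?thesis unfolding p_def by simp
  qed
  have bounds: "(1 - p N) * ?l \<le> (\<integral>u. ?V N u \<partial>?M N) \<and> (\<integral>u. ?V N u \<partial>?M N) \<le> ?u + p N * ?m"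
    if N: "0 < N" for N
  proof -
    let ?bad = "\<lambda>v. {u \<in> space (?M N). \<bar>(\<Sum>i<N. max 0 (v \<bullet> u i)) / real N - \<gamma>\<bar> \<ge> e}"
    define Bad where "Bad = (\<Union>v\<in>T. ?bad v)"
    interpret prob_space "?M N" by (rule prob_space_PiM_ball_measure)
    have bad [measurable]: "?bad v \<in> sets (?M N)" for v by measurable
    then have Bad [measurable]: "Bad \<in> sets (?M N)" unfolding Bad_def using T(2) by auto
    have "prob Bad \<le> (\<Sum>v\<in>T. prob (?bad v))"
      unfolding Bad_def using T(2) bad by (intro finite_measure_subadditive_finite) auto
    also have "\<dots> \<le> (\<Sum>v\<in>T. 2 * exp (- 2 * real N * e\<^sup>2))"
      using T(1) e g N by (intro sum_mono prob_positive_part_deviation) auto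
    finally have pB: "prob Bad \<le> p N" by (simp add: p_def)
    have Vm: "?V N \<in> borel_measurable (?M N)"
      using s by (intro measurable_vol_plus_zonotope[OF K(1,2) _ _ _ sets_PiM_ball_measure]) auto
    have Z: "zonotope (\<lambda>i. (s / real N) *\<^sub>R u i) {..<N} =
        (\<lambda>x. s *\<^sub>R x) ` zonotope (\<lambda>i. (1 / real N) *\<^sub>R u i) {..<N}" for u :: "nat \<Rightarrow> real ^ 'n"
      by (subst zonotope_scaleR[symmetric]) simp
    have scb: "(\<lambda>x. s *\<^sub>R x) ` cball (0 :: real ^ 'n) t = cball 0 (s * t)" for t
      using scaleR_cball_Int[of "UNIV :: (real ^ 'n) set" s t] s by simp
    have AE_m: "AE u in ?M N. ?V N u \<le> ?m"
      using AE_PiM_ball_measure[OF finite_lessThan]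
    proof eventually_elim
      case (elim u)
      have "?V N u \<le> vol (K + cball 0 (real (card {..<N}) * (s / real N)))"
        using elim s by (intro vol_plus_zonotope_le K) (auto simp: divide_right_mono mult_left_le)
      then show ?case using N by simp
    qed
    have AE_lu: "AE u in ?M N. u \<notin> Bad \<longrightarrow> ?l \<le> ?V N u \<and> ?V N u \<le> ?u"
      using AE_PiM_ball_measure[OF finite_lessThan] AE_space
    proof eventually_elim
      case (elim u)
      show ?case
      proof
        assume nb: "u \<notin> Bad"
        have "cball 0 (\<gamma> - 2 * e) \<subseteq> zonotope (\<lambda>i. (1 / real N) *\<^sub>R u i) {..<N}"
          "zonotope (\<lambda>i. (1 / real N) *\<^sub>R u i) {..<N} \<subseteq> cball 0 (\<gamma> + 2 * e)"
          by (rule zonotope_near_ball[OF _ N T(1,3) e(1)];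
              use elim nb e in \<open>auto simp: Bad_def not_le\<close>)+
        then have "cball 0 (s * (\<gamma> - 2 * e)) \<subseteq> zonotope (\<lambda>i. (s / real N) *\<^sub>R u i) {..<N}"
          "zonotope (\<lambda>i. (s / real N) *\<^sub>R u i) {..<N} \<subseteq> cball 0 (s * (\<gamma> + 2 * e))"
          unfolding Z scb[symmetric] by - (intro image_mono, assumption)+
        then show "?l \<le> ?V N u \<and> ?V N u \<le> ?u"
          using K by (intro conjI vol_mono set_plus_mono2 compact_set_plus) auto
      qed
    qed
    have int: "integrable (?M N) (?V N)"
      using AE_m Vm by (intro integrable_const_bound[of _ ?m]) auto
    have intB: "integrable (?M N) (indicator Bad :: _ \<Rightarrow> real)"
      using Bad by (intro integrable_real_indicator) (auto simp: emeasure_eq_measure)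
    have "(\<integral>u. (1 - indicator Bad u) * ?l \<partial>?M N) \<le> (\<integral>u. ?V N u \<partial>?M N)"
    proof (rule integral_mono_AE)
      show "AE u in ?M N. (1 - indicator Bad u) * ?l \<le> ?V N u"
        using AE_lu by eventually_elim (auto simp: indicator_def)
      show "integrable (?M N) (\<lambda>u. (1 - indicator Bad u) * ?l)"
        by (intro integrable_mult_left Bochner_Integration.integrable_diff intB) auto
    qed (rule int)
    also have "(\<integral>u. (1 - indicator Bad u) * ?l \<partial>?M N) = (1 - prob Bad) * ?l"
      using intB Bad by (simp add: prob_space)
    finally have 1: "(1 - prob Bad) * ?l \<le> (\<integral>u. ?V N u \<partial>?M N)" .
    have "(1 - p N) * ?l \<le> (1 - prob Bad) * ?l" using pB by (intro mult_right_mono) auto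
    with 1 have A: "(1 - p N) * ?l \<le> (\<integral>u. ?V N u \<partial>?M N)" by linarith
    have "(\<integral>u. ?V N u \<partial>?M N) \<le> (\<integral>u. ?u + indicator Bad u * ?m \<partial>?M N)"
    proof (rule integral_mono_AE)
      show "AE u in ?M N. ?V N u \<le> ?u + indicator Bad u * ?m"
        using AE_lu AE_m by eventually_elim (auto simp: indicator_def add_increasing)
      show "integrable (?M N) (\<lambda>u. ?u + indicator Bad u * ?m)"
        by (intro integrable_mult_left Bochner_Integration.integrable_add intB) auto
    qed (rule int)
    also have "\<dots> = ?u + prob Bad * ?m"
      using intB Bad by (simp add: prob_space)
    also have "\<dots> \<le> ?u + p N * ?m" using pB by (intro add_left_mono mult_right_mono) auto
    finally show ?thesis using A by simp
  qed
  have "(\<lambda>N. (1 - p N) * ?l) \<longlonglongrightarrow> (1 - 0) * ?l" "(\<lambda>N. ?u + p N * ?m) \<longlonglongrightarrow> ?u + 0 * ?m"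
    by (intro tendsto_intros p)+
  then have l: "(\<lambda>N. (1 - p N) * ?l) \<longlonglongrightarrow> ?l" and u: "(\<lambda>N. ?u + p N * ?m) \<longlonglongrightarrow> ?u" by simp_all
  show "?l \<le> L"
    by (rule LIMSEQ_le[OF l lim]) (use bounds in \<open>auto intro!: exI[of _ 1]\<close>)
  show "L \<le> ?u"
    by (rule LIMSEQ_le[OF lim u]) (use bounds in \<open>auto intro!: exI[of _ 1]\<close>)
qed

text \<open>The two bounds of \<open>steiner_bounds\<close> are compared with the radius s *
  \<gamma> through \<open>vol_plus_cball_le_scaled\<close>, and the comparison factors tend to
  1.\<close>

lemma steiner_formula:
  obtains \<gamma> where "0 < \<gamma>"
    "\<And>(K :: (real ^ 'n) set) s. compact K \<Longrightarrow> convex K \<Longrightarrow> K \<noteq> {} \<Longrightarrow> 0 \<le> s \<Longrightarrow>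
      vol (K + cball 0 (s * \<gamma>)) = (\<Sum>j\<le>CARD('n). s ^ j / fact j * mean_vol_diff j K)"
proof -
  obtain \<gamma> where \<gamma>: "0 < \<gamma>" "\<And>v :: real ^ 'n. norm v = 1 \<Longrightarrow> (\<integral>u. max 0 (v \<bullet> u) \<partial>ball_measure) = \<gamma>"
    using integral_positive_part_ball_measure[where 'n='n] by metis
  have "vol (K + cball 0 (s * \<gamma>)) = (\<Sum>j\<le>CARD('n). s ^ j / fact j * mean_vol_diff j K)"
    if K: "compact K" "convex K" "K \<noteq> {}" and s: "0 \<le> s" for K :: "(real ^ 'n) set" and s
  proof (cases "s = 0")
    case True
    have "(\<Sum>j\<le>CARD('n). s ^ j / fact j * mean_vol_diff j K) = (\<Sum>j\<le>CARD('n). if j = 0 then mean_vol_diff 0 K else 0)"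
      using True by (intro sum.cong) auto
    also have "\<dots> = vol K"
      by (simp add: mean_vol_diff_def vol_diff_def prob_space.prob_space[OF prob_space_PiM_ball_measure])
    finally show ?thesis using True by simp
  next
    case False
    with s have s: "0 < s" by simp
    let ?L = "\<Sum>j\<le>CARD('n). s ^ j / fact j * mean_vol_diff j K" and ?v = "vol (K + cball 0 (s * \<gamma>))"
    \<comment> \<open>The denominators begin at 3 so that 2 * ?e m < \<gamma> holds already for m =
      0.\<close>
    let ?e = "\<lambda>m. \<gamma> / real (Suc (Suc (Suc m)))"
    have e0: "?e \<longlonglongrightarrow> 0"
      using LIMSEQ_Suc[OF LIMSEQ_Suc[OF LIMSEQ_Suc[OF lim_const_over_n[of \<gamma>]]]] by simp
    have e: "0 < ?e m" "2 * ?e m < \<gamma>" for m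
      using \<gamma>(1) by (auto simp: field_simps intro: add_pos_nonneg)
    let ?n = "CARD('n)"
    have "?v \<le> (\<gamma> / (\<gamma> - 2 * ?e m)) ^ ?n * ?L" for m
    proof -
      have "?v \<le> ((s * \<gamma>) / (s * (\<gamma> - 2 * ?e m))) ^ DIM(real ^ 'n) * vol (K + cball 0 (s * (\<gamma> - 2 * ?e m)))"
        using s e[of m] by (intro vol_plus_cball_le_scaled K mult_pos_pos mult_left_mono) auto
      also have "\<dots> = (\<gamma> / (\<gamma> - 2 * ?e m)) ^ ?n * vol (K + cball 0 (s * (\<gamma> - 2 * ?e m)))"
        using s by simp
      also have "\<dots> \<le> (\<gamma> / (\<gamma> - 2 * ?e m)) ^ ?n * ?L"
        using \<gamma> e[of m] s steiner_bounds(1)[OF K s e[of m] \<gamma>(2)] by (intro mult_left_mono) auto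
      finally show ?thesis .
    qed
    moreover have "(\<lambda>m. (\<gamma> / (\<gamma> - 2 * ?e m)) ^ ?n * ?L) \<longlonglongrightarrow> (\<gamma> / (\<gamma> - 2 * 0)) ^ ?n * ?L"
      using \<gamma>(1) by (intro tendsto_intros e0) auto
    ultimately have "?v \<le> (\<gamma> / (\<gamma> - 2 * 0)) ^ ?n * ?L"
      by (intro LIMSEQ_le_const) auto
    then have 1: "?v \<le> ?L" using \<gamma>(1) by simp
    have "?L \<le> ((\<gamma> + 2 * ?e m) / \<gamma>) ^ ?n * ?v" for m
    proof -
      have "?L \<le> vol (K + cball 0 (s * (\<gamma> + 2 * ?e m)))"
        by (rule steiner_bounds(2)[OF K s e[of m] \<gamma>(2)])
      also have "\<dots> \<le> ((s * (\<gamma> + 2 * ?e m)) / (s * \<gamma>)) ^ DIM(real ^ 'n) * ?v"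
        using s \<gamma>(1) e[of m] by (intro vol_plus_cball_le_scaled K mult_pos_pos mult_left_mono) auto
      also have "\<dots> = ((\<gamma> + 2 * ?e m) / \<gamma>) ^ ?n * ?v"
        using s by simp
      finally show ?thesis .
    qed
    moreover have "(\<lambda>m. ((\<gamma> + 2 * ?e m) / \<gamma>) ^ ?n * ?v) \<longlonglongrightarrow> ((\<gamma> + 2 * 0) / \<gamma>) ^ ?n * ?v"
      using \<gamma>(1) by (intro tendsto_intros e0) auto
    ultimately have "?L \<le> ((\<gamma> + 2 * 0) / \<gamma>) ^ ?n * ?v"
      by (intro LIMSEQ_le_const) auto
    then have "?L \<le> ?v" using \<gamma>(1) by simp
    with 1 show ?thesis by simp
  qed
  with \<gamma>(1) that show ?thesis by blast
qed

section \<open>Uniqueness of the invariant measure on the Grassmannian\<close>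

text \<open>The set \<open>X\<close> need not be measurable; it is only assumed to have full outer measure.
  Christensen's argument: by Fubini both measures give balls the same mass, and \<open>M U\<close> for
  an open set \<open>U\<close> is at most the lower limit of the averages of the \<open>N\<close>-density of \<open>U\<close> in small balls.\<close>

lemma uniformly_distributed_open_le:
  fixes M N :: "'a::{metric_space, second_countable_topology} measure"
  assumes M: "prob_space M" "sets M = sets borel" "\<And>Q. Q \<in> sets borel \<Longrightarrow> X \<subseteq> Q \<Longrightarrow> AE x in M. x \<in> Q"
    and N: "prob_space N" "sets N = sets borel" "\<And>Q. Q \<in> sets borel \<Longrightarrow> X \<subseteq> Q \<Longrightarrow> AE x in N. x \<in> Q"
    and gM: "\<And>x r. x \<in> X \<Longrightarrow> emeasure M (ball x r) = g r"
    and gN: "\<And>x r. x \<in> X \<Longrightarrow> emeasure N (ball x r) = h r"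
    and U: "open U"
  shows "emeasure M U \<le> emeasure N U"
proof -
  interpret M: prob_space M by fact
  interpret N: prob_space N by fact
  interpret P: pair_sigma_finite M N ..
  note [measurable_cong] = M(2) N(2)
  have Ub [measurable]: "U \<in> sets borel" using U by simp
  have D: "{p. dist (fst p) (snd p :: 'a) < r} \<in> sets ((borel :: 'a measure) \<Otimes>\<^sub>M borel)" for r
    unfolding borel_prod by (intro borel_open open_Collect_less continuous_intros)
  have bm: "(\<lambda>x. emeasure L (V \<inter> ball x r)) \<in> borel_measurable borel"
    if L: "prob_space L" "sets L = sets borel" and V: "V \<in> sets borel" for L :: "'a measure" and V r
  proof -
    interpret L: prob_space L by fact
    have "{p. snd p \<in> V} \<inter> {p. dist (fst p) (snd p :: 'a) < r} \<in> sets (borel \<Otimes>\<^sub>M borel)"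
    proof (rule sets.Int)
      have "{p \<in> space (borel \<Otimes>\<^sub>M borel). snd p \<in> V} \<in> sets (borel \<Otimes>\<^sub>M (borel :: 'a measure))"
        using V by measurable
      then show "{p. snd p \<in> V} \<in> sets ((borel :: 'a measure) \<Otimes>\<^sub>M borel)" by (simp add: space_pair_measure)
      show "{p. dist (fst p) (snd p :: 'a) < r} \<in> sets (borel \<Otimes>\<^sub>M borel)" by (rule D)
    qed
    also have "sets (borel \<Otimes>\<^sub>M borel) = sets (borel \<Otimes>\<^sub>M L)"
      by (intro sets_pair_measure_cong) (simp_all add: L)
    finally have "(\<lambda>x. emeasure L (Pair x -` ({p. snd p \<in> V} \<inter> {p. dist (fst p) (snd p :: 'a) < r}))) \<in> borel_measurable borel"
      by (rule L.measurable_emeasure_Pair)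
    moreover have "Pair x -` ({p. snd p \<in> V} \<inter> {p. dist (fst p) (snd p :: 'a) < r}) = V \<inter> ball x r" for x
      by auto
    ultimately show ?thesis by simp
  qed
  have AE_gN: "AE x in M. emeasure N (ball x r) = h r" for r
  proof -
    have "{x \<in> space borel. emeasure N (UNIV \<inter> ball x r) = h r} \<in> sets borel"
      using bm[OF N(1,2), of UNIV r] by measurable
    then show ?thesis using M(3)[of "{x. emeasure N (ball x r) = h r}"] gN by auto
  qed
  have AE_gM: "AE x in N. emeasure M (ball x r) = g r" for r
  proof -
    have "{x \<in> space borel. emeasure M (UNIV \<inter> ball x r) = g r} \<in> sets borel"
      using bm[OF M(1,2), of UNIV r] by measurable
    then show ?thesis using N(3)[of "{x. emeasure M (ball x r) = g r}"] gM by auto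
  qed
  \<comment> \<open>The relation dist x y < r is symmetric, so the mass that N gives to balls
    centred by M can be computed from the mass that M gives to balls centred by N.\<close>
  have swap: "(\<integral>\<^sup>+x. emeasure N (V \<inter> ball x r) \<partial>M) = (\<integral>\<^sup>+y. indicator V y * emeasure M (ball y r) \<partial>N)"
    if V [measurable]: "V \<in> sets borel" for V r
  proof -
    let ?I = "indicator {p. dist (fst p) (snd p :: 'a) < r} :: 'a \<times> 'a \<Rightarrow> ennreal"
    have [measurable]: "?I \<in> borel_measurable (M \<Otimes>\<^sub>M N)"
      using D sets_pair_measure_cong[OF M(2) N(2)] by (intro borel_measurable_indicator) simp
    have "(\<integral>\<^sup>+x. emeasure N (V \<inter> ball x r) \<partial>M) = (\<integral>\<^sup>+x. \<integral>\<^sup>+y. indicator V y * ?I (x, y) \<partial>N \<partial>M)"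
    proof (intro nn_integral_cong)
      fix x
      have "emeasure N (V \<inter> ball x r) = (\<integral>\<^sup>+y. indicator (V \<inter> ball x r) y \<partial>N)"
        by (rule nn_integral_indicator[symmetric]) (simp add: N(2) V sets.Int)
      also have "\<dots> = (\<integral>\<^sup>+y. indicator V y * ?I (x, y) \<partial>N)"
        by (intro nn_integral_cong) (auto simp: indicator_def)
      finally show "emeasure N (V \<inter> ball x r) = \<dots>" .
    qed
    also have "\<dots> = (\<integral>\<^sup>+y. \<integral>\<^sup>+x. indicator V y * ?I (x, y) \<partial>M \<partial>N)"
      by (rule P.Fubini'[symmetric]) measurable
    also have "\<dots> = (\<integral>\<^sup>+y. indicator V y * emeasure M (ball y r) \<partial>N)"
    proof (intro nn_integral_cong)
      fix y
      have "(\<integral>\<^sup>+x. indicator V y * ?I (x, y) \<partial>M) = (\<integral>\<^sup>+x. indicator V y * indicator (ball y r) x \<partial>M)"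
        by (intro nn_integral_cong) (auto simp: indicator_def dist_commute)
      also have "\<dots> = indicator V y * emeasure M (ball y r)"
        by (rule nn_integral_cmult_indicator) (simp add: M(2))
      finally show "(\<integral>\<^sup>+x. indicator V y * ?I (x, y) \<partial>M) = \<dots>" .
    qed
    finally show ?thesis .
  qed
  have gh: "h r = g r" for r
  proof -
    have "h r = (\<integral>\<^sup>+x. h r \<partial>M)" by (simp add: M.emeasure_space_1)
    also have "\<dots> = (\<integral>\<^sup>+x. emeasure N (UNIV \<inter> ball x r) \<partial>M)"
    proof (rule nn_integral_cong_AE)
      show "AE x in M. h r = emeasure N (UNIV \<inter> ball x r)" using AE_gN[of r] by eventually_elim simp
    qed
    also have "\<dots> = (\<integral>\<^sup>+y. indicator UNIV y * emeasure M (ball y r) \<partial>N)" by (rule swap) simp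
    also have "\<dots> = (\<integral>\<^sup>+y. g r \<partial>N)"
      using AE_gM by (intro nn_integral_cong_AE) auto
    also have "\<dots> = g r" by (simp add: N.emeasure_space_1)
    finally show ?thesis .
  qed
  have "\<exists>x. x \<in> X"
  proof (rule ccontr)
    assume "\<nexists>x. x \<in> X"
    with M(3)[of "{}"] have "AE x in M. False" by auto
    then show False by (simp add: M.AE_False)
  qed
  then obtain x0 where x0: "x0 \<in> X" by auto
  have gfin: "g r < \<infinity>" for r
    using gM[OF x0, of r] M.emeasure_finite[of "ball x0 r"] by (simp add: less_top)
  \<comment> \<open>If balls of radius r about points of X were null, the balls of radius r/2 about
    a countable dense set would cover the space, each of them either missing X or contained in such
    a null ball; then M would vanish.\<close>
  have gpos: "g r \<noteq> 0" if r: "0 < r" for r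
  proof
    assume g0: "g r = 0"
    obtain D :: "'a set" where D: "countable D" "\<And>Y. open Y \<Longrightarrow> Y \<noteq> {} \<Longrightarrow> \<exists>d\<in>D. d \<in> Y"
      using countable_dense_setE by blast
    have "AE x in M. x \<notin> ball d (r/2)" for d
    proof (cases "ball d (r/2) \<inter> X = {}")
      case True
      then show ?thesis using M(3)[of "- ball d (r/2)"] by (auto simp: borel_comp)
    next
      case False
      then obtain x where x: "x \<in> X" "dist d x < r/2" by auto
      have "ball d (r/2) \<subseteq> ball x r"
      proof
        fix y assume "y \<in> ball d (r/2)"
        then show "y \<in> ball x r" using dist_triangle[of x y d] x(2) by (simp add: dist_commute)
      qed
      moreover have "ball x r \<in> null_sets M" using gM[OF x(1), of r] g0 by (auto simp: M(2))
      ultimately have "ball d (r/2) \<in> null_sets M" by (rule null_sets_subset[rotated 2]) (simp add: M(2))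
      then show ?thesis by (rule AE_not_in)
    qed
    then have nb: "AE x in M. \<forall>d\<in>D. x \<notin> ball d (r/2)" using D(1) by (intro AE_ball_countable[THEN iffD2]) auto
    have ex: "\<exists>d\<in>D. x \<in> ball d (r/2)" for x
      using D(2)[of "ball x (r/2)"] r by (auto simp: dist_commute)
    have "AE x in M. False" using nb by (rule eventually_mono) (use ex in blast)
    then show False by (simp add: M.AE_False)
  qed
  define s where "s n = inverse (real (Suc n))" for n
  have s: "s \<longlonglongrightarrow> 0" "0 < s n" for n unfolding s_def by (rule LIMSEQ_inverse_real_of_nat) simp
  let ?f = "\<lambda>n x. emeasure N (U \<inter> ball x (s n)) / g (s n)"
  have Fm [measurable]: "(\<lambda>x. emeasure N (U \<inter> ball x (s n))) \<in> borel_measurable borel" for n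
    by (rule bm[OF N(1,2) Ub])
  have "emeasure M U = (\<integral>\<^sup>+x. indicator U x \<partial>M)"
    by (rule nn_integral_indicator[symmetric]) (simp add: M(2))
  also have "\<dots> \<le> (\<integral>\<^sup>+x. liminf (\<lambda>n. ?f n x) \<partial>M)"
  proof (rule nn_integral_mono_AE)
    show "AE x in M. indicator U x \<le> liminf (\<lambda>n. ?f n x)"
    proof -
      have "{x \<in> space borel. indicator U x \<le> liminf (\<lambda>n. ?f n x)} \<in> sets borel" by measurable
      moreover have "indicator U x \<le> liminf (\<lambda>n. ?f n x)" if "x \<in> X" for x
      proof (cases "x \<in> U")
        case True
        obtain e where e: "0 < e" "ball x e \<subseteq> U" using U True openE by blast
        have "\<forall>\<^sub>F n in sequentially. s n < e" using s(1) e(1) by (rule order_tendstoD)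
        then have "\<forall>\<^sub>F n in sequentially. 1 \<le> ?f n x"
        proof eventually_elim
          case (elim n)
          then have "U \<inter> ball x (s n) = ball x (s n)" using e by auto
          then show ?case
            using gN[OF \<open>x \<in> X\<close>, of "s n"] gh[of "s n"] gpos[OF s(2)[of n]] gfin[of "s n"]
            by (simp add: ennreal_divide_self less_top)
        qed
        then have "1 \<le> liminf (\<lambda>n. ?f n x)" by (rule Liminf_bounded)
        then show ?thesis using True by simp
      qed simp
      ultimately show ?thesis using M(3)[of "{x. indicator U x \<le> liminf (\<lambda>n. ?f n x)}"] by auto
    qed
  qed
  also have "\<dots> \<le> liminf (\<lambda>n. \<integral>\<^sup>+x. ?f n x \<partial>M)"
    by (rule nn_integral_liminf) measurable
  \<comment> \<open>After the swap, the mass that M gives to a ball cancels the normalisation, so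
    every average equals \<open>emeasure N U\<close> exactly.\<close>
  also have "(\<lambda>n. \<integral>\<^sup>+x. ?f n x \<partial>M) = (\<lambda>n. emeasure N U)"
  proof
    fix n
    have "(\<integral>\<^sup>+x. ?f n x \<partial>M) = (\<integral>\<^sup>+x. emeasure N (U \<inter> ball x (s n)) \<partial>M) / g (s n)"
      by (rule nn_integral_divide) measurable
    also have "(\<integral>\<^sup>+x. emeasure N (U \<inter> ball x (s n)) \<partial>M) = (\<integral>\<^sup>+y. indicator U y * emeasure M (ball y (s n)) \<partial>N)"
      by (rule swap) simp
    also have "\<dots> = (\<integral>\<^sup>+y. g (s n) * indicator U y \<partial>N)"
      using AE_gM[of "s n"] by (intro nn_integral_cong_AE) (auto simp: mult.commute)
    also have "\<dots> = g (s n) * emeasure N U"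
      by (rule nn_integral_cmult_indicator) (simp add: N(2))
    also have "\<dots> / g (s n) = emeasure N U"
      using gpos[OF s(2)[of n]] gfin[of "s n"] by (simp add: mult_divide_eq_ennreal mult.commute less_top)
    finally show "(\<integral>\<^sup>+x. ?f n x \<partial>M) = emeasure N U" .
  qed
  also have "liminf (\<lambda>n. emeasure N U) = emeasure N U" by (simp add: Liminf_const)
  finally show ?thesis .
qed

text \<open>The hypotheses are symmetric in M and N, so the inequality on open sets holds in both
  directions, and open sets generate the Borel sets.\<close>

lemma uniformly_distributed_measure_unique:
  fixes M N :: "'a::{metric_space, second_countable_topology} measure"
  assumes M: "prob_space M" "sets M = sets borel" "\<And>Q. Q \<in> sets borel \<Longrightarrow> X \<subseteq> Q \<Longrightarrow> AE x in M. x \<in> Q"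
    and N: "prob_space N" "sets N = sets borel" "\<And>Q. Q \<in> sets borel \<Longrightarrow> X \<subseteq> Q \<Longrightarrow> AE x in N. x \<in> Q"
    and gM: "\<And>x r. x \<in> X \<Longrightarrow> emeasure M (ball x r) = g r"
    and gN: "\<And>x r. x \<in> X \<Longrightarrow> emeasure N (ball x r) = h r"
  shows "M = N"
proof (rule measure_eqI_generator_eq[of "Collect open" UNIV M N "\<lambda>_. UNIV"])
  show "Int_stable (Collect (open :: 'a set \<Rightarrow> bool))" by (auto simp: Int_stable_def)
  show "sets M = sigma_sets UNIV (Collect open)" "sets N = sigma_sets UNIV (Collect open)"
    by (simp_all add: M(2) N(2) borel_def)
  interpret M: prob_space M by fact
  show "emeasure M UNIV \<noteq> \<infinity>" using M.emeasure_finite[of UNIV] by simp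
  fix U :: "'a set" assume "U \<in> Collect open"
  then have U: "open U" by simp
  show "emeasure M U = emeasure N U"
    by (rule antisym[OF uniformly_distributed_open_le[OF M N gM gN U] uniformly_distributed_open_le[OF N M gN gM U]])
qed auto

section \<open>Rotations acting on subspaces and on their projection matrices\<close>

lemma norm_matrix_sq:
  fixes A :: "real ^ 'n ^ 'm"
  shows "(norm A)\<^sup>2 = (\<Sum>j\<in>UNIV. (norm (column j A))\<^sup>2)"
proof -
  have "(norm A)\<^sup>2 = (\<Sum>i\<in>UNIV. \<Sum>j\<in>UNIV. (A $ i $ j)\<^sup>2)"
    by (simp add: norm_vec_def L2_set_def sum_nonneg)
  also have "\<dots> = (\<Sum>j\<in>UNIV. \<Sum>i\<in>UNIV. (A $ i $ j)\<^sup>2)" by (rule sum.swap)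
  also have "\<dots> = (\<Sum>j\<in>UNIV. (norm (column j A))\<^sup>2)"
    by (simp add: norm_vec_def L2_set_def sum_nonneg column_def)
  finally show ?thesis .
qed

lemma norm_transpose: "norm (transpose A :: real ^ 'n ^ 'n) = norm A"
proof -
  have "(norm (transpose A))\<^sup>2 = (\<Sum>i\<in>UNIV. (norm (row i A))\<^sup>2)"
    by (simp add: norm_matrix_sq column_transpose)
  also have "\<dots> = (norm A)\<^sup>2"
    by (simp add: norm_vec_def L2_set_def sum_nonneg row_def)
  finally show ?thesis by simp
qed

lemma orthogonal_transformation_mult_vec:
  fixes Q :: "real ^ 'n ^ 'n"
  assumes "orthogonal_matrix Q"
  shows "orthogonal_transformation ((*v) Q)"
  using assms by (simp add: orthogonal_transformation_matrix matrix_vector_mul_linear)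

text \<open>The norm of a matrix here is the Frobenius norm. Left multiplication acts on the columns
  separately, each by an isometry; right multiplication follows by transposing.\<close>

lemma norm_orthogonal_matrix_mult:
  fixes Q A :: "real ^ 'n ^ 'n"
  assumes "orthogonal_matrix Q"
  shows "norm (Q ** A) = norm A" "norm (A ** transpose Q) = norm A"
proof -
  have *: "norm (Q ** A) = norm A" for A :: "real ^ 'n ^ 'n"
  proof -
    have T: "orthogonal_transformation ((*v) Q)"
      by (rule orthogonal_transformation_mult_vec[OF assms])
    have "column j (Q ** A) = Q *v column j A" for j
      by (simp add: column_def matrix_matrix_mult_def matrix_vector_mult_def)
    then have "(norm (Q ** A))\<^sup>2 = (norm A)\<^sup>2"
      by (simp add: norm_matrix_sq orthogonal_transformation_norm[OF T])
    then show ?thesis by simp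
  qed
  then show "norm (Q ** A) = norm A" .
  have "norm (A ** transpose Q) = norm (Q ** transpose A)"
    by (subst norm_transpose[symmetric]) (simp add: matrix_transpose_mul)
  with * show "norm (A ** transpose Q) = norm A" by (simp add: norm_transpose)
qed

abbreviation proj_matrix :: "(real ^ 'n) set \<Rightarrow> real ^ 'n ^ 'n" where
  "proj_matrix E \<equiv> matrix (orth_proj E)"

lemma proj_matrix_works: "subspace E \<Longrightarrow> proj_matrix E *v x = orth_proj E x"
  by (simp add: linear_orth_proj matrix_works)

lemma orth_proj_orthogonal_image:
  fixes T :: "'a::euclidean_space \<Rightarrow> 'a"
  assumes T: "orthogonal_transformation T" and E: "subspace E"
  shows "orth_proj (T ` E) (T x) = T (orth_proj E x)"
proof (rule orth_proj_unique)
  have lin: "linear T" by (rule orthogonal_transformation_linear[OF T])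
  show "subspace (T ` E)" by (rule linear_subspace_image[OF lin E])
  show "T (orth_proj E x) \<in> T ` E" using orth_proj_mem[OF E] by auto
  have "T x - T (orth_proj E x) = T (x - orth_proj E x)" by (simp add: linear_diff[OF lin])
  then show "T x - T (orth_proj E x) \<in> (T ` E)\<^sup>\<bottom>"
    using orth_proj_mem(2)[OF E, of x] T
    by (auto simp: orthogonal_comp_def orthogonal_def orthogonal_transformation_def)
qed

lemma rotation_matrixD:
  fixes Q :: "real ^ 'n ^ 'n"
  assumes "rotation_matrix Q"
  shows "orthogonal_matrix Q" "orthogonal_transformation ((*v) Q)"
  using assms by (auto simp: rotation_matrix_def intro: orthogonal_transformation_mult_vec)

lemma proj_matrix_image:
  fixes Q :: "real ^ 'n ^ 'n"
  assumes Q: "orthogonal_matrix Q" and E: "subspace E"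
  shows "proj_matrix ((*v) Q ` E) = Q ** proj_matrix E ** transpose Q"
proof -
  have T: "orthogonal_transformation ((*v) Q)"
    by (rule orthogonal_transformation_mult_vec[OF Q])
  have E': "subspace ((*v) Q ` E)" by (intro linear_subspace_image E) simp
  have "proj_matrix ((*v) Q ` E) *v x = (Q ** proj_matrix E ** transpose Q) *v x" for x
  proof -
    have "x = Q *v (transpose Q *v x)"
      using Q by (metis matrix_vector_mul_assoc matrix_vector_mul_lid orthogonal_matrix_def)
    then have "orth_proj ((*v) Q ` E) x = Q *v orth_proj E (transpose Q *v x)"
      using orth_proj_orthogonal_image[OF T E, of "transpose Q *v x"] by simp
    then show ?thesis
      by (simp add: proj_matrix_works E E' matrix_vector_mul_assoc[symmetric] del: matrix_vector_mul_assoc)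
  qed
  then show ?thesis by (simp add: matrix_eq)
qed

lemma Gr_subspace: "E \<in> Gr k \<Longrightarrow> subspace E"
  by (simp add: Gr_def)

lemma linear_conjugation:
  fixes Q :: "real ^ 'n ^ 'n"
  shows "linear (\<lambda>A. Q ** A ** transpose Q)"
proof (rule linearI)
  fix A B :: "real ^ 'n ^ 'n" and c :: real
  have "(A + B) ** C = A ** C + B ** C" for A B C :: "real ^ 'n ^ 'n"
    by (simp add: matrix_matrix_mult_def vec_eq_iff sum.distrib distrib_right)
  then show "Q ** (A + B) ** transpose Q = Q ** A ** transpose Q + Q ** B ** transpose Q"
    by (simp add: matrix_add_ldistrib)
  have "Q ** (c *\<^sub>R A) = c *\<^sub>R (Q ** A)"
    by (simp add: matrix_matrix_mult_def vec_eq_iff sum_distrib_left mult_ac)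
  moreover have "(c *\<^sub>R B) ** C = c *\<^sub>R (B ** C)" for B C :: "real ^ 'n ^ 'n"
    by (simp add: matrix_matrix_mult_def vec_eq_iff sum_distrib_left mult_ac)
  ultimately show "Q ** (c *\<^sub>R A) ** transpose Q = c *\<^sub>R (Q ** A ** transpose Q)"
    by simp
qed

text \<open>Rotations act isometrically on projection matrices; this is the geometric input for
  comparing the masses of balls.\<close>

lemma dist_proj_matrix_image:
  fixes Q :: "real ^ 'n ^ 'n"
  assumes "orthogonal_matrix Q" "subspace E" "subspace F"
  shows "dist (proj_matrix ((*v) Q ` E)) (proj_matrix ((*v) Q ` F)) = dist (proj_matrix E) (proj_matrix F)"
proof -
  have "Q ** proj_matrix E ** transpose Q - Q ** proj_matrix F ** transpose Q =
      Q ** (proj_matrix E - proj_matrix F) ** transpose Q"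
    by (rule linear_diff[OF linear_conjugation, symmetric])
  then show ?thesis
    using assms by (simp add: dist_norm proj_matrix_image norm_orthogonal_matrix_mult)
qed

lemma rotation_image_Gr:
  assumes "rotation_matrix Q" "E \<in> Gr k"
  shows "(*v) Q ` E \<in> Gr k"
proof -
  note T = rotation_matrixD(2)[OF assms(1)]
  have "linear ((*v) Q)" by simp
  moreover have "inj ((*v) Q)" by (rule orthogonal_transformation_inj[OF T])
  ultimately have "dim ((*v) Q ` E) = dim E" by (intro dim_image_eq) (auto intro: inj_on_subset)
  then show ?thesis using assms(2) linear_subspace_image[of "(*v) Q" E] by (simp add: Gr_def)
qed

lemma space_Gr_borel [simp]: "space (Gr_borel k) = Gr k"
  by (simp add: Gr_borel_def)

lemma measurable_proj_matrix [measurable]: "proj_matrix \<in> borel_measurable (Gr_borel k)"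
  unfolding Gr_borel_def by (rule measurable_vimage_algebra1) simp

lemma measurable_into_Gr_borel:
  assumes "\<And>x. x \<in> space M \<Longrightarrow> f x \<in> Gr k" "(\<lambda>x. proj_matrix (f x)) \<in> borel_measurable M"
  shows "f \<in> M \<rightarrow>\<^sub>M Gr_borel k"
  unfolding Gr_borel_def using assms by (intro measurable_vimage_algebra2) auto

lemma measurable_rotation_Gr:
  fixes Q :: "real ^ 'n ^ 'n"
  assumes Q: "rotation_matrix Q"
  shows "(\<lambda>E. (*v) Q ` E) \<in> Gr_borel k \<rightarrow>\<^sub>M Gr_borel k"
proof (rule measurable_into_Gr_borel)
  have "(\<lambda>A. Q ** A ** transpose Q) \<in> borel_measurable borel"
    by (intro borel_measurable_continuous_onI continuous_on_linear linear_conjugation)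
  then have "(\<lambda>E. Q ** proj_matrix E ** transpose Q) \<in> borel_measurable (Gr_borel k)"
    using measurable_proj_matrix by (rule measurable_compose[rotated])
  then show "(\<lambda>E. proj_matrix ((*v) Q ` E)) \<in> borel_measurable (Gr_borel k)"
    by (rule measurable_cong[THEN iffD1, rotated])
      (simp add: proj_matrix_image[OF rotation_matrixD(1)[OF Q] Gr_subspace])
qed (use rotation_image_Gr[OF Q] in auto)

text \<open>Orthonormal bases of E and of its complement are sent to such bases for F. The resulting
  orthogonal map may reverse orientation; preceding it by the reflection along a unit vector of E,
  which leaves E invariant, corrects the determinant, and 1 \<le> k supplies this vector.\<close>

lemma rotation_transitive_Gr:
  fixes E F :: "(real ^ 'n) set"
  assumes E: "E \<in> Gr k" and F: "F \<in> Gr k" and k: "1 \<le> k"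
  obtains Q where "rotation_matrix Q" "(*v) Q ` E = F"
proof -
  have sE: "subspace E" and sF: "subspace F" and d: "dim E = k" "dim F = k"
    using E F by (auto simp: Gr_def)
  let ?A = "SOME B. orthonormal_basis_of E B" and ?B = "SOME B. orthonormal_basis_of F B"
  let ?A' = "SOME B. orthonormal_basis_of (E\<^sup>\<bottom>) B" and ?B' = "SOME B. orthonormal_basis_of (F\<^sup>\<bottom>) B"
  note A = orthonormal_basis_of_some[OF sE] and B = orthonormal_basis_of_some[OF sF]
    and A' = orthonormal_basis_of_some[OF subspace_orthogonal_comp[of E]]
    and B' = orthonormal_basis_of_some[OF subspace_orthogonal_comp[of F]]
  note DA = orthonormal_basis_ofD[OF A] and DB = orthonormal_basis_ofD[OF B]
    and DA' = orthonormal_basis_ofD[OF A'] and DB' = orthonormal_basis_ofD[OF B']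
  note AA = orthonormal_basis_of_union[OF A A'] and BB = orthonormal_basis_of_union[OF B B']
  note DAA = orthonormal_basis_ofD[OF AA(1)] and DBB = orthonormal_basis_ofD[OF BB(1)]
  have d': "dim (E\<^sup>\<bottom>) = dim (F\<^sup>\<bottom>)"
    using dim_orthogonal_comp[OF sE] dim_orthogonal_comp[OF sF] d by simp
  obtain g g' where g: "bij_betw g ?A ?B" and g': "bij_betw g' ?A' ?B'"
    using finite_same_card_bij[OF DA(1) DB(1)] finite_same_card_bij[OF DA'(1) DB'(1)] DA(2) DB(2) DA'(2) DB'(2) d d'
    by metis
  define G where "G x = (if x \<in> ?A then g x else g' x)" for x
  have G: "bij_betw G (?A \<union> ?A') (?B \<union> ?B')"
  proof (rule bij_betw_combine)
    show "bij_betw G ?A ?B" using g by (rule bij_betw_cong[THEN iffD1, rotated]) (simp add: G_def)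
    show "bij_betw G ?A' ?B'" using g' AA(2) by (intro bij_betw_cong[THEN iffD1, OF _ g']) (auto simp: G_def)
    show "?B \<inter> ?B' = {}" by (rule BB(2))
  qed
  obtain T where T: "linear T" "\<And>x. x \<in> ?A \<union> ?A' \<Longrightarrow> T x = G x"
    using linear_independent_extend[OF DAA(6)] by metis
  have TA: "T ` ?A = ?B"
    using T(2) g by (auto simp: G_def bij_betw_def image_iff)
  have TE: "T ` E = F"
    using span_linear_image[OF T(1), of ?A] TA DA(3) DB(3) by simp
  have orthT: "orthogonal_transformation T"
    unfolding orthogonal_transformation_def
  proof (intro conjI allI T(1))
    fix v w
    have "v \<in> span (?A \<union> ?A')" "w \<in> span (?A \<union> ?A')" using DAA(3) by auto
    then obtain p q where p: "v = (\<Sum>a\<in>?A \<union> ?A'. p a *\<^sub>R a)" and q: "w = (\<Sum>a\<in>?A \<union> ?A'. q a *\<^sub>R a)"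
      unfolding span_finite[OF DAA(1)] by auto
    have "T a \<bullet> T b = a \<bullet> b" if "a \<in> ?A \<union> ?A'" "b \<in> ?A \<union> ?A'" for a b
    proof -
      have "G a \<in> ?B \<union> ?B'" "G b \<in> ?B \<union> ?B'" "G a = G b \<longleftrightarrow> a = b"
        using that G by (auto simp: bij_betw_def inj_on_def)
      then show ?thesis using that DAA(7)[of a b] DBB(7)[of "G a" "G b"] T(2) by simp
    qed
    then show "T v \<bullet> T w = v \<bullet> w"
      unfolding p q linear_sum[OF T(1)] linear_scale[OF T(1)] inner_sum_left inner_sum_right inner_scaleR_left inner_scaleR_right
      by (intro sum.cong refl) simp
  qed
  have mT: "orthogonal_matrix (matrix T)" "(*v) (matrix T) = T"
    using orthT T(1) by (auto simp: orthogonal_transformation_matrix matrix_works)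
  show thesis
  proof (cases "det (matrix T) = 1")
    case True
    then show ?thesis using that[of "matrix T"] mT TE by (simp add: rotation_matrix_def)
  next
    case False
    then have detT: "det (matrix T) = -1" using det_orthogonal_matrix[OF mT(1)] by auto
    have "?A \<noteq> {}" using DA(2) d k by auto
    then obtain a where a: "a \<in> ?A" by auto
    have aE: "a \<in> E" and na: "a \<bullet> a = 1" using a DA(5,7) by auto
    define R where "R x = x - (2 * (a \<bullet> x)) *\<^sub>R a" for x
    have linR: "linear R" unfolding R_def by (intro linearI) (auto simp: algebra_simps inner_add_right)
    have R: "orthogonal_transformation R"
      unfolding orthogonal_transformation_def
    proof (intro conjI allI linR)
      fix v w show "R v \<bullet> R w = v \<bullet> w"
        unfolding R_def using na by (simp add: inner_diff_left inner_diff_right inner_commute algebra_simps)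
    qed
    have RR: "R (R x) = x" for x
      unfolding R_def using na by (simp add: inner_diff_right algebra_simps)
    have RE: "R ` E = E"
    proof -
      have "R x \<in> E" if "x \<in> E" for x
        unfolding R_def using that aE sE by (intro subspace_diff subspace_scale)
      then show ?thesis using RR by (auto intro: image_eqI[of _ R, OF RR[symmetric]])
    qed
    have detR: "det (matrix R) = -1"
    proof -
      \<comment> \<open>Any coordinate will do: an orthogonal map taking its axis vector to a
        conjugates R to the diagonal matrix with a single entry -1.\<close>
      obtain i :: 'n where True by simp
      obtain f :: "real ^ 'n \<Rightarrow> real ^ 'n" where f: "orthogonal_transformation f" "f (axis i 1) = a"
        using orthogonal_transformation_exists_1[OF norm_axis_1[of i] iffD2[OF norm_eq_1 na]] by blast
      have linf: "linear f" by (rule orthogonal_transformation_linear[OF f(1)])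
      let ?D = "(\<chi> p q. if p = q then (if p = i then -1 else 1) else 0) :: real ^ 'n ^ 'n"
      have D: "?D *v x = x - (2 * (axis i 1 \<bullet> x)) *\<^sub>R axis i 1" for x
      proof (subst vec_eq_iff, intro allI)
        fix p
        have "(?D *v x) $ p = (\<Sum>q\<in>UNIV. if q = p then (if p = i then - (x $ p) else x $ p) else 0)"
          unfolding matrix_vector_mult_def vec_lambda_beta by (intro sum.cong refl) auto
        also have "\<dots> = (if p = i then - (x $ p) else x $ p)" by simp
        finally show "(?D *v x) $ p = (x - (2 * (axis i 1 \<bullet> x)) *\<^sub>R axis i 1) $ p"
          by (simp add: inner_axis') (simp add: axis_def)
      qed
      have "R (f x) = f (?D *v x)" for x
      proof -
        have "a \<bullet> f x = axis i 1 \<bullet> x"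
          using f by (metis orthogonal_transformation_def)
        then show ?thesis
          unfolding R_def D using f(2) by (simp add: linear_diff[OF linf] linear_scale[OF linf])
      qed
      then have "R \<circ> f = f \<circ> (*v) ?D" by (auto simp: fun_eq_iff)
      then have "matrix R ** matrix f = matrix f ** ?D"
        using matrix_compose[OF linf linR] matrix_compose[OF matrix_vector_mul_linear linf, of ?D]
          matrix_of_matrix_vector_mul[of ?D] by simp
      then have "det (matrix R ** matrix f) = det (matrix f ** ?D)" by (rule arg_cong)
      then have "det (matrix R) * det (matrix f) = det (matrix f) * det ?D"
        by (simp only: det_mul)
      moreover have "det (matrix f) \<noteq> 0"
        using f(1) det_orthogonal_matrix[of "matrix f"] by (auto simp: orthogonal_transformation_matrix)
      ultimately have "det (matrix R) = det ?D" by simp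
      also have "\<dots> = (\<Prod>p\<in>UNIV. if p = i then -1 else 1)"
        by (subst det_diagonal) simp_all
      also have "\<dots> = -1" by simp
      finally show ?thesis .
    qed
    have "det (matrix (T \<circ> R)) = 1"
      using detT detR linR T(1) by (simp add: matrix_compose det_mul)
    moreover have orth: "orthogonal_transformation (T \<circ> R)"
      by (rule orthogonal_transformation_compose[OF orthT R])
    moreover have "(*v) (matrix (T \<circ> R)) = T \<circ> R"
      using orthogonal_transformation_linear[OF orth] by (auto simp: matrix_works)
    moreover have "(T \<circ> R) ` E = F" using RE TE by (metis image_comp)
    ultimately show ?thesis
      using that[of "matrix (T \<circ> R)"] by (simp add: rotation_matrix_def orthogonal_transformation_matrix)
  qed
qed

text \<open>The predicate under the definite description in \<open>Gr_measure\<close>, so that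
  existence and uniqueness can be treated separately.\<close>

definition invariant_Gr_measure :: "nat \<Rightarrow> (real ^ 'n) set measure \<Rightarrow> bool" where
  "invariant_Gr_measure k M \<longleftrightarrow> sets M = sets (Gr_borel k) \<and> prob_space M \<and>
     (\<forall>Q :: real ^ 'n ^ 'n. rotation_matrix Q \<longrightarrow> distr M (Gr_borel k) (\<lambda>E. (*v) Q ` E) = M)"

text \<open>A rotation taking E to F preserves M and, acting isometrically, pulls the ball about the
  matrix of F back to the ball about that of E.\<close>

lemma invariant_Gr_measure_ball:
  fixes E F :: "(real ^ 'n) set"
  assumes M: "invariant_Gr_measure k M" and E: "E \<in> Gr k" and F: "F \<in> Gr k" and k: "1 \<le> k"
  shows "emeasure (distr M borel proj_matrix) (ball (proj_matrix E) r) =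
    emeasure (distr M borel proj_matrix) (ball (proj_matrix F) r)"
proof -
  have sM: "sets M = sets (Gr_borel k)" using M by (simp add: invariant_Gr_measure_def)
  have spM: "space M = Gr k" using sets_eq_imp_space_eq[OF sM] by simp
  obtain Q where Q: "rotation_matrix Q" "(*v) Q ` E = F"
    using rotation_transitive_Gr[OF E F k] by blast
  have inv: "distr M (Gr_borel k) (\<lambda>E. (*v) Q ` E) = M"
    using M Q(1) by (simp add: invariant_Gr_measure_def)
  have Pm: "proj_matrix \<in> borel_measurable M"
    using measurable_proj_matrix measurable_cong_sets[OF sM refl] by blast
  have Qm: "(\<lambda>E. (*v) Q ` E) \<in> M \<rightarrow>\<^sub>M Gr_borel k"
    using measurable_rotation_Gr[OF Q(1)] measurable_cong_sets[OF sM refl] by blast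
  let ?B = "\<lambda>E. proj_matrix -` ball (proj_matrix E) r \<inter> Gr k"
  have B: "?B F \<in> sets (Gr_borel k)"
    using measurable_sets[OF measurable_proj_matrix, of "ball (proj_matrix F) r"] by simp
  have "emeasure (distr M borel proj_matrix) (ball (proj_matrix F) r) = emeasure M (?B F)"
    by (subst emeasure_distr[OF Pm]) (auto simp: spM)
  also have "\<dots> = emeasure (distr M (Gr_borel k) (\<lambda>E. (*v) Q ` E)) (?B F)" by (simp add: inv)
  also have "\<dots> = emeasure M ((\<lambda>E. (*v) Q ` E) -` ?B F \<inter> space M)"
    by (rule emeasure_distr[OF Qm B])
  also have "(\<lambda>E. (*v) Q ` E) -` ?B F \<inter> space M = ?B E"
  proof -
    have "dist (proj_matrix F) (proj_matrix ((*v) Q ` G)) = dist (proj_matrix E) (proj_matrix G)"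
      if "G \<in> Gr k" for G
      unfolding Q(2)[symmetric]
      by (rule dist_proj_matrix_image) (use rotation_matrixD(1)[OF Q(1)] that E Gr_subspace in auto)
    then show ?thesis using rotation_image_Gr[OF Q(1)] by (auto simp: spM)
  qed
  also have "emeasure M (?B E) = emeasure (distr M borel proj_matrix) (ball (proj_matrix E) r)"
    by (subst emeasure_distr[OF Pm]) (auto simp: spM)
  finally show ?thesis by simp
qed

text \<open>The Borel structure of the Grassmannian is pulled back along \<open>proj_matrix\<close>,
  so a measure on it is determined by its image on matrices; there the ball criterion applies, with
  X the set of projection matrices.\<close>

lemma invariant_Gr_measure_unique:
  fixes M N :: "(real ^ 'n) set measure"
  assumes M: "invariant_Gr_measure k M" and N: "invariant_Gr_measure k N" and k: "1 \<le> k"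
  shows "M = N"
proof -
  have sM: "sets M = sets (Gr_borel k)" and sN: "sets N = sets (Gr_borel k)"
    and pM: "prob_space M" and pN: "prob_space N"
    using M N by (simp_all add: invariant_Gr_measure_def)
  have spM: "space M = Gr k" and spN: "space N = Gr k"
    using sets_eq_imp_space_eq[OF sM] sets_eq_imp_space_eq[OF sN] by simp_all
  have Pm: "proj_matrix \<in> borel_measurable M" and Pn: "proj_matrix \<in> borel_measurable N"
    using measurable_proj_matrix measurable_cong_sets[OF sM refl] measurable_cong_sets[OF sN refl] by blast+
  interpret M: prob_space M by fact
  have "Gr k \<noteq> ({} :: (real ^ 'n) set set)" using M.not_empty spM by simp
  then obtain E0 :: "(real ^ 'n) set" where E0: "E0 \<in> Gr k" by auto
  let ?X = "proj_matrix ` (Gr k :: (real ^ 'n) set set)"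
  have AE: "AE x in distr L borel proj_matrix. x \<in> Q"
    if L: "sets L = sets (Gr_borel k)" "proj_matrix \<in> borel_measurable L" and Q: "Q \<in> sets borel" "?X \<subseteq> Q" for L Q
    using Q sets_eq_imp_space_eq[OF L(1)] by (subst AE_distr_iff[OF L(2)]) auto
  have eq: "distr M borel proj_matrix = distr N borel proj_matrix"
  proof (rule uniformly_distributed_measure_unique[where X="?X"])
    show "prob_space (distr M borel proj_matrix)" "prob_space (distr N borel proj_matrix)"
      using prob_space.prob_space_distr[OF pM Pm] prob_space.prob_space_distr[OF pN Pn] by auto
    show "AE x in distr M borel proj_matrix. x \<in> Q" "AE x in distr N borel proj_matrix. x \<in> Q"
      if "Q \<in> sets borel" "?X \<subseteq> Q" for Q
      using AE[OF sM Pm that] AE[OF sN Pn that] by auto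
    show "emeasure (distr M borel proj_matrix) (ball x r) = emeasure (distr M borel proj_matrix) (ball (proj_matrix E0) r)"
      "emeasure (distr N borel proj_matrix) (ball x r) = emeasure (distr N borel proj_matrix) (ball (proj_matrix E0) r)"
      if "x \<in> ?X" for x r
      using that invariant_Gr_measure_ball[OF M _ E0 k] invariant_Gr_measure_ball[OF N _ E0 k] by auto
  qed simp_all
  show ?thesis
  proof (rule measure_eqI)
    fix A assume "A \<in> sets M"
    then obtain A' where A': "A' \<in> sets borel" "A = proj_matrix -` A' \<inter> Gr k"
      unfolding sM Gr_borel_def by (subst (asm) sets_vimage_algebra2) auto
    have "emeasure M A = emeasure (distr M borel proj_matrix) A'"
      using A' by (subst emeasure_distr[OF Pm]) (auto simp: spM)
    also have "\<dots> = emeasure N A"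
      using A' unfolding eq by (subst emeasure_distr[OF Pn]) (auto simp: spN)
    finally show "emeasure M A = emeasure N A" .
  qed (simp add: sM sN)
qed

section \<open>Normalising the Steiner formula\<close>

lemma coeffs_eq_of_nonneg:
  fixes c d :: "nat \<Rightarrow> real"
  assumes eq: "\<And>t. 0 \<le> t \<Longrightarrow> (\<Sum>j\<le>n. c j * t ^ j) = (\<Sum>j\<le>n. d j * t ^ j)" and "j \<le> n"
  shows "c j = d j"
proof (rule ccontr)
  assume "c j \<noteq> d j"
  then have "finite {t. (\<Sum>j\<le>n. (c j - d j) * t ^ j) = 0}"
    using polyfun_finite_roots[of "\<lambda>j. c j - d j" n] \<open>j \<le> n\<close> by auto
  moreover have "{0..} \<subseteq> {t. (\<Sum>j\<le>n. (c j - d j) * t ^ j) = 0}"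
    using eq by (auto simp: left_diff_distrib sum_subtractf)
  ultimately have "finite {0 :: real..}" by (rule finite_subset[rotated])
  then show False by (simp add: infinite_Ici)
qed

lemma cball_plus_cball:
  assumes "0 < r" "0 \<le> t"
  shows "cball (0::'a::real_normed_vector) r + cball 0 t = cball 0 (r + t)"
proof (intro equalityI subsetI)
  fix x assume "x \<in> cball (0::'a) r + cball 0 t"
  then obtain y z where "y \<in> cball (0::'a) r" "z \<in> cball (0::'a) t" "x = y + z" by (auto elim: set_plus_elim)
  then show "x \<in> cball 0 (r + t)" using norm_triangle_ineq[of y z] by simp
next
  fix x :: 'a assume x: "x \<in> cball 0 (r + t)"
  have "(r / (r + t)) *\<^sub>R x + (t / (r + t)) *\<^sub>R x = x"
    using assms by (simp add: scaleR_add_left[symmetric] add_divide_distrib[symmetric])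
  moreover have "(r / (r + t)) *\<^sub>R x \<in> cball 0 r" "(t / (r + t)) *\<^sub>R x \<in> cball 0 t"
    using x assms by (auto simp: divide_le_eq mult_left_mono)
  ultimately show "x \<in> cball (0::'a) r + cball 0 t" by (metis set_plus_intro)
qed

lemma vol_cball:
  "0 \<le> r \<Longrightarrow> vol (cball (0::'a::euclidean_space) r) = unit_ball_vol (real DIM('a)) * r ^ DIM('a)"
  by (rule content_cball)

text \<open>For the unit ball both sides are explicit: the volume is \<kappa> * (1 + s * \<gamma>) ^
  n, and comparing coefficients evaluates the averages. Dividing by them eliminates \<gamma> and the
  factorials from Steiner's formula.\<close>

lemma
  fixes K :: "(real ^ 'n) set"
  shows mean_vol_diff_cball_pos: "j \<le> CARD('n) \<Longrightarrow> 0 < mean_vol_diff j (cball (0 :: real ^ 'n) 1)"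
    and vol_plus_cball: "compact K \<Longrightarrow> convex K \<Longrightarrow> K \<noteq> {} \<Longrightarrow> 0 \<le> t \<Longrightarrow>
      vol (K + cball 0 t) = (\<Sum>j\<le>CARD('n). real (CARD('n) choose j) *
        (unit_ball_vol (real CARD('n)) * mean_vol_diff j K / mean_vol_diff j (cball (0 :: real ^ 'n) 1)) * t ^ j)"
proof -
  let ?n = "CARD('n)" and ?B = "cball (0 :: real ^ 'n) 1" and ?\<kappa> = "unit_ball_vol (real CARD('n))"
  obtain \<gamma> where \<gamma>: "0 < \<gamma>"
    "\<And>(K :: (real ^ 'n) set) s. compact K \<Longrightarrow> convex K \<Longrightarrow> K \<noteq> {} \<Longrightarrow> 0 \<le> s \<Longrightarrow>
      vol (K + cball 0 (s * \<gamma>)) = (\<Sum>j\<le>?n. s ^ j / fact j * mean_vol_diff j K)"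
    by (rule steiner_formula) blast
  have \<kappa>: "0 < ?\<kappa>" by (rule unit_ball_vol_pos) simp
  then have \<kappa>0: "?\<kappa> \<noteq> 0" by (rule less_imp_neq[symmetric])
  have ball: "real (?n choose j) * ?\<kappa> * \<gamma> ^ j = mean_vol_diff j ?B / fact j" if "j \<le> ?n" for j
  proof (rule coeffs_eq_of_nonneg[OF _ that])
    fix s :: real assume s: "0 \<le> s"
    have "(\<Sum>j\<le>?n. mean_vol_diff j ?B / fact j * s ^ j) = vol (?B + cball 0 (s * \<gamma>))"
      using \<gamma>(2)[of ?B s] s by (simp add: mult.commute)
    also have "\<dots> = ?\<kappa> * (s * \<gamma> + 1) ^ ?n"
      using s \<gamma>(1) vol_cball[of "1 + s * \<gamma>", where 'a="real ^ 'n"] by (simp add: cball_plus_cball add.commute)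
    also have "\<dots> = (\<Sum>j\<le>?n. real (?n choose j) * ?\<kappa> * \<gamma> ^ j * s ^ j)"
      by (subst binomial_ring) (simp add: sum_distrib_left power_mult_distrib mult_ac)
    finally show "(\<Sum>j\<le>?n. real (?n choose j) * ?\<kappa> * \<gamma> ^ j * s ^ j) = (\<Sum>j\<le>?n. mean_vol_diff j ?B / fact j * s ^ j)"
      by simp
  qed
  have m: "mean_vol_diff j ?B = fact j * (real (?n choose j) * ?\<kappa> * \<gamma> ^ j)" if "j \<le> ?n" for j
    using ball[OF that] by (simp add: field_simps)
  have pos: "0 < mean_vol_diff j ?B" if "j \<le> ?n" for j
    unfolding m[OF that] using \<kappa> \<gamma>(1) that by (intro mult_pos_pos) auto
  then show "j \<le> ?n \<Longrightarrow> 0 < mean_vol_diff j ?B" .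
  assume K: "compact K" "convex K" "K \<noteq> {}" and t: "0 \<le> t"
  have "vol (K + cball 0 t) = (\<Sum>j\<le>?n. (t / \<gamma>) ^ j / fact j * mean_vol_diff j K)"
    using \<gamma>(2)[OF K, of "t / \<gamma>"] \<gamma>(1) t by simp
  also have "\<dots> = (\<Sum>j\<le>?n. real (?n choose j) * (?\<kappa> * mean_vol_diff j K / mean_vol_diff j ?B) * t ^ j)"
  proof (intro sum.cong refl)
    fix j assume "j \<in> {..?n}"
    then have j: "j \<le> ?n" by simp
    then have "real (?n choose j) \<noteq> 0" by simp
    then show "(t / \<gamma>) ^ j / fact j * mean_vol_diff j K =
        real (?n choose j) * (?\<kappa> * mean_vol_diff j K / mean_vol_diff j ?B) * t ^ j"
      unfolding m[OF j] using \<kappa>0 \<gamma>(1) by (simp add: field_simps)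
  qed
  finally show "vol (K + cball 0 t) = \<dots>" .
qed

section \<open>The law of the orthogonal complement of a random subspace\<close>

text \<open>The projection to the complement of the span of the first i vectors, in a form that is
  visibly measurable in u. If u i already lies in the span of its predecessors then w = 0 and
  nothing is subtracted, so dependent vectors cause no trouble.\<close>

primrec gram_schmidt_proj :: "(nat \<Rightarrow> 'a::real_inner) \<Rightarrow> nat \<Rightarrow> 'a \<Rightarrow> 'a" where
  "gram_schmidt_proj u 0 x = x"
| "gram_schmidt_proj u (Suc i) x = (let w = gram_schmidt_proj u i (u i) in
     gram_schmidt_proj u i x - ((w \<bullet> x) / (w \<bullet> w)) *\<^sub>R w)"

lemma gram_schmidt_proj_eq:
  fixes u :: "nat \<Rightarrow> 'a::euclidean_space"
  shows "gram_schmidt_proj u i x = orth_proj ((span (u ` {..<i}))\<^sup>\<bottom>) x"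
proof (induction i arbitrary: x)
  case 0
  show ?case by (simp add: orth_proj_unique)
next
  case (Suc i)
  let ?V = "span (u ` {..<i})" and ?V' = "span (u ` {..<Suc i})"
  define P where "P = orth_proj (?V\<^sup>\<bottom>)"
  define w where "w = P (u i)"
  define y where "y = P x - ((w \<bullet> x) / (w \<bullet> w)) *\<^sub>R w"
  have sV: "subspace (?V\<^sup>\<bottom>)" by (rule subspace_orthogonal_comp)
  have Pmem: "P z \<in> ?V\<^sup>\<bottom>" "z - P z \<in> ?V" for z
    using orth_proj_mem[OF sV, of z] by (auto simp: P_def orthogonal_comp_self)
  have sub: "?V \<subseteq> ?V'" by (intro span_mono) auto
  have ui: "u i \<in> ?V'" by (intro span_base) auto
  have wV: "w \<in> ?V\<^sup>\<bottom>" unfolding w_def by (rule Pmem)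
  have inner_w: "w \<bullet> P z = w \<bullet> z" for z
    using wV Pmem(2)[of z] by (auto simp: orthogonal_comp_def orthogonal_def inner_diff_right inner_commute)
  have "w \<bullet> y = 0"
    unfolding y_def by (cases "w = 0") (simp_all add: inner_diff_right inner_w)
  then have yw: "y \<bullet> w = 0" by (simp add: inner_commute)
  have yV: "y \<in> ?V\<^sup>\<bottom>" unfolding y_def by (intro subspace_diff[OF sV] subspace_scale[OF sV] Pmem wV)
  have "y \<bullet> u i = 0"
  proof -
    have "y \<bullet> (u i - w) = 0"
      using yV Pmem(2)[of "u i"] by (auto simp: w_def orthogonal_comp_def orthogonal_def inner_commute)
    then show ?thesis using yw by (simp add: inner_diff_right)
  qed
  then have "y \<bullet> z = 0" if "z \<in> u ` {..<Suc i}" for z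
  proof (cases "z = u i")
    case False
    then have "z \<in> u ` {..<i}" using that by (auto simp: less_Suc_eq)
    then have "z \<bullet> y = 0" using yV span_base[of z "u ` {..<i}"] by (auto simp: orthogonal_comp_def orthogonal_def)
    then show ?thesis by (simp add: inner_commute)
  qed (use \<open>y \<bullet> u i = 0\<close> in simp)
  then have y_orth: "y \<in> ?V'\<^sup>\<bottom>"
    using orthogonal_to_span[of _ "u ` {..<Suc i}" y] by (auto simp: orthogonal_comp_def orthogonal_def inner_commute)
  have "w \<in> ?V'"
    using span_diff[OF ui subsetD[OF sub Pmem(2)[of "u i"]]] by (simp add: w_def)
  then have "(x - P x) + ((w \<bullet> x) / (w \<bullet> w)) *\<^sub>R w \<in> ?V'"
    using Pmem(2)[of x] sub by (intro span_add span_scale) auto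
  also have "(x - P x) + ((w \<bullet> x) / (w \<bullet> w)) *\<^sub>R w = x - y" by (simp add: y_def)
  finally have "orth_proj (?V'\<^sup>\<bottom>) x = y"
    by (intro orth_proj_unique y_orth subspace_orthogonal_comp) (simp add: orthogonal_comp_self)
  moreover have "gram_schmidt_proj u (Suc i) x = y"
    using Suc.IH by (simp add: Let_def y_def w_def P_def)
  ultimately show ?case by simp
qed

lemma measurable_gram_schmidt_proj:
  fixes x :: "(nat \<Rightarrow> 'a::euclidean_space) \<Rightarrow> 'a"
  assumes M: "sets M = sets (\<Pi>\<^sub>M i\<in>{..<j}. borel)" and "i \<le> j" and x: "x \<in> borel_measurable M"
  shows "(\<lambda>u. gram_schmidt_proj u i (x u)) \<in> borel_measurable M"
  using assms(2,3)
proof (induction i arbitrary: x)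
  case (Suc i)
  have "(\<lambda>u. u i) \<in> borel_measurable (\<Pi>\<^sub>M i\<in>{..<j}. borel)"
    by (rule measurable_component_singleton) (use Suc.prems in simp)
  then have "(\<lambda>u. u i) \<in> borel_measurable M"
    unfolding measurable_cong_sets[OF M refl] .
  then have [measurable]: "(\<lambda>u. gram_schmidt_proj u i (u i)) \<in> borel_measurable M"
    using Suc by simp
  have [measurable]: "(\<lambda>u. gram_schmidt_proj u i (x u)) \<in> borel_measurable M" "x \<in> borel_measurable M"
    using Suc by simp_all
  show ?case unfolding gram_schmidt_proj.simps Let_def by measurable
qed simp

lemma measurable_matrix:
  fixes F :: "'b \<Rightarrow> real ^ 'n \<Rightarrow> real ^ 'n"
  assumes "\<And>x. (\<lambda>w. F w x) \<in> borel_measurable M"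
  shows "(\<lambda>w. matrix (F w)) \<in> borel_measurable M"
proof (subst borel_measurable_euclidean_space, intro ballI)
  fix b :: "real ^ 'n ^ 'n" assume "b \<in> Basis"
  then obtain i c where b: "b = axis i c" "c \<in> Basis" by (auto simp: Basis_vec_def)
  then obtain j where c: "c = axis j 1" by (auto simp: Basis_vec_def)
  have "matrix (F w) \<bullet> b = F w (axis j 1) \<bullet> axis i 1" for w
    by (simp add: b c inner_axis matrix_def)
  moreover have "(\<lambda>w. F w (axis j 1) \<bullet> axis i 1) \<in> borel_measurable M"
    using assms by measurable
  ultimately show "(\<lambda>w. matrix (F w) \<bullet> b) \<in> borel_measurable M" by simp
qed

lemma vol_diff_orthogonal_image:
  fixes T :: "'a::euclidean_space \<Rightarrow> 'a"
  assumes T: "orthogonal_transformation T" and K: "compact K"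
  shows "vol_diff (\<lambda>i. T (u i)) S (T ` K) = vol_diff u S K"
proof -
  have lin: "linear T" by (rule orthogonal_transformation_linear[OF T])
  have "vol (T ` K + zonotope (\<lambda>i. T (u i)) R) = vol (K + zonotope u R)" for R
  proof -
    have "zonotope (\<lambda>i. T (u i)) R = T ` zonotope u R"
      unfolding zonotope_def linear_image_set_sum[OF lin]
      by (intro sum.cong refl) (simp add: closed_segment_linear_image[OF lin, symmetric] linear_0[OF lin])
    then have "T ` K + zonotope (\<lambda>i. T (u i)) R = T ` (K + zonotope u R)"
      by (simp add: linear_image_set_plus[OF lin])
    then show ?thesis
      using emeasure_orthogonal_image[OF T compact_set_plus[OF K compact_zonotope[of u R]]] by (simp add: measure_def)
  qed
  then show ?thesis by (simp add: vol_diff_def)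
qed

lemma orthogonal_comp_orthogonal_image:
  fixes T :: "'a::euclidean_space \<Rightarrow> 'a"
  assumes T: "orthogonal_transformation T"
  shows "(T ` V)\<^sup>\<bottom> = T ` (V\<^sup>\<bottom>)"
proof (intro set_eqI iffI)
  fix x assume x: "x \<in> (T ` V)\<^sup>\<bottom>"
  obtain y where y: "x = T y" using orthogonal_transformation_surj[OF T] by (metis surjD)
  then have "y \<in> V\<^sup>\<bottom>"
    using x T by (auto simp: orthogonal_comp_def orthogonal_def orthogonal_transformation_def)
  then show "x \<in> T ` (V\<^sup>\<bottom>)" using y by simp
qed (use T in \<open>auto simp: orthogonal_comp_def orthogonal_def orthogonal_transformation_def\<close>)

section \<open>Projection volumes and the weighted law of the complement\<close>

definition proj_vol :: "'a::euclidean_space set \<Rightarrow> 'a set \<Rightarrow> real" where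
  "proj_vol K E = measure (subspace_lborel E) (orth_proj E ` K)"

lemma proj_vol_cball:
  fixes E :: "'a::euclidean_space set"
  assumes E: "subspace E"
  shows "proj_vol (cball 0 1) E = unit_ball_vol (real (dim E))"
proof -
  have "orth_proj E ` cball 0 1 = cball 0 1 \<inter> E"
  proof (intro equalityI subsetI)
    fix x assume x: "x \<in> cball 0 1 \<inter> E"
    then have "x = orth_proj E x"
      using orth_proj_unique[OF E, of x x] subspace_0[OF subspace_orthogonal_comp[of E]] by simp
    with x show "x \<in> orth_proj E ` cball 0 1" by blast
  next
    fix x assume "x \<in> orth_proj E ` cball 0 1"
    then obtain y where "x = orth_proj E y" "norm y \<le> 1" by auto
    then show "x \<in> cball 0 1 \<inter> E"
      using orth_proj_mem(1)[OF E, of y] norm_orth_proj_le[OF E, of y] by simp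
  qed
  then show ?thesis
    using measure_subspace_lborel_cball[OF E, of 1] by (simp add: proj_vol_def)
qed

text \<open>By \<open>vol_diff_eq\<close> the coefficients of K and of the unit ball share the
  parallelotope factor, so their ratio is that of the projection volumes. The product form also
  covers dependent generators, where both coefficients vanish.\<close>

lemma vol_diff_proj_vol:
  fixes K :: "'a::euclidean_space set" and u :: "'i \<Rightarrow> 'a"
  assumes S: "finite S" and K: "compact K" "convex K"
  defines "E \<equiv> (span (u ` S))\<^sup>\<bottom>"
  shows "vol_diff u S K * unit_ball_vol (real (dim E)) = vol_diff u S (cball 0 1) * proj_vol K E"
    and "vol_diff u S (cball 0 1) \<noteq> 0 \<Longrightarrow> dim E + card S = DIM('a)"
    and "0 \<le> vol_diff u S K"
proof -
  have E: "subspace E" unfolding E_def by (rule subspace_orthogonal_comp)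
  have B: "compact (cball (0::'a) 1)" "convex (cball (0::'a) 1)" by auto
  note eqK = vol_diff_eq[OF S K, of u, folded E_def proj_vol_def]
    and eqB = vol_diff_eq[OF S B, of u, folded E_def proj_vol_def]
  show "vol_diff u S K * unit_ball_vol (real (dim E)) = vol_diff u S (cball 0 1) * proj_vol K E"
    unfolding eqK eqB by (simp add: proj_vol_cball[OF E])
  show "0 \<le> vol_diff u S K"
    unfolding eqK by (simp add: proj_vol_def)
  show "dim E + card S = DIM('a)" if "vol_diff u S (cball 0 1) \<noteq> 0"
    using that dim_orthogonal_comp[of "span (u ` S)"] unfolding eqB E_def
    by (auto split: if_splits)
qed

text \<open>For dependent generators the complement has the wrong dimension. The default element of
  \<open>Gr k\<close> keeps all values in the Grassmannian; it is used only where the density of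
  \<open>complement_law\<close> is 0.\<close>

definition random_complement :: "nat \<Rightarrow> (nat \<Rightarrow> real ^ 'n) \<Rightarrow> (real ^ 'n) set" where
  "random_complement k u =
    (if vol_diff u {..<CARD('n) - k} (cball 0 1) = 0 then SOME E. E \<in> Gr k
     else (span (u ` {..<CARD('n) - k}))\<^sup>\<bottom>)"

text \<open>The density is the volume of the parallelotope of the generators, normalised to mean 1.
  With this weight the average of \<open>vol_diff\<close> for K turns into the integral of
  \<open>proj_vol K\<close>.\<close>

definition complement_law :: "nat \<Rightarrow> (real ^ 'n) set measure" where
  "complement_law k = distr
    (density (\<Pi>\<^sub>M i\<in>{..<CARD('n) - k}. ball_measure)
      (\<lambda>u. ennreal (vol_diff u {..<CARD('n) - k} (cball 0 1) / mean_vol_diff (CARD('n) - k) (cball (0 :: real ^ 'n) 1))))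
    (Gr_borel k) (random_complement k)"

lemma Gr_nonempty:
  assumes "k \<le> CARD('n)"
  shows "(SOME E. E \<in> Gr k) \<in> (Gr k :: (real ^ 'n) set set)"
proof -
  have "k \<le> dim (UNIV :: (real ^ 'n) set)" using assms by simp
  then obtain T :: "(real ^ 'n) set" where "subspace T" "dim T = k"
    by (rule choose_subspace_of_subspace) blast
  then have "\<exists>E :: (real ^ 'n) set. E \<in> Gr k" by (auto simp: Gr_def)
  then show ?thesis by (rule someI_ex)
qed

lemma random_complement_Gr:
  fixes u :: "nat \<Rightarrow> real ^ 'n"
  assumes k: "k \<le> CARD('n)"
  shows "random_complement k u \<in> Gr k"
  using Gr_nonempty[OF k] vol_diff_proj_vol(2)[of "{..<CARD('n) - k}" "cball 0 1" u] k
  by (auto simp: random_complement_def Gr_def subspace_orthogonal_comp)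

lemma measurable_random_complement:
  assumes k: "k \<le> CARD('n)"
  shows "random_complement k \<in> (\<Pi>\<^sub>M i\<in>{..<CARD('n) - k}. ball_measure :: (real ^ 'n) measure) \<rightarrow>\<^sub>M Gr_borel k"
proof (rule measurable_into_Gr_borel)
  let ?j = "CARD('n) - k" and ?B = "cball (0 :: real ^ 'n) 1"
  let ?M = "\<Pi>\<^sub>M i\<in>{..<?j}. ball_measure :: (real ^ 'n) measure"
  have [measurable]: "(\<lambda>u. vol_diff u {..<?j} ?B) \<in> borel_measurable ?M"
    by (intro measurable_vol_diff[OF _ _ _ _ sets_PiM_ball_measure]) auto
  have "(\<lambda>u. matrix (gram_schmidt_proj u ?j)) \<in> borel_measurable ?M"
    by (intro measurable_matrix measurable_gram_schmidt_proj[OF sets_PiM_ball_measure]) auto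
  then have [measurable]: "(\<lambda>u. proj_matrix ((span (u ` {..<?j}))\<^sup>\<bottom>)) \<in> borel_measurable ?M"
    by (simp add: gram_schmidt_proj_eq[abs_def])
  have "(\<lambda>u. if vol_diff u {..<?j} ?B = 0 then proj_matrix (SOME E :: (real ^ 'n) set. E \<in> Gr k)
      else proj_matrix ((span (u ` {..<?j}))\<^sup>\<bottom>)) \<in> borel_measurable ?M"
    by measurable
  then show "(\<lambda>u. proj_matrix (random_complement k u)) \<in> borel_measurable ?M"
    by (simp add: random_complement_def if_distrib[of proj_matrix] cong: if_cong)
qed (rule random_complement_Gr[OF k])

lemma random_complement_rotation:
  fixes u :: "nat \<Rightarrow> real ^ 'n" and T :: "real ^ 'n \<Rightarrow> real ^ 'n"
  assumes T: "orthogonal_transformation T" and c: "vol_diff u {..<CARD('n) - k} (cball 0 1) \<noteq> 0"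
  shows "vol_diff (\<lambda>i. T (u i)) {..<CARD('n) - k} (cball 0 1) = vol_diff u {..<CARD('n) - k} (cball 0 1)"
    and "random_complement k (\<lambda>i. T (u i)) = T ` random_complement k u"
proof -
  let ?J = "{..<CARD('n) - k}"
  have "T ` cball 0 1 = cball 0 1"
    using image_orthogonal_transformation_cball[OF T, of 0 1] linear_0[OF orthogonal_transformation_linear[OF T]]
    by simp
  then show eq: "vol_diff (\<lambda>i. T (u i)) ?J (cball 0 1) = vol_diff u ?J (cball 0 1)"
    using vol_diff_orthogonal_image[OF T, of "cball 0 1" u ?J] by simp
  have "(\<lambda>i. T (u i)) ` ?J = T ` u ` ?J" by (simp add: image_image)
  then have "span ((\<lambda>i. T (u i)) ` ?J) = T ` span (u ` ?J)"
    using span_linear_image[OF orthogonal_transformation_linear[OF T], of "u ` ?J"] by simp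
  then show "random_complement k (\<lambda>i. T (u i)) = T ` random_complement k u"
    using c by (simp add: random_complement_def eq orthogonal_comp_orthogonal_image[OF T])
qed

lemma distr_PiM_ball_measure_orthogonal:
  fixes T :: "'a::euclidean_space \<Rightarrow> 'a"
  assumes T: "orthogonal_transformation T" and "finite I"
  shows "distr (\<Pi>\<^sub>M i\<in>I. ball_measure) (\<Pi>\<^sub>M i\<in>I. ball_measure) (compose I T) = (\<Pi>\<^sub>M i\<in>I. ball_measure)"
proof -
  have "distr ball_measure ball_measure T = distr ball_measure borel T"
    by (rule distr_cong) auto
  then show ?thesis
    using distr_PiM_finite_prob_space'[OF assms(2) prob_space_ball_measure prob_space_ball_measure
        measurable_orthogonal_ball_measure[OF T]]
    by (simp add: distr_ball_measure_orthogonal[OF T])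
qed

lemma complement_law_density_measurable:
  "(\<lambda>u. ennreal (vol_diff u {..<j} (cball (0 :: 'a::euclidean_space) 1) / mean_vol_diff j (cball (0 :: 'a) 1)))
    \<in> borel_measurable (\<Pi>\<^sub>M i\<in>{..<j}. ball_measure)"
proof -
  have "(\<lambda>u. vol_diff u {..<j} (cball (0::'a) 1)) \<in> borel_measurable (\<Pi>\<^sub>M i\<in>{..<j}. ball_measure)"
    by (intro measurable_vol_diff[OF _ _ _ _ sets_PiM_ball_measure]) auto
  then show ?thesis
    by (intro measurable_compose[OF _ measurable_ennreal] borel_measurable_divide borel_measurable_const)
qed

lemma emeasure_complement_law:
  fixes A :: "(real ^ 'n) set set"
  assumes k: "k \<le> CARD('n)" and A: "A \<in> sets (Gr_borel k)"
  defines "j \<equiv> CARD('n) - k"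
  shows "emeasure (complement_law k) A = (\<integral>\<^sup>+u.
    ennreal (vol_diff u {..<j} (cball 0 1) / mean_vol_diff j (cball (0 :: real ^ 'n) 1)) *
    indicator A (random_complement k u) \<partial>(\<Pi>\<^sub>M i\<in>{..<j}. ball_measure))"
proof -
  let ?M = "\<Pi>\<^sub>M i\<in>{..<j}. ball_measure :: (real ^ 'n) measure"
  let ?d = "\<lambda>u. ennreal (vol_diff u {..<j} (cball 0 1) / mean_vol_diff j (cball (0 :: real ^ 'n) 1))"
  have m: "random_complement k \<in> ?M \<rightarrow>\<^sub>M Gr_borel k"
    unfolding j_def by (rule measurable_random_complement[OF k])
  then have m': "random_complement k \<in> density ?M ?d \<rightarrow>\<^sub>M Gr_borel k" by simp
  have d: "?d \<in> borel_measurable ?M" by (rule complement_law_density_measurable)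
  have S: "random_complement k -` A \<inter> space ?M \<in> sets ?M" by (rule measurable_sets[OF m A])
  have "emeasure (complement_law k) A = emeasure (density ?M ?d) (random_complement k -` A \<inter> space ?M)"
    unfolding complement_law_def j_def[symmetric] by (subst emeasure_distr[OF m' A]) simp
  also have "\<dots> = (\<integral>\<^sup>+u. ?d u * indicator (random_complement k -` A \<inter> space ?M) u \<partial>?M)"
    by (rule emeasure_density[OF d S])
  also have "\<dots> = (\<integral>\<^sup>+u. ?d u * indicator A (random_complement k u) \<partial>?M)"
    by (intro nn_integral_cong) (auto simp: indicator_def)
  finally show ?thesis .
qed

lemma sets_complement_law [simp, measurable_cong]: "sets (complement_law k) = sets (Gr_borel k)"
  and space_complement_law [simp]: "space (complement_law k) = Gr k"
  by (simp_all add: complement_law_def)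

text \<open>Rotating all generators preserves their joint law and the density, and rotates the
  complement. The default subspace need not be rotated along, but there the density is 0 on both
  sides.\<close>

lemma invariant_complement_law:
  assumes k: "k \<le> CARD('n)"
  shows "invariant_Gr_measure k (complement_law k :: (real ^ 'n) set measure)"
  unfolding invariant_Gr_measure_def
proof (intro conjI allI impI)
  let ?j = "CARD('n) - k" and ?B = "cball (0 :: real ^ 'n) 1"
  let ?J = "{..<?j}"
  let ?M = "\<Pi>\<^sub>M i\<in>?J. ball_measure :: (real ^ 'n) measure"
  let ?d = "\<lambda>u. ennreal (vol_diff u ?J ?B / mean_vol_diff ?j ?B)"
  have mpos: "0 < mean_vol_diff ?j ?B" by (rule mean_vol_diff_cball_pos) simp
  have dm [measurable]: "?d \<in> borel_measurable ?M" by (rule complement_law_density_measurable)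
  have nonneg: "0 \<le> vol_diff u ?J ?B" for u by (rule vol_diff_proj_vol(3)) auto
  show "sets (complement_law k) = sets (Gr_borel k)" by simp
  show "prob_space (complement_law k :: (real ^ 'n) set measure)"
  proof (rule prob_spaceI)
    have "emeasure (complement_law k) (space (complement_law k :: (real ^ 'n) set measure)) =
        (\<integral>\<^sup>+u. ?d u * indicator (Gr k) (random_complement k u) \<partial>?M)"
      using emeasure_complement_law[OF k, of "Gr k"] sets.top[of "Gr_borel k :: (real ^ 'n) set measure"] by simp
    also have "\<dots> = (\<integral>\<^sup>+u. ?d u \<partial>?M)"
      using random_complement_Gr[OF k] by simp
    also have "\<dots> = ennreal (\<integral>u. vol_diff u ?J ?B / mean_vol_diff ?j ?B \<partial>?M)"
      using nonneg mpos integrable_vol_diff[of ?B ?J ?J]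
      by (intro nn_integral_eq_integral) (auto intro: divide_nonneg_pos)
    also have "(\<integral>u. vol_diff u ?J ?B / mean_vol_diff ?j ?B \<partial>?M) = 1"
      using mpos by (simp add: mean_vol_diff_def)
    finally show "emeasure (complement_law k) (space (complement_law k :: (real ^ 'n) set measure)) = 1" by simp
  qed
  fix Q :: "real ^ 'n ^ 'n" assume Q: "rotation_matrix Q"
  let ?T = "(*v) Q"
  have T: "orthogonal_transformation ?T" by (rule rotation_matrixD(2)[OF Q])
  have Qm: "(\<lambda>E. ?T ` E) \<in> Gr_borel k \<rightarrow>\<^sub>M Gr_borel k" by (rule measurable_rotation_Gr[OF Q])
  have Qm': "(\<lambda>E. ?T ` E) \<in> complement_law k \<rightarrow>\<^sub>M Gr_borel k"
    using Qm measurable_cong_sets[OF sets_complement_law refl] by blast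
  have Cm: "compose ?J ?T \<in> ?M \<rightarrow>\<^sub>M ?M"
  proof -
    show ?thesis unfolding compose_def
      by (intro measurable_restrict measurable_compose[OF _ measurable_orthogonal_ball_measure[OF T]] measurable_component_singleton)
  qed
  show "distr (complement_law k) (Gr_borel k) (\<lambda>E. ?T ` E) = complement_law k"
  proof (rule measure_eqI)
    fix A assume "A \<in> sets (distr (complement_law k) (Gr_borel k) (\<lambda>E. ?T ` E))"
    then have A: "A \<in> sets (Gr_borel k)" by simp
    let ?A = "(\<lambda>E. ?T ` E) -` A \<inter> Gr k"
    have A': "?A \<in> sets (Gr_borel k)" using measurable_sets[OF Qm A] by simp
    have "emeasure (distr (complement_law k) (Gr_borel k) (\<lambda>E. ?T ` E)) A = emeasure (complement_law k) ?A"
      by (subst emeasure_distr[OF Qm' A]) simp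
    also have "\<dots> = (\<integral>\<^sup>+u. ?d u * indicator ?A (random_complement k u) \<partial>?M)"
      by (rule emeasure_complement_law[OF k A'])
    also have "\<dots> = (\<integral>\<^sup>+u. ?d (compose ?J ?T u) * indicator A (random_complement k (compose ?J ?T u)) \<partial>?M)"
    proof (intro nn_integral_cong)
      fix u
      \<comment> \<open>\<open>compose\<close> restricts functions to the index set, and both the
        coefficient and the span depend only on the values there.\<close>
      have v: "vol_diff (compose ?J ?T u) ?J K = vol_diff (\<lambda>i. ?T (u i)) ?J K" for K
        by (rule vol_diff_cong) (simp add: compose_def)
      have "compose ?J ?T u ` ?J = (\<lambda>i. ?T (u i)) ` ?J" by (auto simp: compose_def)
      then have r: "random_complement k (compose ?J ?T u) = random_complement k (\<lambda>i. ?T (u i))"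
        by (simp add: random_complement_def v)
      have z: "vol_diff (\<lambda>i. ?T (u i)) ?J ?B = vol_diff u ?J ?B"
        using vol_diff_orthogonal_image[OF T, of ?B u ?J] image_orthogonal_transformation_cball[OF T, of 0 1]
          linear_0[OF orthogonal_transformation_linear[OF T]] by simp
      show "?d u * indicator ?A (random_complement k u) =
          ?d (compose ?J ?T u) * indicator A (random_complement k (compose ?J ?T u))"
      proof (cases "vol_diff u ?J ?B = 0")
        case False
        then show ?thesis
          using random_complement_rotation(2)[OF T False] random_complement_Gr[OF k, of u]
          by (simp add: v r z indicator_def)
      qed (simp add: v z)
    qed
    also have "\<dots> = (\<integral>\<^sup>+u. ?d u * indicator A (random_complement k u) \<partial>distr ?M ?M (compose ?J ?T))"
    proof -
      have "(\<lambda>u. indicator A (random_complement k u) :: ennreal) \<in> borel_measurable ?M"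
        using measurable_compose[OF measurable_random_complement[OF k] borel_measurable_indicator[OF A]] .
      then have "(\<lambda>u. ?d u * indicator A (random_complement k u)) \<in> borel_measurable ?M"
        by (intro borel_measurable_times_ennreal dm)
      then show ?thesis by (subst nn_integral_distr[OF Cm]) simp_all
    qed
    also have "\<dots> = emeasure (complement_law k) A"
      using emeasure_complement_law[OF k A] distr_PiM_ball_measure_orthogonal[OF T finite_lessThan] by simp
    finally show "emeasure (distr (complement_law k) (Gr_borel k) (\<lambda>E. ?T ` E)) A = emeasure (complement_law k) A" .
  qed simp
qed

lemma Gr_measure_eq:
  assumes "1 \<le> k" "k \<le> CARD('n)"
  shows "Gr_measure k = (complement_law k :: (real ^ 'n) set measure)"
  unfolding Gr_measure_def invariant_Gr_measure_def[symmetric]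
  using invariant_complement_law[OF assms(2)] invariant_Gr_measure_unique[OF _ _ assms(1)]
  by (intro the_equality) auto

section \<open>Integrating volumes of projections\<close>

text \<open>Thickening by the unit ball of the complement turns a volume measured in the varying
  space E into a volume in the fixed ambient space, where dependence on E can be handled as
  measurability of sections.\<close>

lemma proj_vol_eq_vol:
  fixes E :: "'a::euclidean_space set"
  assumes E: "subspace E" and K: "compact K"
  shows "vol {x. orth_proj E x \<in> orth_proj E ` K \<and> norm (x - orth_proj E x) \<le> 1} =
    proj_vol K E * unit_ball_vol (real (dim (E\<^sup>\<bottom>)))"
proof -
  have "{x. orth_proj E x \<in> orth_proj E ` K \<and> norm (x - orth_proj E x) \<le> 1} =
      orth_proj E ` K + (cball 0 1 \<inter> E\<^sup>\<bottom>)"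
  proof (intro set_eqI iffI)
    fix x assume "x \<in> {x. orth_proj E x \<in> orth_proj E ` K \<and> norm (x - orth_proj E x) \<le> 1}"
    then have "orth_proj E x + (x - orth_proj E x) \<in> orth_proj E ` K + (cball 0 1 \<inter> E\<^sup>\<bottom>)"
      using orth_proj_mem(2)[OF E, of x] by (intro set_plus_intro) auto
    then show "x \<in> orth_proj E ` K + (cball 0 1 \<inter> E\<^sup>\<bottom>)" by simp
  next
    fix x assume "x \<in> orth_proj E ` K + (cball 0 1 \<inter> E\<^sup>\<bottom>)"
    then obtain y z where yz: "x = y + z" "y \<in> orth_proj E ` K" "z \<in> cball 0 1 \<inter> E\<^sup>\<bottom>"
      by (rule set_plus_elim)
    then have "orth_proj E x = y"
      using orth_proj_mem(1)[OF E] by (intro orth_proj_unique[OF E]) auto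
    then show "x \<in> {x. orth_proj E x \<in> orth_proj E ` K \<and> norm (x - orth_proj E x) \<le> 1}"
      using yz by auto
  qed
  then show ?thesis
    using vol_plus_complement_cball[OF E compact_orth_proj[OF E K], of 1] orth_proj_mem(1)[OF E]
    by (auto simp: proj_vol_def)
qed

text \<open>Orthogonal projections are self-adjoint. The varying body is thereby replaced by the
  fixed support function of K at a varying argument.\<close>

lemma support_fun_orth_proj:
  fixes E :: "'a::euclidean_space set"
  assumes E: "subspace E"
  shows "support_fun (orth_proj E ` K) v = support_fun K (orth_proj E v)"
proof -
  have "v \<bullet> orth_proj E x = orth_proj E v \<bullet> x" for x
  proof -
    have "v \<bullet> orth_proj E x = orth_proj E v \<bullet> orth_proj E x"
      using orth_proj_mem(1)[OF E, of x] orth_proj_mem(2)[OF E, of v]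
      by (auto simp: orthogonal_comp_def orthogonal_def inner_diff_right inner_commute)
    also have "\<dots> = orth_proj E v \<bullet> x"
      using orth_proj_mem(1)[OF E, of v] orth_proj_mem(2)[OF E, of x]
      by (auto simp: orthogonal_comp_def orthogonal_def inner_diff_right)
    finally show ?thesis .
  qed
  then show ?thesis by (simp add: support_fun_def image_image)
qed

lemma measurable_proj_vol:
  fixes K :: "(real ^ 'n) set"
  assumes K: "compact K" "convex K" "K \<noteq> {}" and k: "k \<le> CARD('n)"
  shows "proj_vol K \<in> borel_measurable (Gr_borel k)"
proof -
  obtain D :: "(real ^ 'n) set" where D: "countable D" "closure D = UNIV"
    by (rule countable_dense_closureE)
  have [measurable]: "support_fun K \<in> borel_measurable borel"
    by (intro borel_measurable_continuous_onI continuous_on_support_fun K)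
  have [measurable]: "(\<lambda>p. fst p *v snd p) \<in> borel_measurable ((borel :: (real ^ 'n ^ 'n) measure) \<Otimes>\<^sub>M (borel :: (real ^ 'n) measure))"
    unfolding borel_prod matrix_vector_mult_def
    by (intro borel_measurable_continuous_onI continuous_intros)
  have [measurable]: "(\<lambda>p. fst p *v v) \<in> borel_measurable ((borel :: (real ^ 'n ^ 'n) measure) \<Otimes>\<^sub>M (borel :: (real ^ 'n) measure))" for v
    unfolding borel_prod matrix_vector_mult_def
    by (intro borel_measurable_continuous_onI continuous_intros)
  let ?Q = "{p \<in> space ((borel :: (real ^ 'n ^ 'n) measure) \<Otimes>\<^sub>M (lborel :: (real ^ 'n) measure)).
      (\<forall>v\<in>D. v \<bullet> (fst p *v snd p) \<le> support_fun K (fst p *v v)) \<and> norm (snd p - fst p *v snd p) \<le> 1}"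
  have Q: "?Q \<in> sets ((borel :: (real ^ 'n ^ 'n) measure) \<Otimes>\<^sub>M (lborel :: (real ^ 'n) measure))"
    using D(1) by measurable
  \<comment> \<open>A function of arbitrary matrices, hence a statement about their Borel space; at
    the projection matrix of a k-dimensional E it equals \<open>proj_vol K E\<close>.\<close>
  let ?g = "\<lambda>A. enn2real (emeasure lborel (Pair A -` ?Q)) / unit_ball_vol (real (CARD('n) - k))"
  have "?g \<in> borel_measurable borel"
    using lborel.measurable_emeasure_Pair[OF Q] by measurable
  then have "(\<lambda>E. ?g (proj_matrix E)) \<in> borel_measurable (Gr_borel k)"
    using measurable_proj_matrix by (rule measurable_compose[rotated])
  moreover have "?g (proj_matrix E) = proj_vol K E" if "E \<in> space (Gr_borel k)" for E
  proof -
    have E: "subspace E" and dE: "dim E = k" using that by (auto simp: Gr_def)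
    have "dim (E\<^sup>\<bottom>) = CARD('n) - k" using dim_orthogonal_comp[OF E] dE by simp
    moreover have "Pair (proj_matrix E) -` ?Q =
        {x. orth_proj E x \<in> orth_proj E ` K \<and> norm (x - orth_proj E x) \<le> 1}"
      using mem_iff_support_fun_dense[OF compact_orth_proj[OF E K(1)]
          convex_linear_image[OF linear_orth_proj[OF E] K(2)] _ D(2)] K(3)
      by (auto simp: space_pair_measure proj_matrix_works[OF E] support_fun_orth_proj[OF E])
    moreover have "unit_ball_vol (real (CARD('n) - k)) \<noteq> 0"
      by (rule less_imp_neq[OF unit_ball_vol_pos, symmetric]) simp
    ultimately show ?thesis
      using proj_vol_eq_vol[OF E K(1)] by (simp add: measure_def)
  qed
  ultimately show ?thesis by (rule measurable_cong[THEN iffD1, rotated])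
qed

lemma proj_vol_bounds:
  fixes E :: "(real ^ 'n) set"
  assumes E: "E \<in> Gr k" and K: "compact K" "K \<subseteq> cball 0 r" and r: "0 < r"
  shows "0 \<le> proj_vol K E" "proj_vol K E \<le> unit_ball_vol (real k) * r ^ k"
proof -
  have sE: "subspace E" and dE: "dim E = k" using E by (auto simp: Gr_def)
  show "0 \<le> proj_vol K E" by (simp add: proj_vol_def)
  have "orth_proj E ` K \<subseteq> cball 0 r \<inter> E"
    using K(2) norm_orth_proj_le[OF sE] orth_proj_mem(1)[OF sE] by (force intro: order_trans)
  moreover have "emeasure (subspace_lborel E) (cball 0 r \<inter> E) < \<infinity>"
    by (rule emeasure_subspace_lborel_finite[OF sE]) (simp add: bounded_Int)
  ultimately have "proj_vol K E \<le> measure (subspace_lborel E) (cball 0 r \<inter> E)"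
    unfolding proj_vol_def using compact_orth_proj[OF sE K(1)] compact_cball_Int[OF sE, of r]
    by (intro measure_mono_fmeasurable) (auto simp: fmeasurable_def borel_compact)
  then show "proj_vol K E \<le> unit_ball_vol (real k) * r ^ k"
    using measure_subspace_lborel_cball[OF sE r] dE by simp
qed

lemma integrable_proj_vol:
  fixes K :: "(real ^ 'n) set"
  assumes K: "compact K" "convex K" "K \<noteq> {}" and k: "1 \<le> k" "k \<le> CARD('n)"
  shows "integrable (Gr_measure k) (proj_vol K)"
proof -
  interpret prob_space "complement_law k :: (real ^ 'n) set measure"
    using invariant_complement_law[OF k(2)] by (simp add: invariant_Gr_measure_def)
  obtain r where r: "0 < r" "K \<subseteq> cball 0 r" by (rule compact_subset_cballE[OF K(1)])
  have "proj_vol K \<in> borel_measurable (complement_law k)"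
    using measurable_proj_vol[OF K k(2)] measurable_cong_sets[OF sets_complement_law refl] by blast
  then show ?thesis
    unfolding Gr_measure_eq[OF k]
    using proj_vol_bounds[OF _ K(1) r(2,1)]
    by (intro integrable_const_bound[of _ "unit_ball_vol (real k) * r ^ k"]) auto
qed

text \<open>Pulled back to the generators, the density times the projection volume is the
  coefficient of K times a constant, by \<open>vol_diff_proj_vol\<close>.\<close>

lemma mean_vol_diff_eq_integral:
  fixes K :: "(real ^ 'n) set"
  assumes K: "compact K" "convex K" "K \<noteq> {}" and k: "1 \<le> k" "k \<le> CARD('n)"
  defines "j \<equiv> CARD('n) - k"
  shows "mean_vol_diff j K / mean_vol_diff j (cball (0 :: real ^ 'n) 1) =
    (\<integral>E. proj_vol K E \<partial>Gr_measure k) / unit_ball_vol (real k)"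
proof -
  let ?B = "cball (0 :: real ^ 'n) 1" and ?\<kappa> = "unit_ball_vol (real k)"
  let ?M = "\<Pi>\<^sub>M i\<in>{..<j}. ball_measure :: (real ^ 'n) measure"
  let ?d = "\<lambda>u. vol_diff u {..<j} ?B / mean_vol_diff j ?B"
  have mpos: "0 < mean_vol_diff j ?B" unfolding j_def by (rule mean_vol_diff_cball_pos) simp
  have \<kappa>: "0 < ?\<kappa>" by (rule unit_ball_vol_pos) simp
  have nonneg: "0 \<le> vol_diff u {..<j} ?B" for u by (rule vol_diff_proj_vol(3)) auto
  have dm: "?d \<in> borel_measurable ?M"
    by (intro borel_measurable_divide borel_measurable_const measurable_vol_diff[OF _ _ _ _ sets_PiM_ball_measure]) auto
  have rm: "random_complement k \<in> ?M \<rightarrow>\<^sub>M Gr_borel k"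
    unfolding j_def by (rule measurable_random_complement[OF k(2)])
  have pm: "proj_vol K \<in> borel_measurable (Gr_borel k)" by (rule measurable_proj_vol[OF K k(2)])
  have "(\<integral>E. proj_vol K E \<partial>Gr_measure k) =
      (\<integral>u. proj_vol K (random_complement k u) \<partial>density ?M (\<lambda>u. ennreal (?d u)))"
    unfolding Gr_measure_eq[OF k] complement_law_def j_def[symmetric]
    by (rule integral_distr[OF _ pm]) (use rm in simp)
  also have "\<dots> = (\<integral>u. ?d u *\<^sub>R proj_vol K (random_complement k u) \<partial>?M)"
    using mpos nonneg by (intro integral_density dm measurable_compose[OF rm pm]) (auto intro: divide_nonneg_pos)
  also have "\<dots> = (\<integral>u. vol_diff u {..<j} K * (?\<kappa> / mean_vol_diff j ?B) \<partial>?M)"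
  proof (intro Bochner_Integration.integral_cong refl)
    fix u :: "nat \<Rightarrow> real ^ 'n"
    let ?E = "(span (u ` {..<j}))\<^sup>\<bottom>"
    have 1: "vol_diff u {..<j} K * unit_ball_vol (real (dim ?E)) = vol_diff u {..<j} ?B * proj_vol K ?E"
      by (rule vol_diff_proj_vol(1)[OF _ K(1,2)]) simp
    show "?d u *\<^sub>R proj_vol K (random_complement k u) = vol_diff u {..<j} K * (?\<kappa> / mean_vol_diff j ?B)"
    proof (cases "vol_diff u {..<j} ?B = 0")
      case True
      have "unit_ball_vol (real (dim ?E)) \<noteq> 0"
        by (rule less_imp_neq[OF unit_ball_vol_pos, symmetric]) simp
      \<comment> \<open>Where the density vanishes, the coefficient of K vanishes as well, so the
        default value of \<open>random_complement\<close> has no influence.\<close>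
      then have "vol_diff u {..<j} K = 0" using 1 True by simp
      then show ?thesis using True by simp
    next
      case False
      then have "dim ?E = k"
        using vol_diff_proj_vol(2)[of "{..<j}" ?B u] k(2) by (simp add: j_def)
      moreover have "random_complement k u = ?E"
        using False by (simp add: random_complement_def j_def)
      ultimately show ?thesis using 1 by simp
    qed
  qed
  also have "\<dots> = mean_vol_diff j K * (?\<kappa> / mean_vol_diff j ?B)"
    by (simp add: mean_vol_diff_def)
  finally show ?thesis using less_imp_neq[OF \<kappa>] mpos by (simp add: field_simps)
qed

section \<open>Quermassintegrals as coefficients of the Steiner polynomial\<close>

lemma permutation_of_surj:
  assumes f: "f \<in> {..<n} \<rightarrow>\<^sub>E {..<n :: nat}" "f ` {..<n} = {..<n}"
  obtains p where "p permutes {..<n}" "f = (\<lambda>i\<in>{..<n}. i) \<circ> p"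
proof -
  define p where "p i = (if i < n then f i else i)" for i
  have inj: "inj_on f {..<n}" using f(2) by (intro eq_card_imp_inj_on) auto
  have "p permutes {..<n}"
  proof (rule bij_imp_permutes)
    show "bij_betw p {..<n} {..<n}"
      using inj f(2) by (intro bij_betw_cong[THEN iffD1, of _ f p]) (auto simp: bij_betw_def p_def)
  qed (auto simp: p_def)
  moreover have "f = (\<lambda>i\<in>{..<n}. i) \<circ> p"
  proof
    fix i show "f i = ((\<lambda>i\<in>{..<n}. i) \<circ> p) i"
      using f(1) by (cases "i < n") (auto simp: p_def PiE_iff extensional_def)
  qed
  ultimately show ?thesis by (rule that)
qed

text \<open>Evaluating at indicator functions and taking the alternating sum over all subsets
  isolates the coefficients of the tuples that are permutations.\<close>

lemma symmetric_coefficient_eq_0: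
  fixes c :: "(nat \<Rightarrow> nat) \<Rightarrow> real" and n :: nat
  defines "F \<equiv> {..<n} \<rightarrow>\<^sub>E {..<n}"
  assumes sym: "\<And>f p. f \<in> F \<Longrightarrow> p permutes {..<n} \<Longrightarrow> c (f \<circ> p) = c f"
    and zero: "\<And>l. (\<And>i. i < n \<Longrightarrow> 0 \<le> l i) \<Longrightarrow> (\<Sum>f\<in>F. c f * (\<Prod>i<n. l (f i))) = 0"
  shows "c (\<lambda>i\<in>{..<n}. i) = 0"
proof -
  let ?I = "{..<n}" and ?e = "\<lambda>i\<in>{..<n}. i"
  have fin: "finite F" unfolding F_def by (intro finite_PiE) auto
  have eF: "?e \<in> F" by (auto simp: F_def)
  have alt: "(\<Sum>T\<in>Pow ?I. (-1) ^ card (?I - T) * (\<Prod>i<n. if f i \<in> T then 1 else 0 :: real)) =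
      (if f ` ?I = ?I then 1 else 0)" if f: "f \<in> F" for f
  proof -
    let ?R = "f ` ?I"
    have R: "?R \<subseteq> ?I" using f by (auto simp: F_def)
    have "(\<Sum>T\<in>Pow ?I. (-1) ^ card (?I - T) * (\<Prod>i<n. if f i \<in> T then 1 else 0 :: real)) =
        (\<Sum>T\<in>Pow ?I. if ?R \<subseteq> T then (-1) ^ card (?I - T) else 0)"
    proof (intro sum.cong refl)
      fix T
      have "(\<Prod>i<n. if f i \<in> T then 1 else 0 :: real) = (if ?R \<subseteq> T then 1 else 0)"
        by (auto simp: image_subset_iff intro: prod.neutral)
      then show "(-1) ^ card (?I - T) * (\<Prod>i<n. if f i \<in> T then 1 else 0 :: real) =
          (if ?R \<subseteq> T then (-1) ^ card (?I - T) else 0)" by simp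
    qed
    also have "\<dots> = (\<Sum>T\<in>{T \<in> Pow ?I. ?R \<subseteq> T}. (-1) ^ card (?I - T))"
      by (rule sum.inter_filter[symmetric]) simp
    \<comment> \<open>Passing to complements of T leaves an unrestricted alternating sum over the
      subsets of the indices missed by f, which is 0 unless f misses none.\<close>
    also have "\<dots> = (\<Sum>S\<in>Pow (?I - ?R). (-1) ^ card S)"
      by (rule sum.reindex_bij_witness[of _ "\<lambda>S. ?I - S" "\<lambda>T. ?I - T"]) (use R in auto)
    also have "\<dots> = (\<Sum>j\<le>card (?I - ?R). real (card (?I - ?R) choose j) * (-1) ^ j)"
      by (rule sum_Pow_card) simp
    also have "\<dots> = (if ?R = ?I then 1 else 0)"
    proof (cases "?R = ?I")
      case False
      then have "card (?I - ?R) > 0" using R by (auto simp: card_gt_0_iff)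
      then show ?thesis
        using choose_alternating_sum[of "card (?I - ?R)", where 'a=real] False by (simp add: mult.commute)
    qed simp
    finally show ?thesis .
  qed
  have "0 = (\<Sum>T\<in>Pow ?I. (-1) ^ card (?I - T) * (\<Sum>f\<in>F. c f * (\<Prod>i<n. if f i \<in> T then 1 else 0)))"
  proof -
    have "(\<Sum>f\<in>F. c f * (\<Prod>i<n. if f i \<in> T then 1 else 0)) = 0" for T
      using zero[of "\<lambda>i. if i \<in> T then 1 else 0"] by simp
    then show ?thesis by simp
  qed
  also have "\<dots> = (\<Sum>f\<in>F. c f * (\<Sum>T\<in>Pow ?I. (-1) ^ card (?I - T) * (\<Prod>i<n. if f i \<in> T then 1 else 0)))"
    by (subst sum_distrib_left, subst sum.swap) (simp add: sum_distrib_left mult_ac)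
  \<comment> \<open>The surjective tuples are rearrangements of the identity tuple, so by symmetry
    all surviving coefficients coincide.\<close>
  also have "\<dots> = (\<Sum>f\<in>F. if f ` ?I = ?I then c ?e else 0)"
  proof (intro sum.cong refl)
    fix f assume f: "f \<in> F"
    show "c f * (\<Sum>T\<in>Pow ?I. (-1) ^ card (?I - T) * (\<Prod>i<n. if f i \<in> T then 1 else 0)) =
        (if f ` ?I = ?I then c ?e else 0)"
    proof (cases "f ` ?I = ?I")
      case True
      obtain p where "p permutes ?I" "f = ?e \<circ> p"
        using permutation_of_surj[OF f[unfolded F_def] True] by blast
      then have "c f = c ?e" using sym[OF eF] by simp
      then show ?thesis using alt[OF f] True by simp
    qed (simp add: alt[OF f])
  qed
  also have "\<dots> = real (card {f \<in> F. f ` ?I = ?I}) * c ?e"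
    using fin by (simp add: sum.inter_filter[symmetric])
  finally have "real (card {f \<in> F. f ` ?I = ?I}) * c ?e = 0" by simp
  moreover have "?e \<in> {f \<in> F. f ` ?I = ?I}" using eF by auto
  then have "card {f \<in> F. f ` ?I = ?I} \<noteq> 0" using fin by (auto simp: card_eq_0_iff)
  ultimately show ?thesis by simp
qed

text \<open>Two coefficient systems of the same family differ by a symmetric system whose polynomial
  vanishes, so they agree at the identity tuple and the description is well defined once one system
  is exhibited.\<close>

lemma mixed_volume_eq:
  fixes K :: "nat \<Rightarrow> (real ^ 'n) set"
  assumes c: "minkowski_coefficients K c"
  shows "mixed_volume K = c (\<lambda>i\<in>{..<CARD('n)}. i)"
  unfolding mixed_volume_def
proof (rule the_equality)
  show "\<exists>c'. minkowski_coefficients K c' \<and> c (\<lambda>i\<in>{..<CARD('n)}. i) = c' (\<lambda>i\<in>{..<CARD('n)}. i)"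
    using c by blast
  fix v assume "\<exists>c'. minkowski_coefficients K c' \<and> v = c' (\<lambda>i\<in>{..<CARD('n)}. i)"
  then obtain d where d: "minkowski_coefficients K d" "v = d (\<lambda>i\<in>{..<CARD('n)}. i)" by blast
  have "(\<lambda>f. d f - c f) (\<lambda>i\<in>{..<CARD('n)}. i) = 0"
  proof (rule symmetric_coefficient_eq_0)
    fix f p assume "f \<in> {..<CARD('n)} \<rightarrow>\<^sub>E {..<CARD('n)}" "p permutes {..<CARD('n)}"
    then show "d (f \<circ> p) - c (f \<circ> p) = d f - c f"
      using c d(1) by (auto simp: minkowski_coefficients_def Let_def)
  next
    fix l :: "nat \<Rightarrow> real" assume "\<And>i. i < CARD('n) \<Longrightarrow> 0 \<le> l i"
    then show "(\<Sum>f\<in>{..<CARD('n)} \<rightarrow>\<^sub>E {..<CARD('n)}. (d f - c f) * (\<Prod>i<CARD('n). l (f i))) = 0"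
      using c d(1) by (simp add: minkowski_coefficients_def Let_def left_diff_distrib sum_subtractf)
  qed
  then show "v = c (\<lambda>i\<in>{..<CARD('n)}. i)" using d(2) by simp
qed

text \<open>A weighted binomial theorem: tuples are sorted by the set S of positions whose index
  lies in B, and for fixed S the sum of products factorises.\<close>

lemma sum_prod_split:
  fixes l :: "'b \<Rightarrow> real" and w :: "nat \<Rightarrow> real"
  assumes I: "finite I" and A: "finite A" and B: "finite B" and AB: "A \<inter> B = {}"
  shows "(\<Sum>f\<in>I \<rightarrow>\<^sub>E (A \<union> B). w (card {i \<in> I. f i \<in> B}) * (\<Prod>i\<in>I. l (f i))) =
    (\<Sum>m\<le>card I. real (card I choose m) * (w m * (sum l A ^ (card I - m) * sum l B ^ m)))"
proof -
  let ?F = "I \<rightarrow>\<^sub>E (A \<union> B)" and ?g = "\<lambda>f. {i \<in> I. f i \<in> B}"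
  have "(\<Sum>f\<in>?F. w (card (?g f)) * (\<Prod>i\<in>I. l (f i))) =
      (\<Sum>S\<in>Pow I. \<Sum>f\<in>{f \<in> ?F. ?g f = S}. w (card (?g f)) * (\<Prod>i\<in>I. l (f i)))"
    using I A B by (intro sum.group[symmetric] finite_PiE) auto
  also have "\<dots> = (\<Sum>S\<in>Pow I. w (card S) * (sum l A ^ (card I - card S) * sum l B ^ card S))"
  proof (intro sum.cong refl)
    fix S assume S: "S \<in> Pow I"
    let ?X = "\<lambda>i. if i \<in> S then B else A"
    have "{f \<in> ?F. ?g f = S} = Pi\<^sub>E I ?X"
    proof (intro set_eqI iffI)
      fix f assume f: "f \<in> {f \<in> ?F. ?g f = S}"
      then have "f i \<in> ?X i" if "i \<in> I" for i
        using that by (auto simp: PiE_iff)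
      then show "f \<in> Pi\<^sub>E I ?X" using f by (auto simp: PiE_iff)
    next
      fix f assume f: "f \<in> Pi\<^sub>E I ?X"
      then have "f i \<in> ?X i" if "i \<in> I" for i using that by (auto simp: PiE_iff)
      then have *: "f i \<in> A \<union> B \<and> (f i \<in> B \<longleftrightarrow> i \<in> S)" if "i \<in> I" for i
        using that AB by (cases "i \<in> S") force+
      then have "?g f = S" using S by auto
      then show "f \<in> {f \<in> ?F. ?g f = S}" using f * by (auto simp: PiE_iff)
    qed
    then have "(\<Sum>f\<in>{f \<in> ?F. ?g f = S}. w (card (?g f)) * (\<Prod>i\<in>I. l (f i))) =
        w (card S) * (\<Sum>f\<in>Pi\<^sub>E I ?X. \<Prod>i\<in>I. l (f i))"
      by (simp add: sum_distrib_left cong: conj_cong) (auto intro!: sum.cong arg_cong[where f=w] arg_cong[where f=card])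
    also have "(\<Sum>f\<in>Pi\<^sub>E I ?X. \<Prod>i\<in>I. l (f i)) = (\<Prod>i\<in>I. \<Sum>x\<in>?X i. l x)"
      using I A B by (intro prod_sum_PiE[symmetric]) auto
    also have "\<dots> = (\<Prod>i\<in>I - S. sum l A) * (\<Prod>i\<in>S. sum l B)"
      using S I by (subst prod.subset_diff[of S I]) (auto intro!: arg_cong2[where f="(*)"] prod.cong)
    also have "\<dots> = sum l A ^ (card I - card S) * sum l B ^ card S"
      using S I by (simp add: card_Diff_subset finite_subset)
    finally show "(\<Sum>f\<in>{f \<in> ?F. ?g f = S}. w (card (?g f)) * (\<Prod>i\<in>I. l (f i))) =
        w (card S) * (sum l A ^ (card I - card S) * sum l B ^ card S)" .
  qed
  also have "\<dots> = (\<Sum>m\<le>card I. real (card I choose m) * (w m * (sum l A ^ (card I - m) * sum l B ^ m)))"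
    by (rule sum_Pow_card[OF I])
  finally show ?thesis .
qed

section \<open>Homogeneous form of the Steiner polynomial\<close>

lemma convex_scaleR_plus:
  fixes K :: "'a::real_vector set"
  assumes K: "convex K" "K \<noteq> {}" and st: "0 \<le> s" "0 \<le> t"
  shows "(\<lambda>x. s *\<^sub>R x) ` K + (\<lambda>x. t *\<^sub>R x) ` K = (\<lambda>x. (s + t) *\<^sub>R x) ` K"
proof (intro equalityI subsetI)
  fix z assume "z \<in> (\<lambda>x. s *\<^sub>R x) ` K + (\<lambda>x. t *\<^sub>R x) ` K"
  then obtain x y where xy: "x \<in> K" "y \<in> K" "z = s *\<^sub>R x + t *\<^sub>R y" by (auto elim!: set_plus_elim)
  show "z \<in> (\<lambda>x. (s + t) *\<^sub>R x) ` K"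
  proof (cases "s + t = 0")
    case True
    then have "s = 0" "t = 0" using st by auto
    then show ?thesis using xy by auto
  next
    case False
    then have pos: "0 < s + t" using st by auto
    have "(s / (s + t)) *\<^sub>R x + (t / (s + t)) *\<^sub>R y \<in> K"
      using st pos xy by (intro convexD[OF K(1)]) (auto simp: add_divide_distrib[symmetric])
    moreover have "z = (s + t) *\<^sub>R ((s / (s + t)) *\<^sub>R x + (t / (s + t)) *\<^sub>R y)"
      using pos xy(3) by (simp add: scaleR_add_right)
    ultimately show ?thesis by blast
  qed
next
  fix z assume "z \<in> (\<lambda>x. (s + t) *\<^sub>R x) ` K"
  then obtain x where "x \<in> K" "z = s *\<^sub>R x + t *\<^sub>R x" by (auto simp: scaleR_add_left)
  then show "z \<in> (\<lambda>x. s *\<^sub>R x) ` K + (\<lambda>x. t *\<^sub>R x) ` K" by blast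
qed

lemma sum_scaleR_convex:
  fixes K :: "'a::real_vector set"
  assumes "finite I" "convex K" "K \<noteq> {}" "\<And>i. i \<in> I \<Longrightarrow> 0 \<le> l i"
  shows "(\<Sum>i\<in>I. (\<lambda>x. l i *\<^sub>R x) ` K) = (\<lambda>x. sum l I *\<^sub>R x) ` K"
  using assms
proof (induction I)
  case empty
  then show ?case by (auto simp: image_constant_conv)
next
  case (insert i I)
  then show ?case
    by (simp add: convex_scaleR_plus sum_nonneg)
qed

text \<open>For a > 0 the factor a is pulled out of the sum. For a = 0 only the ball remains and
  only the term of top degree survives, which is what \<open>top\<close> evaluates.\<close>

lemma vol_scaled_plus_ball:
  fixes K :: "'a::euclidean_space set"
  assumes K: "compact K" "K \<noteq> {}" and ab: "0 \<le> a" "0 \<le> b"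
    and steiner: "\<And>t. 0 \<le> t \<Longrightarrow> vol (K + cball 0 t) = (\<Sum>m\<le>DIM('a). real (DIM('a) choose m) * w m * t ^ m)"
    and top: "w DIM('a) = unit_ball_vol (real DIM('a))"
  shows "vol ((\<lambda>x. a *\<^sub>R x) ` K + (\<lambda>x. b *\<^sub>R x) ` cball 0 1) =
    (\<Sum>m\<le>DIM('a). real (DIM('a) choose m) * (w m * (a ^ (DIM('a) - m) * b ^ m)))"
proof -
  let ?n = "DIM('a)"
  have scb: "(\<lambda>x. b *\<^sub>R x) ` cball (0 :: 'a) 1 = cball 0 b" if "0 \<le> b" for b
  proof (cases "b = 0")
    case False
    then show ?thesis using scaleR_cball_Int[of "UNIV :: 'a set" b 1] that by simp
  qed (auto simp: image_constant_conv)
  show ?thesis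
  proof (cases "a = 0")
    case True
    have "vol ((\<lambda>x. a *\<^sub>R x) ` K + (\<lambda>x. b *\<^sub>R x) ` cball 0 1) = vol (cball (0 :: 'a) b)"
      using True K(2) scb[OF ab(2)] by (simp add: image_constant_conv)
    also have "\<dots> = w ?n * b ^ ?n" using vol_cball[OF ab(2), where 'a='a] top by simp
    also have "\<dots> = (\<Sum>m\<le>?n. if m = ?n then w ?n * b ^ ?n else 0)" by simp
    also have "\<dots> = (\<Sum>m\<le>?n. real (?n choose m) * (w m * (a ^ (?n - m) * b ^ m)))"
      using True by (intro sum.cong refl) auto
    finally show ?thesis .
  next
    case False
    then have a: "0 < a" using ab by simp
    have "(\<lambda>x. b *\<^sub>R x) ` cball (0 :: 'a) 1 = (\<lambda>x. a *\<^sub>R x) ` cball 0 (b / a)"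
      using scb[OF ab(2)] scaleR_cball_Int[of "UNIV :: 'a set" a "b / a"] a by simp
    then have "vol ((\<lambda>x. a *\<^sub>R x) ` K + (\<lambda>x. b *\<^sub>R x) ` cball 0 1) = vol ((\<lambda>x. a *\<^sub>R x) ` (K + cball 0 (b / a)))"
      by (simp add: image_scaleR_plus)
    also have "\<dots> = a ^ ?n * vol (K + cball 0 (b / a))"
      using a K by (intro vol_scaleR borel_compact compact_set_plus) auto
    also have "\<dots> = a ^ ?n * (\<Sum>m\<le>?n. real (?n choose m) * w m * (b / a) ^ m)"
      using steiner[of "b / a"] a ab by simp
    also have "\<dots> = (\<Sum>m\<le>?n. real (?n choose m) * (w m * (a ^ (?n - m) * b ^ m)))"
      unfolding sum_distrib_left
    proof (intro sum.cong refl)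
      fix m assume "m \<in> {..?n}"
      then have "a ^ ?n = a ^ (?n - m) * a ^ m" by (simp add: power_add[symmetric])
      then show "a ^ ?n * (real (?n choose m) * w m * (b / a) ^ m) = real (?n choose m) * (w m * (a ^ (?n - m) * b ^ m))"
        using a by (simp add: power_divide)
    qed
    finally show ?thesis .
  qed
qed

text \<open>The homogeneous Steiner polynomial is itself a Minkowski expansion for the family of
  copies of K and of the ball, with coefficients depending only on how many indices of a tuple point
  to a ball. At the identity tuple this number is j.\<close>

lemma quermassintegral_eq:
  fixes K :: "(real ^ 'n) set"
  assumes K: "compact K" "convex K" "K \<noteq> {}" and j: "j \<le> CARD('n)"
    and steiner: "\<And>t. 0 \<le> t \<Longrightarrow> vol (K + cball 0 t) = (\<Sum>m\<le>CARD('n). real (CARD('n) choose m) * w m * t ^ m)"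
    and top: "w CARD('n) = unit_ball_vol (real CARD('n))"
  shows "quermassintegral j K = w j"
proof -
  let ?n = "CARD('n)" and ?B = "cball (0 :: real ^ 'n) 1"
  let ?K = "\<lambda>i. if i < ?n - j then K else ?B"
  let ?A = "{..<?n - j}" and ?C = "{?n - j..<?n}"
  let ?c = "\<lambda>f. w (card {i \<in> {..<?n}. f i \<in> ?C})"
  have un: "{..<?n} = ?A \<union> ?C" using j by auto
  have "minkowski_coefficients ?K ?c"
    unfolding minkowski_coefficients_def Let_def
  proof (intro conjI ballI allI impI)
    fix f p assume f: "f \<in> {..<?n} \<rightarrow>\<^sub>E {..<?n}" and p: "p permutes {..<?n}"
    have "p ` {i \<in> {..<?n}. (f \<circ> p) i \<in> ?C} = {i \<in> {..<?n}. f i \<in> ?C}"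
    proof (intro equalityI subsetI)
      fix i assume "i \<in> {i \<in> {..<?n}. f i \<in> ?C}"
      then have "i = p (inv p i)" "inv p i \<in> {i \<in> {..<?n}. (f \<circ> p) i \<in> ?C}"
        using permutes_inverses(1)[OF p] permutes_in_image[OF permutes_inv[OF p], of i] by auto
      then show "i \<in> p ` {i \<in> {..<?n}. (f \<circ> p) i \<in> ?C}" by blast
    qed (use permutes_in_image[OF p] in auto)
    then have "card {i \<in> {..<?n}. (f \<circ> p) i \<in> ?C} = card {i \<in> {..<?n}. f i \<in> ?C}"
      using card_image[OF permutes_inj_on[OF p], of "{i \<in> {..<?n}. (f \<circ> p) i \<in> ?C}"] by (simp only:)
    then show "?c (f \<circ> p) = ?c f" by simp
  next
    fix l :: "nat \<Rightarrow> real" assume l: "\<forall>i<?n. 0 \<le> l i"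
    have nonneg: "0 \<le> sum l ?A" "0 \<le> sum l ?C" using l by (auto intro!: sum_nonneg)
    have "(\<Sum>i<?n. (\<lambda>x. l i *\<^sub>R x) ` ?K i) = (\<Sum>i\<in>?A. (\<lambda>x. l i *\<^sub>R x) ` K) + (\<Sum>i\<in>?C. (\<lambda>x. l i *\<^sub>R x) ` ?B)"
      unfolding un by (subst sum.union_disjoint) auto
    \<comment> \<open>By convexity, scaled copies of one body add up to a single copy scaled by the
      sum of the factors.\<close>
    also have "\<dots> = (\<lambda>x. sum l ?A *\<^sub>R x) ` K + (\<lambda>x. sum l ?C *\<^sub>R x) ` ?B"
      using l K by (subst (1 2) sum_scaleR_convex) auto
    finally have "vol (\<Sum>i<?n. (\<lambda>x. l i *\<^sub>R x) ` ?K i) =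
        (\<Sum>m\<le>?n. real (?n choose m) * (w m * (sum l ?A ^ (?n - m) * sum l ?C ^ m)))"
      using vol_scaled_plus_ball[OF K(1,3) nonneg, of w] steiner top by simp
    also have "\<dots> = (\<Sum>f\<in>{..<?n} \<rightarrow>\<^sub>E (?A \<union> ?C). ?c f * (\<Prod>i<?n. l (f i)))"
      by (subst sum_prod_split) auto
    finally show "vol (\<Sum>i<?n. (\<lambda>x. l i *\<^sub>R x) ` ?K i) = (\<Sum>f\<in>{..<?n} \<rightarrow>\<^sub>E {..<?n}. ?c f * (\<Prod>i<?n. l (f i)))"
      by (simp only: un[symmetric])
  qed
  then have "quermassintegral j K = ?c (\<lambda>i\<in>{..<?n}. i)"
    unfolding quermassintegral_def by (rule mixed_volume_eq)
  also have "{i \<in> {..<?n}. (\<lambda>i\<in>{..<?n}. i) i \<in> ?C} = ?C" by auto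
  finally show ?thesis using j by simp
qed

section \<open>Kubota's formula and the symmetrization defect\<close>

lemma kubota:
  fixes K :: "(real ^ 'n) set"
  assumes K: "compact K" "convex K" "K \<noteq> {}" and k: "1 \<le> k" "k \<le> CARD('n)"
  shows "quermassintegral (CARD('n) - k) K =
    unit_ball_vol (real CARD('n)) / unit_ball_vol (real k) * (\<integral>E. proj_vol K E \<partial>Gr_measure k)"
proof -
  let ?n = "CARD('n)" and ?B = "cball (0 :: real ^ 'n) 1" and ?\<kappa> = "unit_ball_vol (real CARD('n))"
  \<comment> \<open>In top degree the complement of independent generators is {0}, where all
    nonempty sets have the same projection. So this coefficient is the same for K and the ball, as
    the normalisation in \<open>quermassintegral_eq\<close> demands.\<close>
  have top: "mean_vol_diff ?n K = mean_vol_diff ?n ?B"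
    unfolding mean_vol_diff_def
  proof (intro Bochner_Integration.integral_cong refl)
    fix u :: "nat \<Rightarrow> real ^ 'n"
    let ?E = "(span (u ` {..<?n}))\<^sup>\<bottom>"
    have E: "subspace ?E" by (rule subspace_orthogonal_comp)
    have 1: "vol_diff u {..<?n} K * unit_ball_vol (real (dim ?E)) = vol_diff u {..<?n} ?B * proj_vol K ?E"
      by (rule vol_diff_proj_vol(1)[OF _ K(1,2)]) simp
    have \<kappa>: "unit_ball_vol (real (dim ?E)) \<noteq> 0"
      by (rule less_imp_neq[OF unit_ball_vol_pos, symmetric]) simp
    show "vol_diff u {..<?n} K = vol_diff u {..<?n} ?B"
    proof (cases "vol_diff u {..<?n} ?B = 0")
      case False
      then have "dim ?E = 0" using vol_diff_proj_vol(2)[of "{..<?n}" ?B u] by simp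
      then have E0: "?E = {0}" using subspace_0[OF E] by (auto simp: dim_eq_0)
      have "orth_proj ?E ` X = {0}" if "X \<noteq> {}" for X
        using orth_proj_mem(1)[OF E] that unfolding E0 by (auto simp: image_iff)
      then have "proj_vol K ?E = proj_vol ?B ?E" using K(3) by (simp add: proj_vol_def)
      then show ?thesis using 1 \<kappa> by (simp add: proj_vol_cball[OF E])
    qed (use 1 \<kappa> in simp)
  qed
  have "quermassintegral (?n - k) K = ?\<kappa> * mean_vol_diff (?n - k) K / mean_vol_diff (?n - k) ?B"
  proof (rule quermassintegral_eq[OF K])
    show "vol (K + cball 0 t) = (\<Sum>m\<le>?n. real (?n choose m) * (?\<kappa> * mean_vol_diff m K / mean_vol_diff m ?B) * t ^ m)"
      if "0 \<le> t" for t by (rule vol_plus_cball[OF K that])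
    show "?\<kappa> * mean_vol_diff ?n K / mean_vol_diff ?n ?B = ?\<kappa>"
      using mean_vol_diff_cball_pos[of ?n, where 'n='n] by (simp add: top)
  qed simp
  also have "\<dots> = ?\<kappa> * (mean_vol_diff (?n - k) K / mean_vol_diff (?n - k) ?B)" by simp
  also have "\<dots> = ?\<kappa> * ((\<integral>E. proj_vol K E \<partial>Gr_measure k) / unit_ball_vol (real k))"
    by (simp only: mean_vol_diff_eq_integral[OF K k])
  finally show ?thesis by simp
qed

lemma linear_image_central_symmetral:
  assumes "linear f"
  shows "f ` central_symmetral K = central_symmetral (f ` K)"
proof -
  have "f ` uminus ` K = uminus ` f ` K"
    by (simp add: image_image linear_neg[OF assms])
  then have "f ` (K + uminus ` K) = f ` K + uminus ` f ` K"
    by (simp add: linear_image_set_plus[OF assms])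
  moreover have "f ` (\<lambda>x. (1/2) *\<^sub>R x) ` S = (\<lambda>x. (1/2) *\<^sub>R x) ` f ` S" for S
    unfolding image_image linear_scale[OF assms] ..
  ultimately show ?thesis by (simp only: central_symmetral_def)
qed

theorem proposition4p1:
  fixes K :: "(real ^ 'n) set" and k :: nat
  assumes "convex_body K" and "1 \<le> k" and "k \<le> CARD('n)"
  shows "symmetrization_defect k K =
    unit_ball_vol (real CARD('n)) / unit_ball_vol (real k) *
    (\<integral>E. (measure (subspace_lborel E) (central_symmetral (orth_proj E ` K))
           - measure (subspace_lborel E) (orth_proj E ` K)) \<partial>Gr_measure k)"
proof -
  note k = assms(2,3)
  let ?C = "central_symmetral K"
  have K: "compact K" "convex K" "K \<noteq> {}"
    using assms(1) by (auto simp: convex_body_def)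
  obtain a where "a \<in> K" using K(3) by blast
  then have "a + - a \<in> K + uminus ` K" by (intro set_plus_intro imageI)
  then have ne: "K + uminus ` K \<noteq> {}" by blast
  have C: "compact ?C" "convex ?C" "?C \<noteq> {}"
    unfolding central_symmetral_def
    using compact_scaling[OF compact_set_plus[OF K(1) compact_negations[OF K(1)]], of "1/2"]
      convex_scaling[OF convex_set_plus[OF K(2) convex_negations[OF K(2)]], of "1/2"] ne
    by (simp_all only: image_is_empty not_False_eq_True)
  have "(\<integral>E. (measure (subspace_lborel E) (central_symmetral (orth_proj E ` K))
           - measure (subspace_lborel E) (orth_proj E ` K)) \<partial>Gr_measure k) =
      (\<integral>E. proj_vol ?C E - proj_vol K E \<partial>Gr_measure k)"
  proof (rule Bochner_Integration.integral_cong)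
    fix E assume "E \<in> space (Gr_measure k :: (real ^ 'n) set measure)"
    then have "subspace E" by (simp add: Gr_measure_eq[OF k] Gr_def)
    then show "measure (subspace_lborel E) (central_symmetral (orth_proj E ` K))
        - measure (subspace_lborel E) (orth_proj E ` K) = proj_vol ?C E - proj_vol K E"
      by (simp add: proj_vol_def linear_image_central_symmetral linear_orth_proj)
  qed simp
  \<comment> \<open>The Bochner integral of a difference splits because both projection volumes are
    measurable and bounded on the Grassmannian.\<close>
  also have "\<dots> = (\<integral>E. proj_vol ?C E \<partial>Gr_measure k) - (\<integral>E. proj_vol K E \<partial>Gr_measure k)"
    by (intro Bochner_Integration.integral_diff integrable_proj_vol C K k)
  finally show ?thesis
    by (simp add: symmetrization_defect_def kubota[OF K k] kubota[OF C k] right_diff_distrib)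
qed

end
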